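(* Let $S$ be an analytic quasi-order on a standard Borel space $Z$, and let $E \subseteq S \cap S^{-1}$ be an analytic equivalence relation on $Z$. Suppose there is a Borel function $f \colon \mathbb{G} \to Z$ such that for all $G,H \in \mathbb{G}$: ($G$ embeds into $H$ as a graph $\iff f(G)\, S\, f(H)$) and ($G = H \iff f(G)\, E\, f(H)$). Let $Y$ be a Polish group, $a$ a Borel action of $Y$ on a standard Borel space $W$, and $g \colon Z \to W$ a Borel reduction of $E$ to the orbit equivalence relation $E_a$. Let $\Sigma \colon \mathbb{G} \to G(Y)$ be defined by $\Sigma(G) = \{y \in Y \mid a(y,(g\circ f)(G)) = (g \circ f)(G)\}$. If $\Sigma$ is Borel, then the pair $(S,E)$ is invariantly universal.
   Context: Borel reducibility: for binary relations $R,R'$ on standard Borel spaces $X,X'$, a Borel $h\colon X\to X'$ with $x\,R\,y \iff h(x)\,R'\,h(y)$ is a Borel reduction, written $R\le_B R'$; $R\sim_B R'$ means $R\le_B R'\le_B R$. For an analytic quasi-order $S$ on a standard Borel space $X$ and an analytic equivalence relation $E\subseteq S\cap S^{-1}$ on $X$, the pair $(S,E)$ is invariantly universal if for every analytic quasi-order $R$ on a standard Borel space there is a Borel $E$-invariant $B\subseteq X$ with $R\sim_B S\restriction B$. $G(Y)$ denotes the standard Borel space of closed subgroups of $Y$ (Effros Borel structure). Definition of $\mathbb{G}$: A normal tree on $2\times\omega$ is a set $T$ of pairs $(u,s)$ with $u\in{}^{<\omega}2$, $s\in{}^{<\omega}\omega$, $|u|=|s|$, closed under taking initial segments (of both coordinates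 simultaneously), such that $(u,s)\in T$ and $s\le t$ pointwise with $|t|=|s|$ imply $(u,t)\in T$. Fix a bijection $\#\colon{}^{<\omega}\omega\to\omega$ and a bijection $\theta\colon{}^{<\omega}2\to\omega$ with $|u|<|v|\Rightarrow\theta(u)<\theta(v)$. Let $G_0$ be the combinatorial tree (connected acyclic graph) obtained from the tree ${}^{<\omega}\omega$ by inserting, for each $s\ne\emptyset$, a new vertex $s^*$ between $s\restriction(|s|-1)$ and $s$. Let $G_1$ be obtained from $G_0$ by adding, for each $s\in{}^{<\omega}\omega$, vertices $s^+, s^{++}$ and $(s^{++},i,j)$ for $0\le j\le i\le \#s+2$, with edges $s - s^+$, $s^+ - s^{++}$, $s^{++} - (s^{++},i,0)$ and $(s^{++},i,j) - (s^{++},i,j+1)$ (when defined). For a normal tree $T$ on $2\times\omega$, $G_T$ is obtained from $G_1$ by adding, for each $(u,s)\in T$, vertices $(u,s,x)$ where $x$ is an initial segment of $0^{2\theta(u)+4}$ or $x=0^{2\theta(u)+2}{}^\frown 1$, with edges $(u,s,\emptyset) - s$ and $(u,s,x)-(u,s,x')$ whenever one of $x,x'$ is an immediate successor of the other. Each $G_T$ is coded, Borel in $T$, as a graph on $\omega$ (an element of the Polish space of graphs on $\omega$), and $\mathbb{G}$ is the set of all these codes $G_T$; $\mathbb{G}$ is a Borel subset of the space of graphs on $\omega$, hence a standard Borel space. *)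

theory Defs
  imports "HOL-Analysis.Analysis" "HOL-Algebra.Group_Action" "HOL-Library.Sublist"
begin

section \<open>Descriptive set theory\<close>

text \<open>
  A measurable space is represented by the \<open>space\<close> and \<open>sets\<close> components of a library measure
  (the measure itself is irrelevant), so Borel functions are the elements of \<open>measurable\<close>.
\<close>

definition polish_topology :: "'a topology \<Rightarrow> bool" where
  "polish_topology \<tau> \<longleftrightarrow> completely_metrizable_space \<tau> \<and> separable_space \<tau>"

definition borel_of :: "'a topology \<Rightarrow> 'a measure" where
  "borel_of \<tau> = sigma (topspace \<tau>) {U. openin \<tau> U}"

definition standard_borel :: "'a measure \<Rightarrow> bool" where
  "standard_borel M \<longleftrightarrow>
     (\<exists>\<tau>. polish_topology \<tau> \<and> space M = topspace \<tau> \<and> sets M = sets (borel_of \<tau>))"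

text \<open>The analytic subsets of \<open>M\<close> are the projections of the Borel subsets of \<open>M \<times> \<omega>\<^sup>\<omega>\<close>.\<close>

definition analytic_in :: "'a measure \<Rightarrow> 'a set \<Rightarrow> bool" where
  "analytic_in M A \<longleftrightarrow> (\<exists>B \<in> sets (M \<Otimes>\<^sub>M (borel :: (nat \<Rightarrow> nat) measure)). A = fst ` B)"

definition analytic_quasi_order :: "'a measure \<Rightarrow> 'a rel \<Rightarrow> bool" where
  "analytic_quasi_order M R \<longleftrightarrow> preorder_on (space M) R \<and> analytic_in (M \<Otimes>\<^sub>M M) R"

definition analytic_equivalence :: "'a measure \<Rightarrow> 'a rel \<Rightarrow> bool" where
  "analytic_equivalence M E \<longleftrightarrow> equiv (space M) E \<and> analytic_in (M \<Otimes>\<^sub>M M) E"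

definition borel_reduction ::
    "'a measure \<Rightarrow> 'a rel \<Rightarrow> 'b measure \<Rightarrow> 'b rel \<Rightarrow> ('a \<Rightarrow> 'b) \<Rightarrow> bool" where
  "borel_reduction M R N R' h \<longleftrightarrow>
     h \<in> measurable M N \<and> (\<forall>x\<in>space M. \<forall>y\<in>space M. (x, y) \<in> R \<longleftrightarrow> (h x, h y) \<in> R')"

definition borel_reducible :: "'a measure \<Rightarrow> 'a rel \<Rightarrow> 'b measure \<Rightarrow> 'b rel \<Rightarrow> bool" where
  "borel_reducible M R N R' \<longleftrightarrow> (\<exists>h. borel_reduction M R N R' h)"

definition borel_bireducible :: "'a measure \<Rightarrow> 'a rel \<Rightarrow> 'b measure \<Rightarrow> 'b rel \<Rightarrow> bool" where
  "borel_bireducible M R N R' \<longleftrightarrow> borel_reducible M R N R' \<and> borel_reducible N R' M R"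

text \<open>
  The type argument supplies the underlying type of the standard Borel spaces \<open>X\<close>, over which
  HOL cannot quantify inside a formula. A statement with this type left as a type variable
  covers all standard Borel spaces.
\<close>

definition invariantly_universal :: "'r itself \<Rightarrow> 'z measure \<Rightarrow> 'z rel \<Rightarrow> 'z rel \<Rightarrow> bool" where
  "invariantly_universal (_ :: 'r itself) Z S E \<longleftrightarrow>
     (\<forall>(X :: 'r measure) R. standard_borel X \<and> analytic_quasi_order X R \<longrightarrow>
        (\<exists>B \<in> sets Z. E `` B \<subseteq> B \<and>
           borel_bireducible X R (restrict_space Z B) (S \<inter> B \<times> B)))"

section \<open>Polish groups\<close>

definition polish_group :: "('y, 'm) monoid_scheme \<Rightarrow> 'y topology \<Rightarrow> bool" where
  "polish_group Y \<tau> \<longleftrightarrow> group Y \<and> topspace \<tau> = carrier Y \<and> polish_topology \<tau> \<and>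
     continuous_map (prod_topology \<tau> \<tau>) \<tau> (\<lambda>(x, y). x \<otimes>\<^bsub>Y\<^esub> y) \<and>
     continuous_map \<tau> \<tau> (\<lambda>x. inv\<^bsub>Y\<^esub> x)"

text \<open>
  As for every \<open>group_action\<close>, each \<open>a y\<close> is extensional: its value outside \<open>space W\<close> is
  \<open>undefined\<close>.
\<close>

definition borel_action ::
    "('y, 'm) monoid_scheme \<Rightarrow> 'y topology \<Rightarrow> 'w measure \<Rightarrow> ('y \<Rightarrow> 'w \<Rightarrow> 'w) \<Rightarrow> bool" where
  "borel_action Y \<tau> W a \<longleftrightarrow> group_action Y (space W) a \<and>
     (\<lambda>(y, w). a y w) \<in> measurable (borel_of \<tau> \<Otimes>\<^sub>M W) W"

definition orbit_equivalence ::
    "('y, 'm) monoid_scheme \<Rightarrow> 'w measure \<Rightarrow> ('y \<Rightarrow> 'w \<Rightarrow> 'w) \<Rightarrow> 'w rel" where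
  "orbit_equivalence Y W a = {(v, w). v \<in> space W \<and> w \<in> orbit Y a v}"

text \<open>The space \<open>G(Y)\<close> of closed subgroups with the Effros Borel structure.\<close>

definition closed_subgroups :: "('y, 'm) monoid_scheme \<Rightarrow> 'y topology \<Rightarrow> 'y set set" where
  "closed_subgroups Y \<tau> = {H. subgroup H Y \<and> closedin \<tau> H}"

definition effros_subgroups :: "('y, 'm) monoid_scheme \<Rightarrow> 'y topology \<Rightarrow> 'y set measure" where
  "effros_subgroups Y \<tau> = sigma (closed_subgroups Y \<tau>)
     {{H \<in> closed_subgroups Y \<tau>. H \<inter> U \<noteq> {}} |U. openin \<tau> U}"

section \<open>The graphs coding normal trees\<close>

text \<open>The Cantor space of all subsets of a countable type, via characteristic functions.\<close>

definition powerset_borel :: "'a set measure" where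
  "powerset_borel = vimage_algebra UNIV (\<lambda>A x. x \<in> A) (borel :: ('a \<Rightarrow> bool) measure)"

definition graphs_on_nat :: "nat rel set" where
  "graphs_on_nat = {G. sym G \<and> irrefl G}"

definition graph_embeds :: "nat rel \<Rightarrow> nat rel \<Rightarrow> bool" where
  "graph_embeds G H \<longleftrightarrow> (\<exists>f. inj f \<and> (\<forall>x y. (x, y) \<in> G \<longleftrightarrow> (f x, f y) \<in> H))"

text \<open>In binary sequences, \<open>False\<close> stands for 0 and \<open>True\<close> for 1.\<close>

definition normal_tree :: "(bool list \<times> nat list) set \<Rightarrow> bool" where
  "normal_tree T \<longleftrightarrow>
     (\<forall>(u, s)\<in>T. length u = length s) \<and>
     (\<forall>(u, s)\<in>T. \<forall>n\<le>length s. (take n u, take n s) \<in> T) \<and>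
     (\<forall>(u, s)\<in>T. \<forall>t. list_all2 (\<le>) s t \<longrightarrow> (u, t) \<in> T)"

text \<open>
  The constructors stand for \<open>s\<close>, \<open>s\<^sup>*\<close>, \<open>s\<^sup>+\<close>, \<open>s\<^sup>+\<^sup>+\<close>, \<open>(s\<^sup>+\<^sup>+, i, j)\<close> and \<open>(u, s, x)\<close>.
\<close>

datatype vertex =
    Node "nat list"
  | Star "nat list"
  | Plus "nat list"
  | PlusPlus "nat list"
  | Path "nat list" nat nat
  | Fork "bool list" "nat list" "bool list"

definition fork :: "(bool list \<Rightarrow> nat) \<Rightarrow> bool list \<Rightarrow> bool list set" where
  "fork \<theta> u = {x. prefix x (replicate (2 * \<theta> u + 4) False)} \<union>
     {replicate (2 * \<theta> u + 2) False @ [True]}"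

definition GT_vertices ::
    "(nat list \<Rightarrow> nat) \<Rightarrow> (bool list \<Rightarrow> nat) \<Rightarrow> (bool list \<times> nat list) set \<Rightarrow> vertex set" where
  "GT_vertices num \<theta> T =
     range Node \<union> {Star s |s. s \<noteq> []} \<union> range Plus \<union> range PlusPlus \<union>
     {Path s i j |s i j. j \<le> i \<and> i \<le> num s + 2} \<union>
     {Fork u s x |u s x. (u, s) \<in> T \<and> x \<in> fork \<theta> u}"

inductive_set GT_arcs ::
    "(nat list \<Rightarrow> nat) \<Rightarrow> (bool list \<Rightarrow> nat) \<Rightarrow> (bool list \<times> nat list) set \<Rightarrow> vertex rel"
  for num :: "nat list \<Rightarrow> nat" and \<theta> :: "bool list \<Rightarrow> nat"
    and T :: "(bool list \<times> nat list) set" where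
  node_star: "s \<noteq> [] \<Longrightarrow> (Node (butlast s), Star s) \<in> GT_arcs num \<theta> T"
| star_node: "s \<noteq> [] \<Longrightarrow> (Star s, Node s) \<in> GT_arcs num \<theta> T"
| node_plus: "(Node s, Plus s) \<in> GT_arcs num \<theta> T"
| plus_plus: "(Plus s, PlusPlus s) \<in> GT_arcs num \<theta> T"
| path_start: "i \<le> num s + 2 \<Longrightarrow> (PlusPlus s, Path s i 0) \<in> GT_arcs num \<theta> T"
| path_step: "j < i \<Longrightarrow> i \<le> num s + 2 \<Longrightarrow> (Path s i j, Path s i (Suc j)) \<in> GT_arcs num \<theta> T"
| fork_start: "(u, s) \<in> T \<Longrightarrow> (Node s, Fork u s []) \<in> GT_arcs num \<theta> T"
| fork_step: "(u, s) \<in> T \<Longrightarrow> x \<in> fork \<theta> u \<Longrightarrow> x @ [b] \<in> fork \<theta> u \<Longrightarrow>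
    (Fork u s x, Fork u s (x @ [b])) \<in> GT_arcs num \<theta> T"

definition GT_edges ::
    "(nat list \<Rightarrow> nat) \<Rightarrow> (bool list \<Rightarrow> nat) \<Rightarrow> (bool list \<times> nat list) set \<Rightarrow> vertex rel" where
  "GT_edges num \<theta> T = GT_arcs num \<theta> T \<union> (GT_arcs num \<theta> T)\<inverse>"

text \<open>
  A coding of the \<open>G\<^sub>T\<close> is any Borel assignment to each normal tree \<open>T\<close> of a graph on \<open>\<omega>\<close>
  isomorphic to \<open>G\<^sub>T\<close>.
\<close>

definition GT_coding :: "(nat list \<Rightarrow> nat) \<Rightarrow> (bool list \<Rightarrow> nat) \<Rightarrow>
    ((bool list \<times> nat list) set \<Rightarrow> nat rel) \<Rightarrow> bool" where
  "GT_coding num \<theta> c \<longleftrightarrow>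
     c \<in> measurable (restrict_space powerset_borel {T. normal_tree T})
                    (restrict_space powerset_borel graphs_on_nat) \<and>
     (\<forall>T. normal_tree T \<longrightarrow>
        (\<exists>h. bij_betw h (GT_vertices num \<theta> T) UNIV \<and>
          (\<forall>v\<in>GT_vertices num \<theta> T. \<forall>w\<in>GT_vertices num \<theta> T.
             (v, w) \<in> GT_edges num \<theta> T \<longleftrightarrow> (h v, h w) \<in> c T)))"

definition coded_graphs :: "((bool list \<times> nat list) set \<Rightarrow> nat rel) \<Rightarrow> nat rel measure" where
  "coded_graphs c = restrict_space powerset_borel (c ` {T. normal_tree T})"

end

theory Submission
  imports Defs
begin

text \<open>
  Let \<open>R\<close> be an analytic quasi-order on \<open>X\<close>. Coding \<open>X\<close> by points of the Cantor space and unfolding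
  the closed set whose projection is \<open>R\<close>, one obtains normal trees \<open>T\<^sub>x\<close> such that \<open>x R y\<close> iff some
  Lipschitz map \<open>h\<close> on finite sequences sends \<open>(u, s) \<in> T\<^sub>x\<close> to \<open>(u, h s) \<in> T\<^sub>y\<close> (Louveau and
  Rosendal). Such an \<open>h\<close> exists iff the graph \<open>G\<^sub>x\<close> of \<open>T\<^sub>x\<close> embeds into the graph \<open>G\<^sub>y\<close> of \<open>T\<^sub>y\<close>: the root is
  recognised by its fork, forks are recognised because they branch at odd distance from the
  nodes, and the length of its stem identifies \<open>u\<close>. So \<open>\<phi> x = f (G\<^sub>x)\<close> reduces \<open>R\<close> to \<open>S\<close>, and
  distinct points have \<open>E\<close>-inequivalent images because the degrees of the vertices \<open>s\<^sup>+\<^sup>+\<close> make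
  \<open>T\<^sub>x\<close>, and \<open>T\<^sub>x\<close> makes \<open>x\<close>, recoverable from \<open>G\<^sub>x\<close>.

  Let \<open>B\<close> be the \<open>E\<close>-saturation of the range of \<open>\<phi>\<close>. It is the \<open>g\<close>-preimage of the saturation of
  \<open>g (\<phi> x)\<close> under the action. As the stabilizers \<open>\<Sigma>\<^sub>x\<close> depend on \<open>x\<close> in a Borel way, there is a Borel
  set \<open>P\<close> of pairs \<open>(x, y)\<close> containing exactly one \<open>y\<close> from every coset of \<open>\<Sigma>\<^sub>x\<close>. On \<open>P\<close> the
  map \<open>(x, y) \<mapsto> y g(\<phi> x)\<close> is injective, so by the Lusin-Souslin theorem its images of Borel
  sets are Borel. Hence \<open>B\<close> is Borel and the map from \<open>B\<close> back to \<open>X\<close> is Borel.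
\<close>

section \<open>Graphs of normal trees\<close>

text \<open>The tree of a closed set projecting onto \<open>R\<close> is not enough: pushing a
  witness of \<open>z R x\<close> forward along \<open>x R y\<close> would need a witness of
  \<open>z R y\<close> computed entry by entry, and transitivity of \<open>R\<close> gives none. So
  single relations between approximations are replaced by chains. One number bounds the length of a
  chain, one sequence bounds all its witnesses, and such bounds compose by pointwise addition, which
  is a Lipschitz map. Because witnesses are bounded and points are binary, Koenig's lemma recovers a
  genuine chain of fixed length in the limit, and transitivity then collapses it. A graph embedding
  demands more than a Lipschitz map: the paths at \<open>h s\<close> must be at least as many and as
  long as those at \<open>s\<close>, so \<open>num\<close> may not decrease. Normality of the target
  tree permits enlarging the map pointwise until this holds. The saturation of a Borel set is a
  priori only analytic, which is why an injective parametrization is sought. Standard Borel spaces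
  enter through Borel isomorphisms with subsets of the Cantor space, where points can be recovered
  digit by digit.\<close>

lemma prefix_replicate_iff: "prefix x (replicate m b) \<longleftrightarrow> (\<exists>k\<le>m. x = replicate k b)"
proof
  assume "prefix x (replicate m b)"
  then obtain y where y: "replicate m b = x @ y" by (auto simp: prefix_def)
  then have "length x \<le> m" "x = take (length x) (replicate m b)"
    by (metis length_append length_replicate le_add1) (simp add: y)
  then show "\<exists>k\<le>m. x = replicate k b" by (metis min.absorb1 take_replicate)
next
  assume "\<exists>k\<le>m. x = replicate k b"
  then obtain k where k: "k \<le> m" "x = replicate k b" by blast
  then have "replicate m b = x @ replicate (m - k) b" by (simp flip: replicate_add)
  then show "prefix x (replicate m b)" by (auto simp: prefix_def)
qed

definition zeros :: "nat \<Rightarrow> bool list" where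
  "zeros k = replicate k False"

lemma length_zeros [simp]: "length (zeros k) = k"
  by (simp add: zeros_def)

lemma zeros_inject [simp]: "zeros k = zeros m \<longleftrightarrow> k = m"
  by (metis length_zeros)

lemma zeros_eq_Nil [simp]: "zeros k = [] \<longleftrightarrow> k = 0" "[] = zeros k \<longleftrightarrow> k = 0"
  by (auto simp: zeros_def)

lemma zeros_0 [simp]: "zeros 0 = []"
  by simp

lemma zeros_snoc_False [simp]: "zeros k @ [False] = zeros (Suc k)"
  by (simp add: zeros_def replicate_append_same)

lemma snoc_eq_zeros [simp]: "y @ [b] = zeros m \<longleftrightarrow> m > 0 \<and> \<not> b \<and> y = zeros (m - 1)"
proof (cases m)
  case (Suc k)
  have "zeros (Suc k) = zeros k @ [False]"
    by (simp add: zeros_def replicate_append_same)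
  then have "y @ [b] = zeros m \<longleftrightarrow> y = zeros k \<and> b = False" using Suc by (metis append1_eq_conv)
  then show ?thesis using Suc by auto
qed auto

lemma zeros_eq_snoc [simp]: "zeros m = y @ [b] \<longleftrightarrow> m > 0 \<and> \<not> b \<and> y = zeros (m - 1)"
  by (metis snoc_eq_zeros)

lemma snoc2_eq_zeros [simp]: "y @ [True, b] \<noteq> zeros m"
  using snoc_eq_zeros[of "y @ [True]" b m] by (auto simp del: snoc_eq_zeros) simp

lemma fork_eq: "fork \<theta> u = insert (zeros (2 * \<theta> u + 2) @ [True]) (zeros ` {..2 * \<theta> u + 4})"
  unfolding fork_def zeros_def by (auto simp: prefix_replicate_iff)

lemma zeros_in_fork: "zeros k \<in> fork \<theta> u \<longleftrightarrow> k \<le> 2 * \<theta> u + 4"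
  by (auto simp: fork_eq)

lemma zeros_snoc_in_fork:
  "zeros k @ [b] \<in> fork \<theta> u \<longleftrightarrow> (if b then k = 2 * \<theta> u + 2 else k < 2 * \<theta> u + 4)"
  by (cases b) (auto simp: fork_eq image_iff)

section \<open>Adjacency, parity and degrees in the graph of a normal tree\<close>

locale gt_graphs =
  fixes num :: "nat list \<Rightarrow> nat" and \<theta> :: "bool list \<Rightarrow> nat"
  assumes bij_num: "bij num" and bij_\<theta>: "bij \<theta>"
    and \<theta>_mono: "length u < length v \<Longrightarrow> \<theta> u < \<theta> v"
begin

abbreviation "V \<equiv> GT_vertices num \<theta>"
abbreviation "A \<equiv> GT_arcs num \<theta>"
abbreviation "E \<equiv> GT_edges num \<theta>"

lemma edge_sym: "(v, w) \<in> E T \<Longrightarrow> (w, v) \<in> E T"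
  by (auto simp: GT_edges_def)

lemma edge_Node: "(Node s, w) \<in> E T \<longleftrightarrow> (\<exists>n. w = Star (s @ [n])) \<or> (s \<noteq> [] \<and> w = Star s) \<or>
    w = Plus s \<or> (\<exists>u. (u, s) \<in> T \<and> w = Fork u s [])"
proof -
  have "(Node s, Star (s @ [n])) \<in> A T" for n
    using GT_arcs.node_star[of "s @ [n]" num \<theta> T] by simp
  moreover have snoc: "\<exists>n. t = r @ [n]" if "r = butlast t" "t \<noteq> []" for r t :: "nat list"
    using that by (metis append_butlast_last_id)
  ultimately show ?thesis
    unfolding GT_edges_def
    by (auto intro: GT_arcs.intros elim!: GT_arcs.cases dest: snoc)
qed

lemma edge_Star: "(Star s, w) \<in> E T \<longleftrightarrow> s \<noteq> [] \<and> (w = Node (butlast s) \<or> w = Node s)"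
  unfolding GT_edges_def by (auto intro: GT_arcs.intros elim!: GT_arcs.cases)

lemma edge_Plus: "(Plus s, w) \<in> E T \<longleftrightarrow> w = Node s \<or> w = PlusPlus s"
  unfolding GT_edges_def by (auto intro: GT_arcs.intros elim!: GT_arcs.cases)

lemma edge_PlusPlus: "(PlusPlus s, w) \<in> E T \<longleftrightarrow> w = Plus s \<or> (\<exists>i\<le>num s + 2. w = Path s i 0)"
  unfolding GT_edges_def by (auto intro: GT_arcs.intros elim!: GT_arcs.cases)

lemma edge_Path: "(Path s i j, w) \<in> E T \<longleftrightarrow> i \<le> num s + 2 \<and>
   (j = 0 \<and> w = PlusPlus s \<or> (\<exists>k. j = Suc k \<and> j \<le> i \<and> w = Path s i k) \<or> j < i \<and> w = Path s i (Suc j))"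
  unfolding GT_edges_def by (auto intro: GT_arcs.intros elim!: GT_arcs.cases)

lemma edge_Fork: "(Fork u s x, w) \<in> E T \<longleftrightarrow> (u, s) \<in> T \<and> x \<in> fork \<theta> u \<and>
   (x = [] \<and> w = Node s \<or> (\<exists>y b. x = y @ [b] \<and> y \<in> fork \<theta> u \<and> w = Fork u s y) \<or>
    (\<exists>b. x @ [b] \<in> fork \<theta> u \<and> w = Fork u s (x @ [b])))"
proof -
  have "[] \<in> fork \<theta> u" by (auto simp: fork_eq)
  then show ?thesis
    unfolding GT_edges_def by (auto intro: GT_arcs.intros elim!: GT_arcs.cases)
qed

lemma edge_Fork_zeros: "(Fork u s (zeros k), w) \<in> E T \<longleftrightarrow> (u, s) \<in> T \<and> k \<le> 2 * \<theta> u + 4 \<and>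
   (k = 0 \<and> w = Node s \<or> (k > 0 \<and> w = Fork u s (zeros (k - 1))) \<or>
    (k < 2 * \<theta> u + 4 \<and> w = Fork u s (zeros (Suc k))) \<or>
    (k = 2 * \<theta> u + 2 \<and> w = Fork u s (zeros k @ [True])))"
proof (cases "(u, s) \<in> T \<and> k \<le> 2 * \<theta> u + 4")
  case True
  then have "zeros (k - 1) \<in> fork \<theta> u" by (auto simp: zeros_in_fork)
  then show ?thesis
    using True unfolding edge_Fork ex_bool_eq
    by (auto simp: zeros_in_fork zeros_snoc_in_fork)
qed (auto simp: edge_Fork zeros_in_fork)

lemma edge_Fork_True: "(Fork u s (zeros (2 * \<theta> u + 2) @ [True]), w) \<in> E T \<Longrightarrow>
   w = Fork u s (zeros (2 * \<theta> u + 2))"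
  unfolding edge_Fork
  by (auto simp: fork_eq image_iff dest: arg_cong[of _ _ butlast])

lemmas edge_simps = edge_Node edge_Star edge_Plus edge_PlusPlus edge_Path edge_Fork_zeros

lemma edge_vertices: "(v, w) \<in> E T \<Longrightarrow> v \<in> V T"
proof -
  have "[] \<in> fork \<theta> u" for u by (auto simp: fork_eq)
  then show "(v, w) \<in> E T \<Longrightarrow> v \<in> V T"
    unfolding GT_edges_def GT_vertices_def
    by (auto elim!: GT_arcs.cases)
qed

text \<open>This is the bipartition of the graph by the parity of the distance to the attached node.
  For \<open>Path s i j\<close> that distance is \<open>j + 3\<close>, for \<open>Fork u s x\<close>
  it is \<open>length x + 1\<close>.\<close>

fun even_vertex :: "vertex \<Rightarrow> bool" where
  "even_vertex (Node s) = True"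
| "even_vertex (Star s) = False"
| "even_vertex (Plus s) = False"
| "even_vertex (PlusPlus s) = True"
| "even_vertex (Path s i j) = odd j"
| "even_vertex (Fork u s x) = odd (length x)"

lemma edge_parity: "(v, w) \<in> E T \<Longrightarrow> even_vertex w \<longleftrightarrow> \<not> even_vertex v"
  unfolding GT_edges_def by (auto elim!: GT_arcs.cases)

lemma fork_cases:
  assumes "(Fork u s x, w) \<in> E T"
  obtains k where "k \<le> 2 * \<theta> u + 4" "x = zeros k" | "x = zeros (2 * \<theta> u + 2) @ [True]"
  using assms unfolding edge_Fork by (auto simp: fork_eq)

text \<open>Inner vertices of paths and stems have two neighbours, and their ends have one. Of the
  three kinds that remain, only the forks branch at odd parity: their branching vertex is at
  distance \<open>2 * \<theta> u + 3\<close> from the node, a plus-plus vertex at distance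
  2.\<close>

lemma branching_vertex:
  assumes "(v, a) \<in> E T" "(v, b) \<in> E T" "(v, c) \<in> E T" "a \<noteq> b" "a \<noteq> c" "b \<noteq> c"
  shows "(\<exists>s. v = Node s) \<or> (\<exists>s. v = PlusPlus s) \<or>
    (\<exists>u s. (u, s) \<in> T \<and> v = Fork u s (zeros (2 * \<theta> u + 2)))"
proof (cases v)
  case (Fork u s x)
  from assms(1) have ux: "(Fork u s x, a) \<in> E T" using Fork by simp
  from ux show ?thesis
  proof (cases rule: fork_cases)
    case (1 k)
    show ?thesis using assms unfolding Fork 1 edge_simps
      by (cases "k = 2 * \<theta> u + 2") auto
  next
    case 2
    then show ?thesis using assms Fork edge_Fork_True by metis
  qed
qed (use assms in \<open>auto simp: edge_simps\<close>)

text \<open>Together with \<open>infinite_neighbours_Node\<close> this characterizes the nodes by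
  their degree, so every embedding has to map nodes to nodes.\<close>

lemma finite_neighbours:
  assumes "\<And>s. v \<noteq> Node s"
  shows "finite {w. (v, w) \<in> E T}"
proof (cases v)
  case (Node s)
  then show ?thesis using assms by blast
next
  case (Star s)
  show ?thesis by (rule finite_subset[of _ "{Node s, Node (butlast s)}"]) (auto simp: Star edge_Star)
next
  case (Plus s)
  show ?thesis by (rule finite_subset[of _ "{Node s, PlusPlus s}"]) (auto simp: Plus edge_Plus)
next
  case (PlusPlus s)
  show ?thesis
    by (rule finite_subset[of _ "insert (Plus s) ((\<lambda>i. Path s i 0) ` {..num s + 2})"])
      (auto simp: PlusPlus edge_PlusPlus)
next
  case (Path s i j)
  show ?thesis
    by (rule finite_subset[of _ "{PlusPlus s, Path s i (j - 1), Path s i (Suc j)}"])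
      (auto simp: Path edge_Path)
next
  case (Fork u s x)
  show ?thesis
    by (rule finite_subset[of _ "{Node s, Fork u s (butlast x), Fork u s (x @ [True]), Fork u s (x @ [False])}"])
      (auto simp: Fork edge_Fork split: bool.splits)
qed

lemma infinite_neighbours_Node: "infinite {w. (Node s, w) \<in> E T}"
proof
  assume "finite {w. (Node s, w) \<in> E T}"
  moreover have "range (\<lambda>n. Star (s @ [n])) \<subseteq> {w. (Node s, w) \<in> E T}" by (auto simp: edge_Node)
  moreover have "inj (\<lambda>n. Star (s @ [n]))" by (auto simp: inj_on_def)
  ultimately show False using finite_subset range_inj_infinite by blast
qed

text \<open>Only stars join two different nodes. The disjunction stays because an embedding might a
  priori exchange predecessor and successor; the root will settle the direction.\<close>

lemma common_neighbour_of_nodes: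
  assumes "(Node s, w) \<in> E T" "(Node t, w) \<in> E T" "s \<noteq> t"
  shows "(\<exists>n. t = s @ [n] \<and> w = Star t) \<or> (\<exists>n. s = t @ [n] \<and> w = Star s)"
proof (cases w)
  case (Star r)
  have "r \<noteq> [] \<Longrightarrow> \<exists>n. r = butlast r @ [n]" by (metis append_butlast_last_id)
  then show ?thesis
    using Star assms(1)[THEN edge_sym] assms(2)[THEN edge_sym] assms(3)
    by (auto simp: edge_Star)
qed (use assms(1)[THEN edge_sym] assms(2)[THEN edge_sym] assms(3)
    in \<open>auto simp: edge_simps edge_Fork\<close>)

lemma \<theta>_Nil: "\<theta> [] = 0"
proof -
  obtain u where u: "\<theta> u = 0" using bij_\<theta> by (metis bij_pointE)
  then show ?thesis using \<theta>_mono[of "[]" u] by (cases u) auto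
qed

lemma \<theta>_inject: "\<theta> u = \<theta> v \<longleftrightarrow> u = v"
  using bij_\<theta> by (meson bij_def inj_eq)

end

section \<open>Rigidity of embeddings between graphs of normal trees\<close>

fun base :: "vertex \<Rightarrow> nat list" where
  "base (Node s) = s"
| "base (Star s) = s"
| "base (Plus s) = s"
| "base (PlusPlus s) = s"
| "base (Path s i j) = s"
| "base (Fork u s x) = s"

text \<open>The index is the distance from the node, so that the whole walk from the node up the
  fork has one numbering. The branching vertex has index \<open>2 * \<theta> u + 3\<close>.\<close>

fun stem :: "bool list \<Rightarrow> nat list \<Rightarrow> nat \<Rightarrow> vertex" where
  "stem u s 0 = Node s"
| "stem u s (Suc i) = Fork u s (zeros i)"

lemma stem_inject [simp]: "stem u s i = stem u s j \<longleftrightarrow> i = j"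
  by (cases i; cases j) auto

locale gt_embedding = gt_graphs +
  fixes S T :: "(bool list \<times> nat list) set" and \<Phi> :: "vertex \<Rightarrow> vertex"
  assumes normal_S: "normal_tree S" and normal_T: "normal_tree T" and root_S: "([], []) \<in> S"
    and inj_\<Phi>: "inj_on \<Phi> (V S)"
    and edge_\<Phi>: "(v, w) \<in> E S \<Longrightarrow> (\<Phi> v, \<Phi> w) \<in> E T"
begin

lemma len_S: "(u, s) \<in> S \<Longrightarrow> length u = length s"
  using normal_S by (auto simp: normal_tree_def)

lemma len_T: "(u, s) \<in> T \<Longrightarrow> length u = length s"
  using normal_T by (auto simp: normal_tree_def)

lemma \<Phi>_neq: "(v, v') \<in> E S \<Longrightarrow> (w, w') \<in> E S \<Longrightarrow> v \<noteq> w \<Longrightarrow> \<Phi> v \<noteq> \<Phi> w"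
  using inj_\<Phi> edge_vertices by (metis inj_on_eq_iff)

lemma \<Phi>_Node: "\<exists>t. \<Phi> (Node s) = Node t"
proof (rule ccontr)
  assume "\<not> ?thesis"
  then have "finite {w. (\<Phi> (Node s), w) \<in> E T}" by (intro finite_neighbours) auto
  moreover have "\<Phi> ` {w. (Node s, w) \<in> E S} \<subseteq> {w. (\<Phi> (Node s), w) \<in> E T}"
    using edge_\<Phi> by auto
  moreover have "inj_on \<Phi> {w. (Node s, w) \<in> E S}"
    using inj_\<Phi> by (rule inj_on_subset) (use edge_sym edge_vertices in blast)
  ultimately show False
    using infinite_neighbours_Node[of s S] by (meson finite_imageD finite_subset)
qed

definition node_map :: "nat list \<Rightarrow> nat list" where
  "node_map s = (THE t. \<Phi> (Node s) = Node t)"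

lemma \<Phi>_node_map: "\<Phi> (Node s) = Node (node_map s)"
  unfolding node_map_def using \<Phi>_Node[of s] by auto

lemma Node_edge: "(Node s, Plus s) \<in> E S"
  by (simp add: edge_Node)

lemma node_map_inject: "node_map s = node_map t \<longleftrightarrow> s = t"
  using \<Phi>_neq[OF Node_edge Node_edge, of s t] by (auto simp: \<Phi>_node_map)

lemma \<Phi>_Star:
  "(\<exists>m. node_map (s @ [n]) = node_map s @ [m] \<and> \<Phi> (Star (s @ [n])) = Star (node_map (s @ [n]))) \<or>
   (\<exists>m. node_map s = node_map (s @ [n]) @ [m] \<and> \<Phi> (Star (s @ [n])) = Star (node_map s))"
proof -
  have "(Node s, Star (s @ [n])) \<in> E S" "(Node (s @ [n]), Star (s @ [n])) \<in> E S"
    by (simp_all add: edge_Node)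
  from this[THEN edge_\<Phi>] show ?thesis
    by (intro common_neighbour_of_nodes) (auto simp: \<Phi>_node_map node_map_inject)
qed

lemma stem_edge:
  assumes "(u, s) \<in> S" "i \<le> 2 * \<theta> u + 2"
  shows "(stem u s i, stem u s (Suc i)) \<in> E S"
  using assms by (cases i) (auto simp: edge_simps edge_Node)

lemma \<Phi>_stem_neq:
  assumes "(u, s) \<in> S" "i \<le> 2 * \<theta> u + 3" "j \<le> 2 * \<theta> u + 3" "i \<noteq> j"
  shows "\<Phi> (stem u s i) \<noteq> \<Phi> (stem u s j)"
proof -
  have *: "\<exists>w. (stem u s i, w) \<in> E S" if "i \<le> 2 * \<theta> u + 3" for i
  proof (cases "i = 2 * \<theta> u + 3")
    case True
    then show ?thesis using stem_edge[OF assms(1), of "2 * \<theta> u + 2", THEN edge_sym]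
      by (metis add_Suc_right le_refl numeral_2_eq_2 numeral_3_eq_3)
  next
    case False
    then show ?thesis using stem_edge[OF assms(1), of i] that by auto
  qed
  show ?thesis using *[OF assms(2)] *[OF assms(3)] \<Phi>_neq assms(4) by (metis stem_inject)
qed

text \<open>
  The branching point of a fork lies at odd distance from the nodes, so it is mapped to a
  branching point of a fork, and following the stem downwards from there one arrives at the
  node to which the image fork is attached.
\<close>

lemma fork_image:
  assumes S: "(u, s) \<in> S"
  obtains v t where "(v, t) \<in> T" "\<theta> v \<le> \<theta> u"
    "\<And>k. k \<le> 2 * \<theta> v + 3 \<Longrightarrow> \<Phi> (stem u s (2 * \<theta> u + 3 - k)) = stem v t (2 * \<theta> v + 3 - k)"
proof -
  define N where "N = 2 * \<theta> u + 2"
  define d where "d i = \<Phi> (stem u s i)" for i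
  have d0: "d 0 = Node (node_map s)" by (simp add: d_def \<Phi>_node_map)
  have step: "(d i, d (Suc i)) \<in> E T" if "i \<le> N" for i
    using stem_edge[OF S, of i] that edge_\<Phi> by (auto simp: d_def N_def)
  have neq: "d i \<noteq> d j" if "i \<le> Suc N" "j \<le> Suc N" "i \<noteq> j" for i j
    using \<Phi>_stem_neq[OF S, of i j] that by (auto simp: d_def N_def)
  have parity: "even_vertex (d i) \<longleftrightarrow> even i" if "i \<le> Suc N" for i
    using that
  proof (induction i)
    case (Suc i)
    then show ?case using edge_parity[OF step[of i]] by auto
  qed (simp add: d0)
  have dN: "d (Suc N) = \<Phi> (Fork u s (zeros N))" by (simp add: d_def)
  obtain v t where vt: "(v, t) \<in> T" "d (Suc N) = Fork v t (zeros (2 * \<theta> v + 2))"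
  proof -
    let ?F = "Fork u s"
    have e: "(?F (zeros N), ?F (zeros (N - 1))) \<in> E S" "(?F (zeros N), ?F (zeros (Suc N))) \<in> E S"
      "(?F (zeros N), ?F (zeros N @ [True])) \<in> E S"
      using S by (auto simp: edge_Fork_zeros N_def)
    have "\<Phi> (?F (zeros (N - 1))) \<noteq> \<Phi> (?F (zeros (Suc N)))"
      "\<Phi> (?F (zeros (N - 1))) \<noteq> \<Phi> (?F (zeros N @ [True]))"
      "\<Phi> (?F (zeros (Suc N))) \<noteq> \<Phi> (?F (zeros N @ [True]))"
      using e[THEN edge_sym] \<Phi>_neq by (auto simp: N_def)
    from branching_vertex[OF e[THEN edge_\<Phi>] this] parity[of "Suc N"] that show ?thesis
      by (auto simp: dN) (auto simp: N_def)
  qed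
  define M where "M = 2 * \<theta> v + 2"
  have dSN: "d (Suc N) = stem v t (Suc M)" using vt by (simp add: M_def)
  have N2: "N \<ge> 2" by (simp add: N_def)
  \<comment> \<open>Beyond the branching vertex the image fork has only a tail of length 2 and a
    side branch of length 1, while \<open>N \<ge> 2\<close> leaves three more vertices
    \<open>d N\<close>, \<open>d (N - 1)\<close>, \<open>d (N - 2)\<close> of an injective walk.
    Neither dead end has room for them, so the walk has to turn towards the node.\<close>
  have dN': "d N = stem v t M"
  proof -
    have e: "(Fork v t (zeros M), d N) \<in> E T" "(d N, d (N - 1)) \<in> E T" "(d (N - 1), d (N - 2)) \<in> E T"
      using step[of N, THEN edge_sym] step[of "N - 1", THEN edge_sym] step[of "N - 2", THEN edge_sym]
        N2 dSN by (auto simp: numeral_2_eq_2 Suc_diff_Suc)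
    have n: "d (N - 1) \<noteq> d (Suc N)" "d (N - 2) \<noteq> d N"
      using N2 neq[of "N - 1" "Suc N"] neq[of "N - 2" N] by auto
    have "d N \<noteq> Fork v t (zeros M @ [True])"
      using e(2) n(1) edge_Fork_True dSN unfolding M_def stem.simps by metis
    moreover have False if dd: "d N = Fork v t (zeros (Suc M))"
    proof -
      have "d (N - 1) = Fork v t (zeros (Suc (Suc M)))"
        using e(2) n(1) unfolding dd dSN by (auto simp: edge_Fork_zeros M_def)
      then show False
        using e(3) n(2) dd by (auto simp: edge_Fork_zeros M_def)
    qed
    ultimately have "d N = Fork v t (zeros (M - 1))"
      using e(1) by (auto simp: edge_Fork_zeros M_def)
    then show ?thesis by (simp add: M_def)
  qed
  \<comment> \<open>Two consecutive positions are carried along: at a vertex of degree two the next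
    vertex is determined only when the previous one is known.\<close>
  have down: "d (Suc N - k) = stem v t (Suc M - k) \<and> d (N - k) = stem v t (M - k)"
    if "k \<le> N" "k \<le> M" for k
    using that
  proof (induction k)
    case 0
    then show ?case using dSN dN' by simp
  next
    case (Suc k)
    then have k: "Suc N - Suc k = N - k" "Suc (N - Suc k) = N - k" "Suc N - k = Suc (N - k)"
      "Suc (M - Suc k) = M - k" "Suc M - k = Suc (M - k)" by auto
    have IH: "d (Suc (N - k)) = stem v t (Suc (M - k))" "d (N - k) = stem v t (M - k)"
      using Suc unfolding k by auto
    have "(stem v t (Suc (M - Suc k)), d (N - Suc k)) \<in> E T"
      using step[of "N - Suc k", THEN edge_sym] IH unfolding k by auto
    moreover have "d (N - Suc k) \<noteq> stem v t (Suc (Suc (M - Suc k)))"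
      using neq[of "N - Suc k" "Suc (N - k)"] Suc.prems IH unfolding k by auto
    moreover have "M - Suc k < 2 * \<theta> v + 2" using Suc.prems by (simp add: M_def)
    ultimately have "d (N - Suc k) = stem v t (M - Suc k)"
      using edge_Fork_zeros[of v t 0]
      by (cases "M - Suc k") (auto simp: edge_Fork_zeros)
    then show ?case using IH k by simp
  qed
  \<comment> \<open>Were the image stem longer, the walk would stop inside it, although
    \<open>d 0\<close> is a node.\<close>
  have MN: "M \<le> N"
  proof (rule ccontr)
    assume "\<not> M \<le> N"
    then have "d 0 = stem v t (M - N)" "M - N > 0" using down[of N] by auto
    then show False using d0 by (cases "M - N") auto
  qed
  show ?thesis
  proof
    show "(v, t) \<in> T" "\<theta> v \<le> \<theta> u" using vt MN by (auto simp: M_def N_def)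
    fix k assume k: "k \<le> 2 * \<theta> v + 3"
    have "d (Suc N - k) = stem v t (Suc M - k)"
    proof (cases k)
      case 0
      then show ?thesis using dSN by simp
    next
      case (Suc l)
      then show ?thesis using down[of l] k MN by (simp add: M_def)
    qed
    then show "\<Phi> (stem u s (2 * \<theta> u + 3 - k)) = stem v t (2 * \<theta> v + 3 - k)"
      by (simp add: d_def N_def M_def eval_nat_numeral)
  qed
qed

text \<open>Since \<open>\<theta> [] = 0\<close>, a fork no longer than the one at the root must
  belong to \<open>[]\<close>, and equality of lengths then places it at the root of the
  target.\<close>

lemma node_map_Nil: "node_map [] = []"
proof -
  obtain v t where vt: "(v, t) \<in> T" "\<theta> v \<le> \<theta> []"
    "\<And>k. k \<le> 2 * \<theta> v + 3 \<Longrightarrow> \<Phi> (stem [] [] (2 * \<theta> [] + 3 - k)) = stem v t (2 * \<theta> v + 3 - k)"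
    using fork_image[OF root_S] by metis
  then have "v = []" using \<theta>_Nil \<theta>_inject[of v "[]"] by auto
  moreover have "t = []" using len_T[OF vt(1)] calculation by simp
  ultimately show ?thesis using vt(3)[of 3] \<theta>_Nil by (simp add: \<Phi>_node_map)
qed

text \<open>Starting from the root, the upward direction propagates: a downward step from
  \<open>s @ [k]\<close> would have to use the star that is already the image of
  \<open>Star (s @ [k])\<close>, against injectivity.\<close>

lemma node_map_snoc:
  "\<exists>m. node_map (s @ [n]) = node_map s @ [m] \<and> \<Phi> (Star (s @ [n])) = Star (node_map (s @ [n]))"
proof (induction s arbitrary: n rule: rev_induct)
  case Nil
  then show ?case using \<Phi>_Star[of "[]" n] by (auto simp: node_map_Nil)
next
  case (snoc k s)
  have "\<Phi> (Star (s @ [k])) = Star (node_map (s @ [k]))" using snoc by blast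
  moreover have "\<Phi> (Star (s @ [k])) \<noteq> \<Phi> (Star ((s @ [k]) @ [n]))"
    by (rule \<Phi>_neq[of _ "Node (s @ [k])" _ "Node (s @ [k])"]) (auto simp: edge_Star butlast_append)
  ultimately show ?case using \<Phi>_Star[of "s @ [k]" n] by auto
qed

lemma length_node_map: "length (node_map s) = length s"
proof (induction s rule: rev_induct)
  case (snoc n s)
  then show ?case using node_map_snoc[of s n] by auto
qed (simp add: node_map_Nil)

text \<open>
  A walk that starts in \<^term>\<open>Node t\<close> and passes neither \<^term>\<open>Star t\<close> nor \<^term>\<open>Node t\<close>
  again stays in the part of the graph above \<open>t\<close>.
\<close>

lemma edge_above:
  assumes "(v, w) \<in> E T" "prefix t (base v)" "v \<noteq> Star t" "v = Node t \<Longrightarrow> w \<noteq> Star t"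
  shows "prefix t (base w)"
proof -
  have pre: "prefix t (butlast r)" if "prefix t r" "r \<noteq> t" for r :: "nat list"
    using that by (cases r rule: rev_cases) auto
  show ?thesis
    using assms unfolding GT_edges_def
    by (auto elim!: GT_arcs.cases intro: pre prefixI simp: prefix_order.trans[OF _ prefixeq_butlast])
qed

text \<open>The image of the stem of \<open>s\<close> cannot descend below
  \<open>node_map s\<close>, so the fork reached sits at some extension \<open>t\<close> of it. As
  \<open>\<theta>\<close> respects lengths, \<open>\<theta> v \<le> \<theta> u\<close> prevents
  \<open>t\<close> from being longer. A strictly shorter fork would make the walk visit the same
  node twice, and so \<open>u = v\<close>.\<close>

theorem node_map_embeds:
  assumes S: "(u, s) \<in> S"
  shows "(u, node_map s) \<in> T"
proof -
  obtain v t where vt: "(v, t) \<in> T" "\<theta> v \<le> \<theta> u"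
    "\<And>k. k \<le> 2 * \<theta> v + 3 \<Longrightarrow> \<Phi> (stem u s (2 * \<theta> u + 3 - k)) = stem v t (2 * \<theta> v + 3 - k)"
    using fork_image[OF S] by metis
  define d where "d i = \<Phi> (stem u s i)" for i
  have d0: "d 0 = Node (node_map s)" by (simp add: d_def \<Phi>_node_map)
  have step: "(d i, d (Suc i)) \<in> E T" if "i \<le> 2 * \<theta> u + 2" for i
    using stem_edge[OF S, of i] that edge_\<Phi> by (auto simp: d_def)
  \<comment> \<open>For the empty sequence \<open>Star []\<close> has no edges at all; otherwise the
    star below \<open>node_map s\<close> is taken, being the image of \<open>Star s\<close>.\<close>
  have star: "d i \<noteq> Star (node_map s)" if "i \<le> 2 * \<theta> u + 3" for i
  proof (cases s rule: rev_cases)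
    case Nil
    have "(Star [], w) \<notin> E T" for w by (simp add: edge_Star)
    moreover have "\<exists>w. (d i, w) \<in> E T"
      using step[of "2 * \<theta> u + 2", THEN edge_sym] step[of i] that
      by (cases "i = 2 * \<theta> u + 3") (auto simp: eval_nat_numeral)
    ultimately show ?thesis using Nil by (auto simp: node_map_Nil)
  next
    case (snoc r n)
    have "Star (node_map s) = \<Phi> (Star s)" using snoc node_map_snoc[of r n] by simp
    moreover have "(Star s, Node s) \<in> E S" using snoc by (simp add: edge_Star)
    moreover have "\<exists>w. (stem u s i, w) \<in> E S"
      using stem_edge[OF S, of "2 * \<theta> u + 2", THEN edge_sym] stem_edge[OF S, of i] that
      by (cases "i = 2 * \<theta> u + 3") (auto simp: eval_nat_numeral)
    moreover have "stem u s i \<noteq> Star s" by (cases i) auto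
    ultimately show ?thesis unfolding d_def using \<Phi>_neq by metis
  qed
  have above: "prefix (node_map s) (base (d i))" if "i \<le> 2 * \<theta> u + 3" for i
    using that
  proof (induction i)
    case (Suc i)
    then show ?case
      using edge_above[OF step[of i], of "node_map s"] star[of i] star[of "Suc i"] by auto
  qed (simp add: d0)
  have "d (2 * \<theta> u + 3) = stem v t (2 * \<theta> v + 3)" using vt(3)[of 0] by (simp add: d_def)
  then have "prefix (node_map s) t" using above[of "2 * \<theta> u + 3"] by (simp add: eval_nat_numeral)
  moreover have "length t \<le> length (node_map s)"
    using \<theta>_mono[of u v] vt(2) len_S[OF S] len_T[OF vt(1)] length_node_map[of s] by fastforce
  ultimately have t: "t = node_map s"
    by (metis prefix_length_le prefix_order.eq_iff le_antisym not_equal_is_parallel parallelE)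
  have "d (2 * \<theta> u - 2 * \<theta> v) = Node t"
    using vt(3)[of "2 * \<theta> v + 3"] vt(2) by (simp add: d_def)
  then have "2 * \<theta> u - 2 * \<theta> v = 0"
    using \<Phi>_stem_neq[OF S, of "2 * \<theta> u - 2 * \<theta> v" 0] t d0 diff_le_self[of "2 * \<theta> u" "2 * \<theta> v"]
    unfolding d_def by force
  then have "u = v" using vt(2) \<theta>_inject[of u v] by auto
  then show ?thesis using vt(1) t by simp
qed

end

section \<open>Recovering the tree from the isomorphism type of its graph\<close>

locale gt_isomorphism = gt_embedding +
  assumes \<Phi>_image: "\<Phi> ` V S = V T"
    and edge_\<Phi>_iff: "v \<in> V S \<Longrightarrow> w \<in> V S \<Longrightarrow> (\<Phi> v, \<Phi> w) \<in> E T \<Longrightarrow> (v, w) \<in> E S"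
begin

lemma \<Phi>_neighbours: "v \<in> V S \<Longrightarrow> {w. (\<Phi> v, w) \<in> E T} = \<Phi> ` {w. (v, w) \<in> E S}"
proof
  assume v: "v \<in> V S"
  show "{w. (\<Phi> v, w) \<in> E T} \<subseteq> \<Phi> ` {w. (v, w) \<in> E S}"
  proof
    fix w assume w: "w \<in> {w. (\<Phi> v, w) \<in> E T}"
    then have "w \<in> V T" using edge_sym edge_vertices by blast
    then obtain w' where "w' \<in> V S" "w = \<Phi> w'" using \<Phi>_image by blast
    then show "w \<in> \<Phi> ` {w. (v, w) \<in> E S}" using w v edge_\<Phi>_iff by blast
  qed
qed (use edge_\<Phi> in auto)

lemma card_neighbours_PlusPlus: "card {w. (PlusPlus s, w) \<in> E U} = num s + 4"
proof -
  let ?P = "(\<lambda>i. Path s i 0) ` {..num s + 2}"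
  have "{w. (PlusPlus s, w) \<in> E U} = insert (Plus s) ?P"
    by (auto simp: edge_PlusPlus)
  moreover have "card ?P = num s + 3"
    by (subst card_image) (auto simp: inj_on_def)
  moreover have "finite ?P" "Plus s \<notin> ?P" by auto
  ultimately have "card {w. (PlusPlus s, w) \<in> E U} = Suc (num s + 3)" by (metis card_insert_disjoint)
  then show ?thesis by simp
qed

text \<open>Isomorphisms preserve degrees exactly. The image of \<open>PlusPlus s\<close> has even
  parity and a finite degree of at least three, so it is again a plus-plus vertex, necessarily the
  one at \<open>node_map s\<close>; its degree \<open>num s + 4\<close> reveals \<open>s\<close>
  because \<open>num\<close> is injective.\<close>

lemma node_map_id: "node_map s = s"
proof -
  let ?v = "\<Phi> (PlusPlus s)"
  have e: "(PlusPlus s, Plus s) \<in> E S" "(PlusPlus s, Path s 0 0) \<in> E S" "(PlusPlus s, Path s 1 0) \<in> E S"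
    "(Plus s, Node s) \<in> E S"
    by (auto simp: edge_PlusPlus edge_Plus)
  have v: "PlusPlus s \<in> V S" using e(1) edge_vertices by blast
  have fin: "finite {w. (PlusPlus s, w) \<in> E S}" by (intro finite_neighbours) simp
  have "finite {w. (?v, w) \<in> E T}" using fin \<Phi>_neighbours[OF v] by simp
  then have "?v \<noteq> Node t" for t using infinite_neighbours_Node by metis
  moreover have "even_vertex ?v"
    using edge_parity[OF edge_\<Phi>[OF e(4)]] edge_parity[OF edge_\<Phi>[OF e(1)]]
    by (simp add: \<Phi>_node_map)
  moreover have "\<Phi> (Plus s) \<noteq> \<Phi> (Path s 0 0)" "\<Phi> (Plus s) \<noteq> \<Phi> (Path s 1 0)"
    "\<Phi> (Path s 0 0) \<noteq> \<Phi> (Path s 1 0)"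
    using \<Phi>_neq[OF e(1)[THEN edge_sym] e(2)[THEN edge_sym]] \<Phi>_neq[OF e(1)[THEN edge_sym] e(3)[THEN edge_sym]]
      \<Phi>_neq[OF e(2)[THEN edge_sym] e(3)[THEN edge_sym]] by simp_all
  ultimately obtain t where t: "?v = PlusPlus t"
    using branching_vertex[OF e(1-3)[THEN edge_\<Phi>]] by auto
  have "t = node_map s"
    using edge_\<Phi>[OF e(1)] edge_\<Phi>[OF e(4)] unfolding t \<Phi>_node_map
    by (auto simp: edge_PlusPlus edge_Plus edge_Path)
  have "card {w. (?v, w) \<in> E T} = card {w. (PlusPlus s, w) \<in> E S}"
    unfolding \<Phi>_neighbours[OF v]
    by (intro card_image inj_on_subset[OF inj_\<Phi>]) (use edge_sym edge_vertices in blast)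
  then have "num t = num s" unfolding t card_neighbours_PlusPlus by simp
  then show ?thesis using bij_num \<open>t = node_map s\<close> by (metis bij_def inj_eq)
qed

theorem isomorphism_imp_subset: "S \<subseteq> T"
  using node_map_embeds node_map_id by auto

end

section \<open>Graph embeddings induced by Lipschitz maps\<close>

context gt_graphs
begin

lemma Path_vertex: "Path s i j \<in> V T \<longleftrightarrow> j \<le> i \<and> i \<le> num s + 2"
  by (auto simp: GT_vertices_def)

lemma Fork_vertex: "Fork u s x \<in> V T \<longleftrightarrow> (u, s) \<in> T \<and> x \<in> fork \<theta> u"
  by (auto simp: GT_vertices_def)

text \<open>The map acts on the node component of every vertex and keeps all other components. The
  condition on \<open>num\<close> provides the paths needed at \<open>h s\<close>; keeping
  \<open>u\<close> unchanged makes corresponding forks identical in shape, since this depends on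
  \<open>u\<close> alone.\<close>

lemma embedding_of_node_map:
  assumes inj: "inj h" and Nil: "h [] = []"
    and snoc: "\<And>s n. \<exists>m. h (s @ [n]) = h s @ [m]"
    and num: "\<And>s. num s \<le> num (h s)"
    and ST: "\<And>u s. (u, s) \<in> S \<Longrightarrow> (u, h s) \<in> T"
  obtains \<Phi> where "inj \<Phi>" "\<Phi> ` V S \<subseteq> V T"
    "\<And>v w. v \<in> V S \<Longrightarrow> w \<in> V S \<Longrightarrow> (v, w) \<in> E S \<longleftrightarrow> (\<Phi> v, \<Phi> w) \<in> E T"
proof
  define \<Phi> where "\<Phi> v = (case v of Node s \<Rightarrow> Node (h s) | Star s \<Rightarrow> Star (h s) | Plus s \<Rightarrow> Plus (h s)
    | PlusPlus s \<Rightarrow> PlusPlus (h s) | Path s i j \<Rightarrow> Path (h s) i j | Fork u s x \<Rightarrow> Fork u (h s) x)" for v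
  have simps [simp]: "\<Phi> (Node s) = Node (h s)" "\<Phi> (Star s) = Star (h s)" "\<Phi> (Plus s) = Plus (h s)"
    "\<Phi> (PlusPlus s) = PlusPlus (h s)" "\<Phi> (Path s i j) = Path (h s) i j"
    "\<Phi> (Fork u s x) = Fork u (h s) x" for s i j u x
    by (simp_all add: \<Phi>_def)
  have h_eq [simp]: "h s = h t \<longleftrightarrow> s = t" for s t using inj by (simp add: inj_eq)
  have h_Nil [simp]: "h s = [] \<longleftrightarrow> s = []" for s using h_eq[of s "[]"] Nil by simp
  have h_butlast: "butlast (h s) = h (butlast s)" for s
  proof (cases s rule: rev_cases)
    case (snoc r n)
    then show ?thesis using assms(3)[of r n] by auto
  qed (simp add: Nil)
  show "inj \<Phi>"
  proof (rule injI)
    fix v w assume "\<Phi> v = \<Phi> w" then show "v = w" by (cases v; cases w) auto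
  qed
  show "\<Phi> ` V S \<subseteq> V T"
    using ST order_trans[OF _ add_right_mono[OF num, of _ 2]]
    unfolding GT_vertices_def by (auto simp del: add_2_eq_Suc')
  have arc: "(\<Phi> v, \<Phi> w) \<in> A T" if "(v, w) \<in> A S" for v w
    using that
  proof cases
    case (node_star s)
    then show ?thesis using GT_arcs.node_star[of "h s"] by (simp add: h_butlast)
  next
    case (path_start i s)
    then show ?thesis using num[of s] by (auto intro!: GT_arcs.intros)
  next
    case (path_step j i s)
    then show ?thesis using num[of s] by (auto intro!: GT_arcs.intros)
  qed (auto intro!: GT_arcs.intros ST)
  have inv: "\<Phi> v = Node t \<longleftrightarrow> (\<exists>s. v = Node s \<and> t = h s)" "\<Phi> v = Star t \<longleftrightarrow> (\<exists>s. v = Star s \<and> t = h s)"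
    "\<Phi> v = Plus t \<longleftrightarrow> (\<exists>s. v = Plus s \<and> t = h s)"
    "\<Phi> v = PlusPlus t \<longleftrightarrow> (\<exists>s. v = PlusPlus s \<and> t = h s)"
    "\<Phi> v = Path t i j \<longleftrightarrow> (\<exists>s. v = Path s i j \<and> t = h s)"
    "\<Phi> v = Fork u t x \<longleftrightarrow> (\<exists>s. v = Fork u s x \<and> t = h s)" for v t i j u x
    by (cases v; auto)+
  have arc_inv: "(v, w) \<in> A S" if "(\<Phi> v, \<Phi> w) \<in> A T" "v \<in> V S" "w \<in> V S" for v w
    using that(1)
  proof cases
    case (node_star t)
    then show ?thesis by (auto simp: inv h_butlast intro!: GT_arcs.node_star)
  next
    case (star_node t)
    then show ?thesis by (auto simp: inv intro!: GT_arcs.star_node)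
  next
    case (node_plus t)
    then show ?thesis by (auto simp: inv intro!: GT_arcs.node_plus)
  next
    case (plus_plus t)
    then show ?thesis by (auto simp: inv intro!: GT_arcs.plus_plus)
  next
    case (path_start i t)
    then obtain s where "v = PlusPlus s" "w = Path s i 0" unfolding inv by auto
    then show ?thesis using that(3) GT_arcs.path_start by (simp only: Path_vertex)
  next
    case (path_step j i t)
    then obtain s where "v = Path s i j" "w = Path s i (Suc j)" unfolding inv by auto
    then show ?thesis using that(3) GT_arcs.path_step[of j i num s] \<open>j < i\<close> by (simp only: Path_vertex)
  next
    case (fork_start u t)
    then obtain s where "v = Node s" "w = Fork u s []" unfolding inv by auto
    then show ?thesis using that(3) GT_arcs.fork_start by (simp only: Fork_vertex)
  next
    case (fork_step u t x b)
    then obtain s where "v = Fork u s x" "w = Fork u s (x @ [b])" unfolding inv by auto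
    then show ?thesis using that(2,3) GT_arcs.fork_step by (simp only: Fork_vertex)
  qed
  show "(v, w) \<in> E S \<longleftrightarrow> (\<Phi> v, \<Phi> w) \<in> E T" if "v \<in> V S" "w \<in> V S" for v w
    using arc arc_inv that unfolding GT_edges_def by auto
qed

end

section \<open>Normal trees from quasi-orders\<close>

abbreviation initial :: "(nat \<Rightarrow> 'a) \<Rightarrow> nat \<Rightarrow> 'a list" where
  "initial x n \<equiv> map x [0..<n]"

lemma take_initial: "m \<le> n \<Longrightarrow> take m (initial x n) = initial x m"
  by (simp add: take_map)

lemma butlast_initial: "butlast (initial x (Suc n)) = initial x n"
  by simp

lemma initial_eq_iff: "initial x n = initial y n \<longleftrightarrow> (\<forall>i<n. x i = y i)"
  by (auto simp: list_eq_iff_nth_eq)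

lemma koenig:
  assumes ex: "\<And>n. \<exists>w. length w = n \<and> P w"
    and take: "\<And>w m. P w \<Longrightarrow> P (take m w)"
    and fin: "\<And>w. P w \<Longrightarrow> finite {a. P (w @ [a])}"
  shows "\<exists>x. \<forall>n. P (initial x n)"
proof -
  define Ext where "Ext w \<longleftrightarrow> (\<forall>n\<ge>length w. \<exists>v. length v = n \<and> prefix w v \<and> P v)" for w
  have Nil: "Ext []" using ex by (auto simp: Ext_def)
  have P_Ext: "P w" if w: "Ext w" for w
  proof -
    obtain v where "length v = length w" "prefix w v" "P v" using w[unfolded Ext_def, rule_format, of "length w"] by auto
    then show ?thesis by (auto elim: prefixE)
  qed
  have step: "\<exists>a. Ext (w @ [a])" if w: "Ext w" for w
  proof (rule ccontr)
    assume "\<nexists>a. Ext (w @ [a])"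
    then have "\<forall>a. \<exists>n>length w. \<forall>v. length v = n \<and> prefix (w @ [a]) v \<longrightarrow> \<not> P v"
      unfolding Ext_def by (simp add: Suc_le_eq) blast
    then obtain N where N: "\<And>a. N a > length w"
      "\<And>a v. length v = N a \<Longrightarrow> prefix (w @ [a]) v \<Longrightarrow> \<not> P v"
      by metis
    \<comment> \<open>\<open>N a\<close> is a length at which the child \<open>w @ [a]\<close> has
      no more descendants in the tree. The sum over the finitely many children in the tree bounds
      each of these lengths, so one descendant of \<open>w\<close> of length \<open>K\<close>
      contradicts them all.\<close>
    define K where "K = Suc (length w) + (\<Sum>a\<in>{a. P (w @ [a])}. N a)"
    obtain v where v: "length v = K" "prefix w v" "P v"
      using w[unfolded Ext_def, rule_format, of K] by (auto simp: K_def)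
    then obtain r where r: "v = w @ r" by (auto simp: prefix_def)
    then have "r \<noteq> []" using v(1) by (auto simp: K_def)
    then obtain a r' where r': "v = (w @ [a]) @ r'" using r by (cases r) auto
    have a: "P (w @ [a])" using take[OF v(3), of "Suc (length w)"] r' by simp
    have "N a \<le> (\<Sum>a\<in>{a. P (w @ [a])}. N a)"
      using a fin[OF P_Ext[OF w]] by (intro member_le_sum) auto
    then have le: "N a \<le> K" by (simp add: K_def)
    have "prefix (w @ [a]) (take (N a) v)"
      using N(1)[of a] unfolding r' by (cases "N a - length w") auto
    then show False using N(2)[of "take (N a) v" a] take[OF v(3)] le v(1) by simp
  qed
  define W where "W = rec_nat [] (\<lambda>n w. w @ [SOME a. Ext (w @ [a])])"
  have W: "W 0 = []" "W (Suc n) = W n @ [SOME a. Ext (W n @ [a])]" for n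
    by (simp_all add: W_def)
  have E: "Ext (W n)" for n
    by (induction n) (auto simp: W Nil intro: someI_ex[OF step])
  have "initial (\<lambda>n. last (W (Suc n))) n = W n" for n
    by (induction n) (simp_all add: W)
  then show ?thesis using P_Ext[OF E] by metis
qed

section \<open>Trees of chains and the quasi-order they encode\<close>

locale sequence_tree =
  fixes tr :: "bool list \<Rightarrow> bool list \<Rightarrow> nat list \<Rightarrow> bool" and Q :: "(nat \<Rightarrow> bool) rel"
  assumes tr_length: "tr u v s \<Longrightarrow> length u = length s \<and> length v = length s"
    and tr_take: "tr u v s \<Longrightarrow> tr (take m u) (take m v) (take m s)"
    and Q_iff: "(x, y) \<in> Q \<longleftrightarrow> (\<exists>\<alpha>. \<forall>n. tr (initial x n) (initial y n) (initial \<alpha> n))"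
    and trans_Q: "trans Q"
begin

text \<open>Bounding the witness instead of naming it makes the relation monotone in
  \<open>t\<close>, which is the source of normality. The diagonal is included so that a chain can
  be padded to any greater length.\<close>

definition link :: "nat list \<Rightarrow> bool list rel" where
  "link t = {(u, v). length u = length t \<and> length v = length t \<and>
     (u = v \<or> (\<exists>s. list_all2 (\<le>) s t \<and> tr u v s))}"

text \<open>
  The first entry of the third component bounds the length of a chain of links; sums of such
  bounds are what makes the resulting tree transitive.
\<close>

fun chain :: "bool list \<Rightarrow> bool list \<Rightarrow> nat list \<Rightarrow> bool" where
  "chain u v [] \<longleftrightarrow> u = [] \<and> v = []"
| "chain u v (k # t) \<longleftrightarrow> length u = Suc (length t) \<and> length v = Suc (length t) \<and>
     (butlast u, butlast v) \<in> link t ^^ k"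

definition tree_of :: "(nat \<Rightarrow> bool) \<Rightarrow> (bool list \<times> nat list) set" where
  "tree_of x = {(u, s). chain u (initial x (length s)) s}"

lemma link_refl: "length u = length t \<Longrightarrow> (u, u) \<in> link t"
  by (simp add: link_def)

lemma link_mono: "list_all2 (\<le>) t t' \<Longrightarrow> link t \<subseteq> link t'"
  unfolding link_def by (auto dest: list_all2_lengthD intro: list_all2_trans[OF order_trans])

lemma link_take:
  assumes "(u, v) \<in> link t"
  shows "(take m u, take m v) \<in> link (take m t)"
  using assms tr_take[of u v _ m] list_all2_takeI unfolding link_def by fastforce

lemma relpow_map:
  assumes "\<And>u v. (u, v) \<in> R \<Longrightarrow> (f u, f v) \<in> R'" "(u, v) \<in> R ^^ k"
  shows "(f u, f v) \<in> R' ^^ k"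
  using assms(2) by (induction k arbitrary: v) (auto intro: assms(1))

lemma link_relpow_length: "(u, v) \<in> link t ^^ k \<Longrightarrow> length u = length t \<Longrightarrow> length v = length t"
  by (cases k) (auto simp: link_def)

lemma link_relpow_mono:
  assumes "(u, v) \<in> link t ^^ k" "length u = length t" "list_all2 (\<le>) t t'" "k \<le> k'"
  shows "(u, v) \<in> link t' ^^ k'"
proof -
  have "(u, v) \<in> link t' ^^ k"
    using relpow_map[of "link t" id "link t'"] assms(1,3) link_mono by fastforce
  moreover have "(v, v) \<in> link t' ^^ j" for j
    using link_relpow_length[OF assms(1,2)] list_all2_lengthD[OF assms(3)]
    by (induction j) (auto intro: link_refl)
  ultimately have "(u, v) \<in> link t' ^^ (k + (k' - k))"
    by (auto simp: relpow_add)
  then show ?thesis using assms(4) by simp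
qed

lemma chain_length: "chain u v t \<Longrightarrow> length u = length t \<and> length v = length t"
  by (cases t) auto

lemma chain_mono:
  assumes "chain u v t" "list_all2 (\<le>) t t'"
  shows "chain u v t'"
  using assms by (cases t; cases t') (auto dest: list_all2_lengthD intro: link_relpow_mono)

lemma chain_take:
  assumes "chain u v t" "n \<le> length t"
  shows "chain (take n u) (take n v) (take n t)"
proof (cases t)
  case (Cons k t')
  show ?thesis
  proof (cases n)
    case (Suc m)
    have "butlast (take (Suc m) w) = take m (butlast w)" if "length w = Suc (length t')" for w :: "bool list"
      using that assms(2) Cons Suc by (simp add: butlast_take take_butlast)
    moreover have "(take m (butlast u), take m (butlast v)) \<in> link (take m t') ^^ k"
      using assms(1) Cons by (intro relpow_map[of "link t'" "take m"] link_take) auto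
    ultimately show ?thesis using assms Cons Suc by (auto simp: min_def)
  qed simp
qed (use assms in simp)

text \<open>Addition suits both roles of the entries: in leading position, lengths of chains add up
  under composition; in the other positions the sum dominates both bounds.\<close>

lemma chain_trans:
  assumes "chain u v s" "chain v w t"
  shows "chain u w (map2 (+) s t)"
proof (cases s)
  case (Cons k s')
  have len: "length t = length s" using chain_length assms by metis
  then obtain l t' where t: "t = l # t'" using Cons by (cases t) auto
  have *: "list_all2 (\<le>) s' (map2 (+) s' t')" "list_all2 (\<le>) t' (map2 (+) s' t')"
    using len Cons t by (auto simp: list_all2_conv_all_nth)
  have "(butlast u, butlast v) \<in> link (map2 (+) s' t') ^^ k"
    "(butlast v, butlast w) \<in> link (map2 (+) s' t') ^^ l"
    using assms Cons t len *
    by (auto intro: link_relpow_mono)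
  then show ?thesis using assms Cons t len by (auto simp: relpow_add)
next
  case Nil
  then show ?thesis using assms chain_length[OF assms(2)] by auto
qed

lemma normal_tree_of: "normal_tree (tree_of x)"
proof -
  have "(take n u, take n s) \<in> tree_of x" if "(u, s) \<in> tree_of x" "n \<le> length s" for u s n
    using chain_take[of u "initial x (length s)" s n] that
    by (simp add: tree_of_def take_initial min_absorb2)
  moreover have "(u, t) \<in> tree_of x" if "(u, s) \<in> tree_of x" "list_all2 (\<le>) s t" for u s t
    using chain_mono[of u "initial x (length s)" s t] that list_all2_lengthD[OF that(2)]
    by (simp add: tree_of_def)
  moreover have "length u = length s" if "(u, s) \<in> tree_of x" for u s
    using chain_length that by (auto simp: tree_of_def)
  ultimately show ?thesis unfolding normal_tree_def by blast
qed

lemma Nil_in_tree_of: "([], []) \<in> tree_of x"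
  by (simp add: tree_of_def)

text \<open>A chain of no links is an equality, so these elements spell out \<open>x\<close>. The
  last digit of \<open>u\<close> is free because the leading entry is spent on the length of the
  chain and leaves only \<open>n\<close> entries for the bounds.\<close>

lemma zero_in_tree_of: "(u, replicate (Suc n) 0) \<in> tree_of x \<longleftrightarrow> length u = Suc n \<and> butlast u = initial x n"
  by (auto simp: tree_of_def butlast_initial simp del: upt_Suc)

lemma tree_of_inject: "tree_of x = tree_of y \<longleftrightarrow> x = y"
proof
  assume eq: "tree_of x = tree_of y"
  have "initial x (Suc n) = initial y (Suc n)" for n
  proof -
    have "(initial x (Suc (Suc n)), replicate (Suc (Suc n)) 0) \<in> tree_of x"
      unfolding zero_in_tree_of butlast_initial by simp
    then show ?thesis unfolding eq zero_in_tree_of butlast_initial by simp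
  qed
  then show "x = y" unfolding initial_eq_iff by blast
qed simp

lemma tree_of_shift:
  assumes "(x, y) \<in> Q"
  obtains \<beta> where "\<And>u s. (u, s) \<in> tree_of x \<Longrightarrow> (u, map2 (+) s (initial \<beta> (length s))) \<in> tree_of y"
proof -
  obtain \<alpha> where \<alpha>: "\<And>n. tr (initial x n) (initial y n) (initial \<alpha> n)"
    using assms Q_iff by blast
  \<comment> \<open>The leading 1 announces a single link, from \<open>x\<close> to
    \<open>y\<close>; the witness of that link follows, shifted by one place.\<close>
  define \<beta> where "\<beta> n = (case n of 0 \<Rightarrow> 1 | Suc m \<Rightarrow> \<alpha> m)" for n
  have \<beta>: "initial \<beta> (Suc n) = 1 # initial \<alpha> n" for n
    by (simp add: \<beta>_def upt_conv_Cons map_Suc_upt[symmetric] del: upt_Suc)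
  have link: "(initial x n, initial y n) \<in> link (initial \<alpha> n)" for n
    using \<alpha>[of n] by (auto simp: link_def intro: list_all2_refl)
  have chain: "chain (initial x n) (initial y n) (initial \<beta> n)" for n
  proof (cases n)
    case (Suc m)
    then show ?thesis using link[of m] by (simp del: upt_Suc add: \<beta>) simp
  qed simp
  show ?thesis
  proof
    fix u s assume "(u, s) \<in> tree_of x"
    then have "chain u (initial x (length s)) s" by (simp add: tree_of_def)
    from chain_trans[OF this chain]
    show "(u, map2 (+) s (initial \<beta> (length s))) \<in> tree_of y" by (simp add: tree_of_def)
  qed
qed

text \<open>Approximations long enough to contain a difference between \<open>x\<close> and
  \<open>y\<close> exclude the diagonal case, so there are witnesses of every length below
  \<open>\<beta>\<close>. The bound makes their tree finitely branching, and an infinite branch is a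
  witness for \<open>Q\<close>.\<close>

lemma link_limit:
  assumes "\<And>n. (initial x n, initial y n) \<in> link (initial \<beta> n)"
  shows "(x, y) \<in> Q\<^sup>="
proof (cases "x = y")
  case False
  then obtain i where i: "x i \<noteq> y i" by auto
  define P where "P s \<longleftrightarrow> tr (initial x (length s)) (initial y (length s)) s \<and>
    list_all2 (\<le>) s (initial \<beta> (length s))" for s
  have P_take: "P (take m w)" if "P w" for w m
    using that tr_take[of "initial x (length w)" "initial y (length w)" w m]
      list_all2_takeI[of "(\<le>)" w "initial \<beta> (length w)" m]
    unfolding P_def by (cases "m \<le> length w") (auto simp: take_initial min_def)
  have "\<exists>s. \<forall>n. P (initial s n)"
  proof (rule koenig)
    fix n
    have "initial x (n + Suc i) \<noteq> initial y (n + Suc i)"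
      using i unfolding initial_eq_iff by (intro notI) (auto dest: spec[of _ i])
    then obtain s where s: "list_all2 (\<le>) s (initial \<beta> (n + Suc i))"
      "tr (initial x (n + Suc i)) (initial y (n + Suc i)) s"
      using assms[of "n + Suc i"] unfolding link_def by auto
    have "length s = n + Suc i" using list_all2_lengthD[OF s(1)] by simp
    then have "P s" using s by (simp add: P_def)
    then show "\<exists>w. length w = n \<and> P w"
      using P_take[of s n] \<open>length s = _\<close> by (intro exI[of _ "take n s"]) simp
  next
    fix w assume "P w"
    show "finite {a. P (w @ [a])}"
      by (rule finite_subset[of _ "{..\<beta> (length w)}"])
        (auto simp: P_def list_all2_append)
  qed (use P_take in blast)
  then show ?thesis unfolding P_def using Q_iff by auto
qed simp

text \<open>The last intermediate point \<open>z\<close> is a branch through the tree of possible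
  intermediate approximations, which is finitely branching because digits are binary. Reflexive
  closure is taken because single links of the chain may be trivial.\<close>

lemma link_relpow_limit:
  assumes "\<And>n. (initial x n, initial y n) \<in> link (initial \<beta> n) ^^ k"
  shows "(x, y) \<in> (Q\<^sup>=) ^^ k"
  using assms
proof (induction k arbitrary: y)
  case 0
  then have "initial x n = initial y n" for n by simp
  then have "x = y" unfolding initial_eq_iff by blast
  then show ?case by simp
next
  case (Suc k)
  define P where "P w \<longleftrightarrow> (initial x (length w), w) \<in> link (initial \<beta> (length w)) ^^ k \<and>
    (w, initial y (length w)) \<in> link (initial \<beta> (length w))" for w
  have "\<exists>z. \<forall>n. P (initial z n)"
  proof (rule koenig)
    fix n
    from Suc.prems[of n] obtain w where w: "(initial x n, w) \<in> link (initial \<beta> n) ^^ k"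
      "(w, initial y n) \<in> link (initial \<beta> n)" by auto
    have "length w = n" using w(2) by (simp add: link_def)
    then show "\<exists>w. length w = n \<and> P w" using w unfolding P_def by auto
  next
    fix w m assume w: "P w"
    then show "P (take m w)"
      unfolding P_def
      using relpow_map[of "link (initial \<beta> (length w))" "take m" "link (take m (initial \<beta> (length w)))",
          OF link_take, of "initial x (length w)" w k]
        link_take[of w "initial y (length w)" "initial \<beta> (length w)" m]
      by (cases "m \<le> length w") (auto simp: take_initial min_def)
  qed simp
  then obtain z where "\<And>n. (initial x n, initial z n) \<in> link (initial \<beta> n) ^^ k"
    "\<And>n. (initial z n, initial y n) \<in> link (initial \<beta> n)"
    by (auto simp: P_def)
  then have "(x, z) \<in> (Q\<^sup>=) ^^ k" "(z, y) \<in> Q\<^sup>=" using Suc.IH link_limit by blast+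
  then show ?case unfolding relpow.simps by blast
qed

text \<open>Following \<open>h\<close> along the zero sequences is enough: there the tree of
  \<open>x\<close> contains \<open>x\<close> itself, and the images are the initial segments of one
  sequence \<open>\<beta>\<close>. Hence the length \<open>\<beta> 0\<close> of the chains from
  \<open>x\<close> to \<open>y\<close> is the same at all levels, as the limit argument
  requires.\<close>

lemma tree_of_embedding_imp:
  assumes h: "\<And>s. length (h s) = length s" "\<And>s n. \<exists>m. h (s @ [n]) = h s @ [m]"
    and emb: "\<And>u s. (u, s) \<in> tree_of x \<Longrightarrow> (u, h s) \<in> tree_of y"
    and refl: "(x, x) \<in> Q"
  shows "(x, y) \<in> Q"
proof -
  define \<beta> where "\<beta> n = last (h (replicate (Suc n) 0))" for n
  have \<beta>: "h (replicate n 0) = initial \<beta> n" for n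
  proof (induction n)
    case 0
    then show ?case using h(1)[of "[]"] by simp
  next
    case (Suc n)
    have "replicate (Suc n) (0::nat) = replicate n 0 @ [0]" by (simp add: replicate_append_same)
    then obtain m where "h (replicate (Suc n) 0) = h (replicate n 0) @ [m]" using h(2) by metis
    then show ?case using Suc by (simp add: \<beta>_def)
  qed
  define k where "k = \<beta> 0"
  have "(initial x n, initial y n) \<in> link (initial (\<lambda>i. \<beta> (Suc i)) n) ^^ k" for n
  proof -
    have "(initial x (Suc n), replicate (Suc n) 0) \<in> tree_of x"
      unfolding zero_in_tree_of butlast_initial by simp
    from emb[OF this] have "chain (initial x (Suc n)) (initial y (Suc n)) (initial \<beta> (Suc n))"
      unfolding \<beta>[of "Suc n"] by (simp add: tree_of_def del: upt_Suc)
    moreover have "initial \<beta> (Suc n) = k # initial (\<lambda>i. \<beta> (Suc i)) n"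
      by (simp add: k_def upt_conv_Cons map_Suc_upt[symmetric] del: upt_Suc)
    ultimately show ?thesis by simp
  qed
  then have "(x, y) \<in> (Q\<^sup>=) ^^ k" by (rule link_relpow_limit)
  then have "(x, y) \<in> Q\<^sup>*" using relpow_imp_rtrancl rtrancl_reflcl by metis
  then show ?thesis using refl unfolding rtrancl_eq_or_trancl trancl_id[OF trans_Q] by blast
qed

end

section \<open>Enlarging a Lipschitz map\<close>

lemma unbounded_choice:
  assumes "\<And>a m. \<exists>b\<ge>m. P a b"
  obtains g :: "nat \<Rightarrow> nat" where "strict_mono g" "\<And>a. P a (g a)"
proof -
  have "\<exists>g. \<forall>n. P n (g n) \<and> g n < g (Suc n)"
  proof (rule dependent_nat_choice)
    show "\<exists>x. P 0 x" using assms by blast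
    show "\<exists>y. P (Suc n) y \<and> x < y" for x n using assms[of "Suc x" "Suc n"] by auto
  qed
  then show ?thesis using that by (auto simp: strict_mono_Suc_iff)
qed

text \<open>Since \<open>num\<close> is injective, the children of a given node have unbounded
  numbers, so each child can be sent to one that is large both in number and in its last entry.
  Choosing these last entries strictly increasing keeps the map injective.\<close>

lemma dominating_node_map:
  fixes num :: "nat list \<Rightarrow> nat"
  assumes "inj num"
  obtains h :: "nat list \<Rightarrow> nat list" where "inj h" "h [] = []" "\<And>s n. \<exists>m. h (s @ [n]) = h s @ [m]"
    "\<And>s. num s \<le> num (h s)" "\<And>s. list_all2 (\<le>) (map2 (+) s (map \<beta> [0..<length s])) (h s)"
proof -
  have "\<exists>b\<ge>m. num (s @ [a]) \<le> num (r @ [b]) \<and> a + \<beta> (length s) \<le> b" for s r :: "nat list" and a m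
  proof -
    have "inj (\<lambda>b. num (r @ [b]))"
      by (rule injI) (use injD[OF assms] in fastforce)
    then have "infinite ((\<lambda>b. num (r @ [b])) ` {max m (a + \<beta> (length s))..})"
      by (subst finite_image_iff) (auto intro: inj_on_subset simp: infinite_Ici)
    then obtain k where "k \<ge> num (s @ [a])" "k \<in> (\<lambda>b. num (r @ [b])) ` {max m (a + \<beta> (length s))..}"
      unfolding infinite_nat_iff_unbounded_le by blast
    then show ?thesis by auto
  qed
  then have "\<exists>g. strict_mono g \<and> (\<forall>a. num (s @ [a]) \<le> num (r @ [g a]) \<and> a + \<beta> (length s) \<le> g a)"
    for s r :: "nat list"
    by (rule unbounded_choice[of "\<lambda>a b. num (s @ [a]) \<le> num (r @ [b]) \<and> a + \<beta> (length s) \<le> b"]) blast+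
  then obtain g where g: "\<And>s r. strict_mono (g s r)" "\<And>s r a. num (s @ [a]) \<le> num (r @ [g s r a])"
    "\<And>s r a. a + \<beta> (length s) \<le> g s r a"
    by metis
  \<comment> \<open>\<open>h\<close> grows at the end of the sequence while \<open>rec_list\<close>
    recurses at the front, hence the reversal. The choice at each step depends on the node and on
    its image so far.\<close>
  define hr where "hr = rec_list [] (\<lambda>a s r. r @ [g (rev s) r a])"
  define h where "h s = hr (rev s)" for s
  have Nil: "h [] = []" by (simp add: h_def hr_def)
  have h_snoc: "h (s @ [a]) = h s @ [g s (h s) a]" for s a by (simp add: h_def hr_def)
  have len: "length (h s) = length s" for s by (induction s rule: rev_induct) (simp_all add: Nil h_snoc)
  have "s = t" if "h s = h t" for s t
    using that
  proof (induction s arbitrary: t rule: rev_induct)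
    case Nil
    then have "length t = 0" using len[of "[]"] len[of t] by (metis list.size(3))
    then show ?case by simp
  next
    case (snoc a s)
    then have "length t = Suc (length s)" using len[of "s @ [a]"] len[of t] by (metis length_append_singleton)
    then obtain b r where t: "t = r @ [b]" by (cases t rule: rev_cases) auto
    have "h s @ [g s (h s) a] = h r @ [g r (h r) b]" using snoc.prems unfolding t h_snoc .
    then have eq: "h s = h r" "g s (h s) a = g r (h r) b" by auto
    have "s = r" by (rule snoc.IH[OF eq(1)])
    then show ?case using eq(2) strict_mono_eq[OF g(1)] unfolding t by simp
  qed
  then have "inj h" by (auto intro: injI)
  moreover have "num s \<le> num (h s)" for s
  proof (cases s rule: rev_cases)
    case (snoc r a)
    then show ?thesis using g(2)[of r a "h r"] by (simp add: h_snoc)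
  qed (simp add: Nil)
  moreover have "list_all2 (\<le>) (map2 (+) s (map \<beta> [0..<length s])) (h s)" for s
  proof (induction s rule: rev_induct)
    case (snoc a s)
    then show ?case using g(3)[of a s "h s"] by (simp add: h_snoc list_all2_append len)
  qed (simp add: Nil)
  ultimately show ?thesis using that[of h] Nil h_snoc by blast
qed

section \<open>Analytic sets and the theorems of Lusin and Souslin\<close>

instance bool :: second_countable_topology
proof
  have "open S \<longleftrightarrow> generate_topology (UNIV :: bool set set) S" for S :: "bool set"
    by (simp add: open_discrete generate_topology.Basis)
  then show "\<exists>B :: bool set set. countable B \<and> open = generate_topology B"
    by (intro exI[of _ UNIV]) auto
qed

text \<open>Closed witness sets are determined by initial segments, which both the trees and the
  separation argument exploit. By \<open>analytic_set_fst_image\<close>, projections of Borel sets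
  have this form on the spaces considered.\<close>

definition analytic_set :: "'a::topological_space set \<Rightarrow> bool" where
  "analytic_set A \<longleftrightarrow> (\<exists>C :: ('a \<times> (nat \<Rightarrow> nat)) set. closed C \<and> A = fst ` C)"

lemma analytic_set_closed:
  assumes "closed A"
  shows "analytic_set A"
  unfolding analytic_set_def
  using assms by (intro exI[of _ "A \<times> UNIV"]) (auto simp: closed_Times)

lemma closed_discrete: "closed (A :: 'a::discrete_topology set)"
  by (simp add: closed_def open_discrete)

lemma continuous_reindex:
  "continuous_on UNIV (\<lambda>p :: 'a::topological_space \<times> (nat \<Rightarrow> nat). \<lambda>i. snd p (g i))"
  by (rule continuous_on_coordinatewise_then_product,
      rule continuous_on_product_then_coordinatewise[OF continuous_on_snd[OF continuous_on_id]])

lemma closed_reindex: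
  fixes C :: "('a::topological_space \<times> (nat \<Rightarrow> nat)) set" and g :: "nat \<Rightarrow> nat"
  assumes "closed C"
  shows "closed {p. (fst p, \<lambda>i. snd p (g i)) \<in> C}"
proof -
  have "continuous_on UNIV (\<lambda>p :: 'a \<times> (nat \<Rightarrow> nat). (fst p, \<lambda>i. snd p (g i)))"
    by (intro continuous_on_Pair continuous_reindex continuous_on_fst continuous_on_id)
  from closed_vimage[OF assms this] show ?thesis by (simp add: vimage_def)
qed

lemma analytic_set_UN:
  assumes "\<And>n :: nat. analytic_set (A n)"
  shows "analytic_set (\<Union>n. A n)"
proof -
  obtain C :: "nat \<Rightarrow> ('a \<times> (nat \<Rightarrow> nat)) set"
    where C: "\<And>n. closed (C n)" "\<And>n. A n = fst ` C n"
    using assms unfolding analytic_set_def by metis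
  \<comment> \<open>The first entry of a witness says which \<open>A n\<close> contains the point;
    the remaining entries witness it.\<close>
  define D where "D = (\<Inter>n. {p. snd p 0 \<noteq> n} \<union> {p. (fst p, \<lambda>i. snd p (Suc i)) \<in> C n})"
  have "continuous_on UNIV (\<lambda>p :: 'a \<times> (nat \<Rightarrow> nat). snd p 0)"
    by (rule continuous_on_product_then_coordinatewise[OF continuous_on_snd[OF continuous_on_id]])
  then have "closed {p :: 'a \<times> (nat \<Rightarrow> nat). snd p 0 \<noteq> n}" for n
    using closed_vimage[OF closed_discrete, of "\<lambda>p :: 'a \<times> (nat \<Rightarrow> nat). snd p 0" "- {n}"]
    by (simp add: vimage_def)
  then have "closed D" unfolding D_def by (intro closed_INT ballI closed_Un closed_reindex C)
  moreover have "(\<Union>n. A n) = fst ` D"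
  proof (intro equalityI subsetI)
    fix x assume "x \<in> (\<Union>n. A n)"
    then obtain n \<alpha> where "(x, \<alpha>) \<in> C n" by (auto simp: C)
    then have "(x, case_nat n \<alpha>) \<in> D" by (auto simp: D_def)
    then show "x \<in> fst ` D" by force
  next
    fix x assume "x \<in> fst ` D"
    then obtain \<alpha> where "(x, \<alpha>) \<in> D" by auto
    then have "(x, \<lambda>i. \<alpha> (Suc i)) \<in> C (\<alpha> 0)" by (auto simp: D_def)
    then show "x \<in> (\<Union>n. A n)" by (force simp: C)
  qed
  ultimately show ?thesis unfolding analytic_set_def by blast
qed

lemma analytic_set_INT:
  assumes "\<And>n :: nat. analytic_set (A n)"
  shows "analytic_set (\<Inter>n. A n)"
proof -
  obtain C :: "nat \<Rightarrow> ('a \<times> (nat \<Rightarrow> nat)) set"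
    where C: "\<And>n. closed (C n)" "\<And>n. A n = fst ` C n"
    using assms unfolding analytic_set_def by metis
  \<comment> \<open>One witness holds countably many, the \<open>n\<close>-th one being stored in
    the \<open>n\<close>-th row of the pairing.\<close>
  define D where "D = (\<Inter>n. {p. (fst p, \<lambda>i. snd p (prod_encode (n, i))) \<in> C n})"
  have "closed D" unfolding D_def by (intro closed_INT ballI closed_reindex C)
  moreover have "(\<Inter>n. A n) = fst ` D"
  proof (intro equalityI subsetI)
    fix x assume "x \<in> (\<Inter>n. A n)"
    then have "\<forall>n. \<exists>\<alpha>. (x, \<alpha>) \<in> C n" by (force simp: C)
    then obtain \<alpha> where "\<And>n. (x, \<alpha> n) \<in> C n" by metis
    then have "(x, \<lambda>k. case prod_decode k of (n, i) \<Rightarrow> \<alpha> n i) \<in> D" by (auto simp: D_def)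
    then show "x \<in> fst ` D" by force
  next
    fix x assume "x \<in> fst ` D"
    then obtain \<alpha> where "(x, \<alpha>) \<in> D" by auto
    then have "(x, \<lambda>i. \<alpha> (prod_encode (n, i))) \<in> C n" for n by (auto simp: D_def)
    then show "x \<in> (\<Inter>n. A n)" by (force simp: C)
  qed
  ultimately show ?thesis unfolding analytic_set_def by blast
qed

class zero_dimensional = second_countable_topology +
  assumes clopen_base: "open U \<Longrightarrow> x \<in> U \<Longrightarrow> \<exists>K. open K \<and> closed K \<and> x \<in> K \<and> K \<subseteq> U"

text \<open>Sets that are analytic together with their complements form a sigma-algebra. It contains
  the open sets, because a second countable space with a clopen base presents them as countable
  unions of clopen sets.\<close>

lemma analytic_set_borel:
  fixes B :: "'a::zero_dimensional set"
  assumes "B \<in> sets borel"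
  shows "analytic_set B"
proof -
  have *: "analytic_set U" if U: "open U" for U :: "'a set"
  proof -
    define F where "F = {K. open K \<and> closed K \<and> K \<subseteq> U}"
    have "\<And>S. S \<in> F \<Longrightarrow> openin (top_of_set UNIV) S" by (auto simp: F_def)
    from Lindelof_openin[OF this] obtain F' where F': "F' \<subseteq> F" "countable F'" "\<Union>F' = \<Union>F"
      by metis
    have "\<Union>F = U" unfolding F_def using clopen_base[OF U] by blast
    then have U_eq: "U = \<Union> (insert {} F')" using F' by auto
    define e where "e = from_nat_into (insert {} F')"
    have "range e = insert {} F'" unfolding e_def using F'(2) by (intro range_from_nat_into) auto
    then have "U = (\<Union>n. e n)" and "\<And>n. e n \<in> insert {} F'" using U_eq by auto
    then have "\<And>n. closed (e n)" using F'(1) by (metis F_def closed_empty insertE mem_Collect_eq subsetD)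
    then show ?thesis unfolding \<open>U = (\<Union>n. e n)\<close> by (intro analytic_set_UN analytic_set_closed)
  qed
  have "B \<in> sigma_sets UNIV {S. open S}" using assms by (simp add: borel_def)
  then have "analytic_set B \<and> analytic_set (- B)"
  proof (induction rule: sigma_sets.induct)
    case (Basic a)
    then show ?case using * analytic_set_closed[of "- a"] by auto
  next
    case Empty
    then show ?case using analytic_set_closed[of "{}"] analytic_set_closed[of UNIV] by simp
  next
    case (Compl a)
    then show ?case by (simp add: Compl_eq_Diff_UNIV[symmetric])
  next
    case (Union a)
    then show ?case using analytic_set_UN[of a] analytic_set_INT[of "\<lambda>n. - a n"] by simp
  qed
  then show ?thesis by simp
qed

lemma clopen_coordinate:
  "open {y :: 'i \<Rightarrow> 'a::discrete_topology. y i = a}" "closed {y :: 'i \<Rightarrow> 'a. y i = a}"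
proof -
  have c: "continuous_on UNIV (\<lambda>y :: 'i \<Rightarrow> 'a. y i)" by simp
  show "open {y :: 'i \<Rightarrow> 'a. y i = a}" "closed {y :: 'i \<Rightarrow> 'a. y i = a}"
    using open_vimage[OF open_discrete c, of "{a}"] closed_vimage[OF closed_discrete c, of "{a}"]
    by (simp_all add: vimage_def)
qed

lemma cylinder_subset:
  fixes x :: "'i \<Rightarrow> 'a::discrete_topology"
  assumes "open U" "x \<in> U"
  obtains F where "finite F" "{y. \<forall>i\<in>F. y i = x i} \<subseteq> U"
proof -
  obtain X where X: "x \<in> (\<Pi>\<^sub>E i\<in>UNIV. X i)" "finite {i. X i \<noteq> UNIV}" "(\<Pi>\<^sub>E i\<in>UNIV. X i) \<subseteq> U"
    using product_topology_open_contains_basis[of "\<lambda>i. euclidean :: 'a topology" UNIV U x] assms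
    by (auto simp: open_fun_def)
  have "y \<in> (\<Pi>\<^sub>E i\<in>UNIV. X i)" if "\<forall>i\<in>{i. X i \<noteq> UNIV}. y i = x i" for y
    using that X(1) by (fastforce simp: PiE_iff)
  then show ?thesis using that[OF X(2)] X(3) by blast
qed

instance "fun" :: (countable, "{second_countable_topology, discrete_topology}") zero_dimensional
proof
  fix U :: "('a \<Rightarrow> 'b) set" and x assume "open U" "x \<in> U"
  then obtain F where F: "finite F" "{y. \<forall>i\<in>F. y i = x i} \<subseteq> U" by (rule cylinder_subset)
  have eq: "{y. \<forall>i\<in>F. y i = x i} = (\<Inter>i\<in>F. {y. y i = x i})" by auto
  have "open {y. \<forall>i\<in>F. y i = x i}" "closed {y. \<forall>i\<in>F. y i = x i}"
    unfolding eq using F(1) by (auto intro!: closed_INT open_INT clopen_coordinate)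
  then show "\<exists>K. open K \<and> closed K \<and> x \<in> K \<and> K \<subseteq> U" using F(2) by blast
qed

instance prod :: (zero_dimensional, zero_dimensional) zero_dimensional
proof
  fix U :: "('a \<times> 'b) set" and x assume "open U" "x \<in> U"
  then obtain A B where AB: "open A" "open B" "x \<in> A \<times> B" "A \<times> B \<subseteq> U" by (rule open_prod_elim)
  obtain K L where "open K" "closed K" "fst x \<in> K" "K \<subseteq> A" "open L" "closed L" "snd x \<in> L" "L \<subseteq> B"
    using clopen_base[OF AB(1), of "fst x"] clopen_base[OF AB(2), of "snd x"] AB(3) by auto
  then show "\<exists>K. open K \<and> closed K \<and> x \<in> K \<and> K \<subseteq> U"
    using AB(4) by (intro exI[of _ "K \<times> L"]) (auto simp: open_Times closed_Times mem_Times_iff)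
qed

lemma closed_contains:
  fixes x :: "nat \<Rightarrow> 'a::discrete_topology" and \<alpha> :: "nat \<Rightarrow> 'b::discrete_topology"
  assumes "closed C" "\<And>n. \<exists>y \<beta>. (y, \<beta>) \<in> C \<and> (\<forall>i<n. y i = x i \<and> \<beta> i = \<alpha> i)"
  shows "(x, \<alpha>) \<in> C"
proof (rule ccontr)
  assume "(x, \<alpha>) \<notin> C"
  then obtain A B where AB: "open A" "open B" "(x, \<alpha>) \<in> A \<times> B" "A \<times> B \<subseteq> - C"
    using open_prod_elim[of "- C" "(x, \<alpha>)"] assms(1) by (auto simp: open_Compl)
  obtain F where F: "finite F" "{y. \<forall>i\<in>F. y i = x i} \<subseteq> A" using cylinder_subset AB(1,3) by blast
  obtain G where G: "finite G" "{y. \<forall>i\<in>G. y i = \<alpha> i} \<subseteq> B" using cylinder_subset AB(2,3) by blast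
  obtain n where "F \<union> G \<subseteq> {..<n}" using F(1) G(1) finite_nat_iff_bounded[of "F \<union> G"] by auto
  moreover obtain y \<beta> where "(y, \<beta>) \<in> C" "\<forall>i<n. y i = x i \<and> \<beta> i = \<alpha> i" using assms(2) by blast
  ultimately have "y \<in> A" "\<beta> \<in> B" using F(2) G(2) by blast+
  then show False using \<open>(y, \<beta>) \<in> C\<close> AB(4) by blast
qed

text \<open>The point projected away and the witness for \<open>B\<close> are merged into one
  sequence as its even and odd entries. The continuous surjection \<open>w\<close> covers
  projections along spaces other than the Baire space, notably the Cantor space.\<close>

lemma analytic_set_fst_image:
  fixes B :: "('a::zero_dimensional \<times> 'w::zero_dimensional) set"
  assumes B: "B \<in> sets borel" and w: "continuous_on UNIV (w :: (nat \<Rightarrow> nat) \<Rightarrow> 'w)" "surj w"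
  shows "analytic_set (fst ` B)"
proof -
  obtain C :: "(('a \<times> 'w) \<times> (nat \<Rightarrow> nat)) set" where C: "closed C" "B = fst ` C"
    using analytic_set_borel[OF B] unfolding analytic_set_def by blast
  define D where "D = {p. ((fst p, w (\<lambda>i. snd p (2 * i))), \<lambda>i. snd p (2 * i + 1)) \<in> C}"
  have "continuous_on UNIV (\<lambda>p :: 'a \<times> (nat \<Rightarrow> nat). ((fst p, w (\<lambda>i. snd p (2 * i))), \<lambda>i. snd p (2 * i + 1)))"
    by (intro continuous_on_Pair continuous_reindex continuous_on_fst continuous_on_id
        continuous_on_compose2[OF w(1)]) auto
  from closed_vimage[OF C(1) this] have "closed D" by (simp add: vimage_def D_def)
  moreover have "fst ` B = fst ` D"
  proof (intro equalityI subsetI)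
    fix x assume "x \<in> fst ` B"
    then obtain z \<beta> where z: "((x, z), \<beta>) \<in> C" by (auto simp: C(2))
    obtain \<alpha> where \<alpha>: "z = w \<alpha>" using w(2) by (metis surjD)
    define \<gamma> where "\<gamma> i = (if even i then \<alpha> (i div 2) else \<beta> (i div 2))" for i
    have "(\<lambda>i. \<gamma> (2 * i)) = \<alpha>" "(\<lambda>i. \<gamma> (2 * i + 1)) = \<beta>" by (auto simp: \<gamma>_def)
    then have "(x, \<gamma>) \<in> D" using z \<alpha> by (simp add: D_def)
    then show "x \<in> fst ` D" by force
  next
    fix x assume "x \<in> fst ` D"
    then show "x \<in> fst ` B" by (force simp: C(2) D_def)
  qed
  ultimately show ?thesis unfolding analytic_set_def by blast
qed

lemma continuous_positive:
  "continuous_on UNIV (\<lambda>\<alpha> :: nat \<Rightarrow> nat. \<lambda>i. 0 < \<alpha> i)" "surj (\<lambda>\<alpha> :: nat \<Rightarrow> nat. \<lambda>i. 0 < \<alpha> i)"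
proof -
  have "continuous_on UNIV (\<lambda>k :: nat. 0 < k)" by simp
  then show "continuous_on UNIV (\<lambda>\<alpha> :: nat \<Rightarrow> nat. \<lambda>i. 0 < \<alpha> i)"
    by (intro continuous_on_coordinatewise_then_product)
      (rule continuous_on_compose2[of UNIV "\<lambda>k. 0 < k", OF _ continuous_on_product_coordinates], auto)
  show "surj (\<lambda>\<alpha> :: nat \<Rightarrow> nat. \<lambda>i. 0 < \<alpha> i)"
  proof (rule surjI)
    show "(\<lambda>i. 0 < (if x i then 1 else 0 :: nat)) = x" for x :: "nat \<Rightarrow> bool" by auto
  qed
qed

text \<open>
  If two analytic sets cannot be separated by a Borel set, then neither can two pieces of
  them on which longer and longer initial segments of the points and of their witnesses are
  fixed; in the limit this yields a common point.
\<close>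

theorem lusin_separation:
  fixes A A' :: "(nat \<Rightarrow> 'a::{second_countable_topology, discrete_topology, countable}) set"
  assumes "analytic_set A" "analytic_set A'" "A \<inter> A' = {}"
  obtains B where "B \<in> sets borel" "A \<subseteq> B" "B \<inter> A' = {}"
proof (rule ccontr)
  assume notthesis: "\<not> thesis"
  obtain C C' :: "((nat \<Rightarrow> 'a) \<times> (nat \<Rightarrow> nat)) set"
    where C: "closed C" "A = fst ` C" "closed C'" "A' = fst ` C'"
    using assms(1,2) unfolding analytic_set_def by blast
  define piece where "piece D w = {x. \<exists>\<alpha>. (x, \<alpha>) \<in> D \<and> (\<forall>i<length w. w ! i = (x i, \<alpha> i))}"
    for D :: "((nat \<Rightarrow> 'a) \<times> (nat \<Rightarrow> nat)) set" and w
  define sep where "sep X Y \<longleftrightarrow> (\<exists>B\<in>sets borel. X \<subseteq> B \<and> B \<inter> Y = {})" for X Y :: "(nat \<Rightarrow> 'a) set"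
  define bad where "bad p \<longleftrightarrow> \<not> sep (piece C (fst p)) (piece C' (snd p))" for p
  have piece_UN: "piece D w = (\<Union>a. piece D (w @ [a]))" for D w
    by (auto simp: piece_def nth_append less_Suc_eq)
  have "piece C [] = A" "piece C' [] = A'" unfolding C by (force simp: piece_def)+
  then have start: "bad ([], [])"
    using notthesis that by (auto simp: bad_def sep_def)
  have step: "\<exists>a b. bad (v @ [a], w @ [b])" if "bad (v, w)" for v w
  proof (rule ccontr)
    assume "\<nexists>a b. bad (v @ [a], w @ [b])"
    then have "\<forall>a b. \<exists>B\<in>sets borel. piece C (v @ [a]) \<subseteq> B \<and> B \<inter> piece C' (w @ [b]) = {}"
      by (auto simp: bad_def sep_def)
    then obtain B where B: "\<And>a b. B a b \<in> sets borel" "\<And>a b. piece C (v @ [a]) \<subseteq> B a b"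
      "\<And>a b. B a b \<inter> piece C' (w @ [b]) = {}"
      by metis
    \<comment> \<open>Separators of all pairs of pieces combine into one: intersecting over
      \<open>b\<close> separates a piece of \<open>C\<close> from all of \<open>C'\<close>, and
      uniting over \<open>a\<close> collects the pieces of \<open>C\<close>. Only countably many
      extensions occur.\<close>
    have "(\<Union>a. \<Inter>b. B a b) \<in> sets borel"
      using B(1) by (intro sets.countable_UN'' sets.countable_INT'') auto
    moreover have "piece C v \<subseteq> (\<Union>a. \<Inter>b. B a b)" using B(2) by (subst piece_UN) blast
    moreover have "(\<Union>a. \<Inter>b. B a b) \<inter> piece C' w = {}" using B(3) by (subst piece_UN) blast
    ultimately show False using that by (auto simp: bad_def sep_def)
  qed
  have "\<exists>W. W 0 = ([], []) \<and> (\<forall>n. bad (W n)) \<and>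
      (\<forall>n. \<exists>a b. W (Suc n) = (fst (W n) @ [a], snd (W n) @ [b]))"
  proof -
    have "\<exists>W. \<forall>n. (bad (W n) \<and> (n = 0 \<longrightarrow> W n = ([], []))) \<and>
      (\<exists>a b. W (Suc n) = (fst (W n) @ [a], snd (W n) @ [b]))"
    proof (rule dependent_nat_choice)
      fix p and n :: nat assume "bad p \<and> (n = 0 \<longrightarrow> p = ([], []))"
      then obtain a b where "bad (fst p @ [a], snd p @ [b])" using step[of "fst p" "snd p"] by auto
      then show "\<exists>q. (bad q \<and> (Suc n = 0 \<longrightarrow> q = ([], []))) \<and>
          (\<exists>a b. q = (fst p @ [a], snd p @ [b]))" by blast
    qed (use start in blast)
    then show ?thesis by auto
  qed
  then obtain W where W: "W 0 = ([], [])" "\<And>n. bad (W n)"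
    "\<And>n. \<exists>a b. W (Suc n) = (fst (W n) @ [a], snd (W n) @ [b])" by blast
  define z z' where "z n = last (fst (W (Suc n)))" and "z' n = last (snd (W (Suc n)))" for n
  have W_eq: "W n = (map z [0..<n], map z' [0..<n])" for n
  proof (induction n)
    case (Suc n)
    then show ?case using W(3)[of n] by (auto simp: z_def z'_def)
  qed (simp add: W(1))
  define x x' where "x = fst \<circ> z" and "x' = fst \<circ> z'"
  \<comment> \<open>An empty piece on either side would be separated by the empty set or by the
    whole space.\<close>
  have nonempty: "piece C (map z [0..<n]) \<noteq> {}" "piece C' (map z' [0..<n]) \<noteq> {}" for n
    using W(2)[of n] unfolding bad_def sep_def W_eq
    by (auto dest: bspec[of _ _ "{}"] bspec[of _ _ UNIV])
  have piece_iff: "y \<in> piece D (map v [0..<n]) \<longleftrightarrow> (\<exists>\<beta>. (y, \<beta>) \<in> D \<and> (\<forall>i<n. v i = (y i, \<beta> i)))"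
    for y D v n
    by (simp add: piece_def)
  have limit: "(fst \<circ> v, snd \<circ> v) \<in> D" if D: "closed D" "\<And>n. piece D (map v [0..<n]) \<noteq> {}" for D v
  proof (rule closed_contains[OF D(1)])
    fix n
    obtain y \<beta> where "(y, \<beta>) \<in> D" "\<forall>i<n. v i = (y i, \<beta> i)"
      using D(2)[of n] unfolding ex_in_conv[symmetric] piece_iff by blast
    then show "\<exists>y \<beta>. (y, \<beta>) \<in> D \<and> (\<forall>i<n. y i = (fst \<circ> v) i \<and> \<beta> i = (snd \<circ> v) i)"
      by (intro exI[of _ y] exI[of _ \<beta>]) simp
  qed
  have "x \<in> A" "x' \<in> A'"
    using imageI[OF limit[OF C(1) nonempty(1)], of fst] imageI[OF limit[OF C(3) nonempty(2)], of fst]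
    unfolding C x_def x'_def by simp_all
  then have "x \<noteq> x'" using assms(3) by blast
  then obtain i where i: "x i \<noteq> x' i" by (auto simp: fun_eq_iff)
  \<comment> \<open>The two limits differ at \<open>i\<close>, so a clopen cylinder already
    separates the pieces of length \<open>i + 1\<close>, which were chosen inseparable.\<close>
  have "{y. y i = x i} \<in> sets borel" using clopen_coordinate(1) by (rule borel_open)
  moreover have "piece C (map z [0..<Suc i]) \<subseteq> {y. y i = x i}"
    unfolding subset_iff piece_iff by (auto simp: x_def)
  moreover have "{y. y i = x i} \<inter> piece C' (map z' [0..<Suc i]) = {}"
    using i unfolding set_eq_iff Int_iff piece_iff by (auto simp: x'_def)
  ultimately have "sep (piece C (map z [0..<Suc i])) (piece C' (map z' [0..<Suc i]))"
    unfolding sep_def by blast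
  then show False using W(2)[of "Suc i"] unfolding bad_def W_eq by simp
qed

section \<open>Cantor codes and injective images of Borel sets\<close>

definition cantor_code ::
    "'a measure \<Rightarrow> ('a \<Rightarrow> nat \<Rightarrow> bool) \<Rightarrow> ((nat \<Rightarrow> bool) \<Rightarrow> 'a) \<Rightarrow> (nat \<Rightarrow> bool) set \<Rightarrow> bool" where
  "cantor_code M e j D \<longleftrightarrow> e \<in> measurable M borel \<and> D \<in> sets borel \<and>
     j \<in> measurable (restrict_space borel D) M \<and>
     (\<forall>x\<in>space M. e x \<in> D \<and> j (e x) = x) \<and> (\<forall>d\<in>D. e (j d) = d)"

lemma cantor_codeD:
  assumes "cantor_code M e j D"
  shows "e \<in> measurable M borel" "D \<in> sets borel" "j \<in> measurable (restrict_space borel D) M"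
    "\<And>x. x \<in> space M \<Longrightarrow> e x \<in> D" "\<And>x. x \<in> space M \<Longrightarrow> j (e x) = x"
    "\<And>d. d \<in> D \<Longrightarrow> e (j d) = d" "\<And>d. d \<in> D \<Longrightarrow> j d \<in> space M"
    "\<And>x y. x \<in> space M \<Longrightarrow> y \<in> space M \<Longrightarrow> e x = e y \<longleftrightarrow> x = y"
proof -
  show *: "e \<in> measurable M borel" "D \<in> sets borel" "j \<in> measurable (restrict_space borel D) M"
    "\<And>x. x \<in> space M \<Longrightarrow> e x \<in> D" "\<And>x. x \<in> space M \<Longrightarrow> j (e x) = x"
    "\<And>d. d \<in> D \<Longrightarrow> e (j d) = d"
    using assms by (auto simp: cantor_code_def)
  show "\<And>d. d \<in> D \<Longrightarrow> j d \<in> space M"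
    using measurable_space[OF *(3)] by (simp add: space_restrict_space)
  show "\<And>x y. x \<in> space M \<Longrightarrow> y \<in> space M \<Longrightarrow> e x = e y \<longleftrightarrow> x = y"
    using *(5) by metis
qed

lemma cantor_code_vimage:
  assumes "cantor_code M e j D" "A \<in> sets M"
  shows "{d \<in> D. j d \<in> A} \<in> sets borel"
proof -
  have "j -` A \<inter> space (restrict_space borel D) \<in> sets (restrict_space borel D)"
    using cantor_codeD(3)[OF assms(1)] assms(2) by (rule measurable_sets)
  moreover have "j -` A \<inter> space (restrict_space borel D) = {d \<in> D. j d \<in> A}"
    by (auto simp: space_restrict_space)
  ultimately show ?thesis
    using cantor_codeD(2)[OF assms(1)] by (simp add: sets_restrict_space_iff)
qed

lemma measurable_fst_borel: "fst \<in> measurable borel (borel :: 'a::topological_space measure)"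
  and measurable_snd_borel: "snd \<in> measurable borel (borel :: 'b::topological_space measure)"
  by (auto intro!: borel_measurable_continuous_onI continuous_on_fst continuous_on_snd continuous_on_id)

lemma sets_coordinate:
  assumes "h \<in> measurable M (borel :: ('i::countable \<Rightarrow> 'b::{second_countable_topology, discrete_topology}) measure)"
  shows "{x \<in> space M. h x n = b} \<in> sets M"
proof -
  have "h -` {y. y n = b} \<inter> space M \<in> sets M"
    using assms by (rule measurable_sets) (simp add: clopen_coordinate borel_open)
  then show ?thesis by (simp add: vimage_def Int_def conj_commute)
qed

lemma measurable_coordinatewise:
  assumes "\<And>n. {x \<in> space M. h x n} \<in> sets M"
  shows "h \<in> measurable M (borel :: ('i::countable \<Rightarrow> bool) measure)"
proof (rule measurable_coordinatewise_then_product)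
  fix n
  show "(\<lambda>x. h x n) \<in> borel_measurable M"
  proof (rule borel_measurableI)
    fix S :: "bool set"
    have "h x n \<in> S \<longleftrightarrow> h x n \<and> True \<in> S \<or> \<not> h x n \<and> False \<in> S" for x
      by (cases "h x n") auto
    then have "(\<lambda>x. h x n) -` S \<inter> space M =
        (if True \<in> S then {x \<in> space M. h x n} else {}) \<union> (if False \<in> S then space M - {x \<in> space M. h x n} else {})"
      by auto
    then show "(\<lambda>x. h x n) -` S \<inter> space M \<in> sets M" using assms[of n] by auto
  qed
qed

text \<open>The image is the projection of the graph of \<open>h\<close> transported to codes, the
  set of pairs \<open>(h x, e x)\<close> with \<open>x\<close> in \<open>Q\<close>. That set is
  Borel because the equation \<open>y = h (j d)\<close> can be checked one digit at a time, each
  digit giving one \<open>B n\<close>.\<close>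

lemma analytic_set_image:
  fixes h :: "'a \<Rightarrow> nat \<Rightarrow> bool"
  assumes code: "cantor_code M e j D" and h: "h \<in> measurable M borel" and Q: "Q \<in> sets M"
  shows "analytic_set (h ` Q)"
proof -
  define X where "X n = {d \<in> D. j d \<in> {x \<in> Q. h x n}}" for n
  define Y where "Y n = {d \<in> D. j d \<in> {x \<in> Q. \<not> h x n}}" for n
  have "{x \<in> Q. h x n} \<in> sets M" "{x \<in> Q. \<not> h x n} \<in> sets M" for n
    using sets.Int[OF Q sets_coordinate[OF h, of n True]] sets.Int[OF Q sets_coordinate[OF h, of n False]]
      sets.sets_into_space[OF Q] by (simp_all add: Int_def subset_iff conj_commute cong: conj_cong)
  then have XY: "X n \<in> sets borel" "Y n \<in> sets borel" for n
    unfolding X_def Y_def using cantor_code_vimage[OF code] by blast+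
  define B where "B n = (snd -` X n \<inter> fst -` {y. y n = True}) \<union> (snd -` Y n \<inter> fst -` {y. y n = False})"
    for n :: nat
  have "B n \<in> sets (borel :: ((nat \<Rightarrow> bool) \<times> (nat \<Rightarrow> bool)) measure)" for n
  proof -
    have "snd -` S \<in> sets (borel :: ((nat \<Rightarrow> bool) \<times> (nat \<Rightarrow> bool)) measure)"
      "fst -` S \<in> sets (borel :: ((nat \<Rightarrow> bool) \<times> (nat \<Rightarrow> bool)) measure)" if "S \<in> sets borel" for S
      using measurable_sets[OF measurable_snd_borel that] measurable_sets[OF measurable_fst_borel that] by simp_all
    moreover have "{y :: nat \<Rightarrow> bool. y n = b} \<in> sets borel" for b
      by (simp add: clopen_coordinate borel_open del: eq_True eq_False)
    ultimately show ?thesis unfolding B_def using XY by (intro sets.Un sets.Int) blast+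
  qed
  then have "(\<Inter>n. B n) \<in> sets borel" by (intro sets.countable_INT'') auto
  moreover have "h ` Q = fst ` (\<Inter>n. B n)"
  proof (intro equalityI subsetI)
    fix y assume "y \<in> h ` Q"
    then obtain x where x: "x \<in> Q" "y = h x" by blast
    then have "x \<in> space M" using sets.sets_into_space[OF Q] by blast
    then have "(y, e x) \<in> (\<Inter>n. B n)"
      using x cantor_codeD(4,5)[OF code] by (auto simp: B_def X_def Y_def)
    then show "y \<in> fst ` (\<Inter>n. B n)" by force
  next
    fix y assume "y \<in> fst ` (\<Inter>n. B n)"
    then obtain d where "\<forall>n. (y, d) \<in> B n" by auto
    then have d: "(y, d) \<in> B n" for n by blast
    have "j d \<in> Q" using d[of 0] by (auto simp: B_def X_def Y_def)
    moreover have "h (j d) = y" using d by (intro ext) (auto simp: B_def X_def Y_def)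
    ultimately show "y \<in> h ` Q" by blast
  qed
  ultimately show ?thesis using analytic_set_fst_image continuous_positive by metis
qed

text \<open>
  The sets of values of \<open>F\<close> on the points of \<open>P\<close> whose \<open>n\<close>-th digit is 1, respectively 0, are
  disjoint. Borel sets \<open>B n\<close> separating them let us read off the digits of the preimage from
  the value.
\<close>

theorem lusin_souslin:
  assumes M: "cantor_code M e j D" and N: "cantor_code N e' j' D'"
    and F: "F \<in> measurable M N" and P: "P \<in> sets M" and inj: "inj_on F P"
  shows "F ` P \<in> sets N"
proof -
  have PM: "P \<subseteq> space M" using P by (rule sets.sets_into_space)
  have FN: "x \<in> P \<Longrightarrow> F x \<in> space N" for x using measurable_space[OF F] PM by blast
  have h: "(\<lambda>x. e' (F x)) \<in> measurable M borel"
    using F cantor_codeD(1)[OF N] by (rule measurable_compose)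
  define Q where "Q n b = {x \<in> P. e x n = b}" for n b
  have Q: "Q n b \<in> sets M" for n b
    using sets.Int[OF P sets_coordinate[OF cantor_codeD(1)[OF M], of n b]] PM
    unfolding Q_def by (simp add: Int_def subset_iff conj_commute cong: conj_cong)
  have "\<exists>B\<in>sets borel. (\<lambda>x. e' (F x)) ` Q n True \<subseteq> B \<and> B \<inter> (\<lambda>x. e' (F x)) ` Q n False = {}" for n
  proof -
    have disj: "(\<lambda>x. e' (F x)) ` Q n True \<inter> (\<lambda>x. e' (F x)) ` Q n False = {}"
    proof (rule ccontr)
      assume "\<not> ?thesis"
      then obtain x y where xy: "x \<in> Q n True" "y \<in> Q n False" "e' (F x) = e' (F y)" by auto
      then have "x \<in> P" "y \<in> P" by (auto simp: Q_def)
      then have "x = y" using xy(3) cantor_codeD(8)[OF N FN FN] inj by (metis inj_onD)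
      then show False using xy by (auto simp: Q_def)
    qed
    show ?thesis
      by (rule lusin_separation[OF analytic_set_image[OF M h Q] analytic_set_image[OF M h Q] disj]) blast
  qed
  then obtain B where B: "\<And>n. B n \<in> sets borel" "\<And>n. (\<lambda>x. e' (F x)) ` Q n True \<subseteq> B n"
    "\<And>n. B n \<inter> (\<lambda>x. e' (F x)) ` Q n False = {}" by metis
  define H where "H z n \<longleftrightarrow> e' z \<in> B n" for z n
  have H_measurable: "H \<in> measurable N borel"
  proof (rule measurable_coordinatewise)
    fix n
    show "{z \<in> space N. H z n} \<in> sets N"
      using measurable_sets[OF cantor_codeD(1)[OF N] B(1)[of n]]
      by (simp add: H_def vimage_def Int_def conj_commute)
  qed
  have H_F: "H (F x) = e x" if "x \<in> P" for x
  proof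
    fix n
    show "H (F x) n = e x n" using B(2,3)[of n] that by (cases "e x n") (auto simp: H_def Q_def)
  qed
  \<comment> \<open>Off the image of \<open>P\<close> the sequence \<open>H z\<close> may be
    meaningless. \<open>R\<close> keeps the \<open>z\<close> for which it codes some point of
    \<open>P\<close>, and the image then consists of those that \<open>F\<close> returns from this
    point.\<close>
  define R where "R = {z \<in> space N. H z \<in> {d \<in> D. j d \<in> P}}"
  have R: "R \<in> sets N"
    using measurable_sets[OF H_measurable cantor_code_vimage[OF M P]]
    by (simp add: R_def vimage_def Int_def conj_commute)
  have jH: "(\<lambda>z. e' (F (j (H z)))) \<in> measurable (restrict_space N R) borel"
  proof -
    have "H \<in> measurable (restrict_space N R) (restrict_space borel D)"
      by (rule measurable_restrict_space2[OF _ measurable_restrict_space1[OF H_measurable]])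
        (auto simp: R_def space_restrict_space)
    from measurable_compose[OF measurable_compose[OF this cantor_codeD(3)[OF M]] h]
    show ?thesis .
  qed
  have "F ` P = (\<Inter>n. {z \<in> R. e' (F (j (H z))) n = e' z n})"
  proof (intro equalityI subsetI)
    fix z assume "z \<in> F ` P"
    then obtain x where x: "x \<in> P" "z = F x" by blast
    have xM: "x \<in> space M" using PM x(1) by blast
    have "H z = e x" "j (H z) = x"
      using H_F[OF x(1)] x(2) cantor_codeD(5)[OF M xM] by simp_all
    then show "z \<in> (\<Inter>n. {z \<in> R. e' (F (j (H z))) n = e' z n})"
      using x FN[OF x(1)] cantor_codeD(4)[OF M xM] by (simp add: R_def)
  next
    fix z assume z: "z \<in> (\<Inter>n. {z \<in> R. e' (F (j (H z))) n = e' z n})"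
    then have "z \<in> R" "e' (F (j (H z))) = e' z" by auto
    then have "j (H z) \<in> P" "F (j (H z)) = z" using cantor_codeD(8)[OF N FN] by (auto simp: R_def)
    then show "z \<in> F ` P" by (metis imageI)
  qed
  moreover have "{z \<in> R. e' (F (j (H z))) n = e' z n} \<in> sets N" for n
  proof -
    have e': "e' \<in> measurable (restrict_space N R) borel"
      using cantor_codeD(1)[OF N] by (rule measurable_restrict_space1)
    let ?S = "restrict_space N R"
    have "{z \<in> R. e' (F (j (H z))) n = e' z n} =
      ({z \<in> space ?S. e' (F (j (H z))) n = True} \<inter> {z \<in> space ?S. e' z n = True}) \<union>
      ({z \<in> space ?S. e' (F (j (H z))) n = False} \<inter> {z \<in> space ?S. e' z n = False})"
      using sets.sets_into_space[OF R] by (auto simp: space_restrict_space)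
    also have "\<dots> \<in> sets ?S"
      by (intro sets.Un sets.Int sets_coordinate jH e')
    finally show ?thesis using R by (simp add: sets_restrict_space_iff)
  qed
  ultimately show ?thesis by (simp add: sets.countable_INT'')
qed

lemma cantor_code_prod:
  assumes M: "cantor_code M e j D" and N: "cantor_code N e' j' D'"
  shows "\<exists>f k D''. cantor_code (M \<Otimes>\<^sub>M N) f k D''"
proof -
  define f where "f p n = (if even n then e (fst p) (n div 2) else e' (snd p) (n div 2))" for p n
  define ev od where "ev z n = z (2 * n)" and "od z n = z (Suc (2 * n))" for z :: "nat \<Rightarrow> bool" and n
  define D'' where "D'' = {z. ev z \<in> D \<and> od z \<in> D'}"
  define k where "k z = (j (ev z), j' (od z))" for z
  have ev: "ev \<in> measurable borel borel" and od: "od \<in> measurable borel borel"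
  proof -
    have "{z :: nat \<Rightarrow> bool. z n} \<in> sets borel" for n
      using clopen_coordinate(1)[of n True] by (simp add: borel_open)
    then show "ev \<in> measurable borel borel" "od \<in> measurable borel borel"
      unfolding ev_def od_def by (simp_all add: measurable_coordinatewise)
  qed
  have D'': "D'' \<in> sets borel"
    using sets.Int[OF measurable_sets[OF ev cantor_codeD(2)[OF M]] measurable_sets[OF od cantor_codeD(2)[OF N]]]
    by (simp add: D''_def vimage_def Int_def)
  have f: "f \<in> measurable (M \<Otimes>\<^sub>M N) borel"
  proof (rule measurable_coordinatewise)
    fix n
    have "(\<lambda>p. e (fst p)) \<in> measurable (M \<Otimes>\<^sub>M N) borel" "(\<lambda>p. e' (snd p)) \<in> measurable (M \<Otimes>\<^sub>M N) borel"
      using cantor_codeD(1)[OF M] cantor_codeD(1)[OF N] by simp_all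
    from this[THEN sets_coordinate, of "n div 2" True]
    show "{p \<in> space (M \<Otimes>\<^sub>M N). f p n} \<in> sets (M \<Otimes>\<^sub>M N)" by (simp add: f_def)
  qed
  have k: "k \<in> measurable (restrict_space borel D'') (M \<Otimes>\<^sub>M N)"
  proof -
    have "ev \<in> measurable (restrict_space borel D'') (restrict_space borel D)"
      "od \<in> measurable (restrict_space borel D'') (restrict_space borel D')"
      by (rule measurable_restrict_space2[OF _ measurable_restrict_space1[OF ev]]
          measurable_restrict_space2[OF _ measurable_restrict_space1[OF od]],
          simp add: D''_def space_restrict_space)+
    from measurable_compose[OF this(1) cantor_codeD(3)[OF M]] measurable_compose[OF this(2) cantor_codeD(3)[OF N]]
    show ?thesis unfolding k_def by (rule measurable_Pair)
  qed
  have ev_f: "ev (f p) = e (fst p)" and od_f: "od (f p) = e' (snd p)" for p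
    by (auto simp: ev_def od_def f_def)
  have "f (k z) = z" if "z \<in> D''" for z
  proof
    fix n
    have "e (j (ev z)) = ev z" "e' (j' (od z)) = od z"
      using that cantor_codeD(6)[OF M] cantor_codeD(6)[OF N] by (auto simp: D''_def)
    then show "f (k z) n = z n" by (auto simp: f_def k_def ev_def od_def)
  qed
  moreover have "f p \<in> D'' \<and> k (f p) = p" if "p \<in> space (M \<Otimes>\<^sub>M N)" for p
    using that cantor_codeD(4,5)[OF M] cantor_codeD(4,5)[OF N]
    by (auto simp: D''_def k_def ev_f od_f space_pair_measure)
  ultimately have "cantor_code (M \<Otimes>\<^sub>M N) f k D''"
    unfolding cantor_code_def using f k D'' by blast
  then show ?thesis by blast
qed

section \<open>Polish spaces and Borel transversals\<close>

lemma openin_Pow: "{U. openin \<tau> U} \<subseteq> Pow (topspace \<tau>)"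
  using openin_subset by blast

lemma space_borel_of [simp]: "space (borel_of \<tau>) = topspace \<tau>"
  by (simp add: borel_of_def openin_Pow space_measure_of_conv)

lemma openin_borel_of: "openin \<tau> U \<Longrightarrow> U \<in> sets (borel_of \<tau>)"
  unfolding borel_of_def by (rule in_measure_of[OF openin_Pow]) simp

lemma measurable_borel_ofI:
  assumes "\<And>x. x \<in> space N \<Longrightarrow> f x \<in> topspace \<tau>"
    and "\<And>U. openin \<tau> U \<Longrightarrow> {x \<in> space N. f x \<in> U} \<in> sets N"
  shows "f \<in> measurable N (borel_of \<tau>)"
  unfolding borel_of_def
  by (rule measurable_measure_of[OF openin_Pow])
    (use assms in \<open>auto simp: vimage_def Int_def conj_commute\<close>)

abbreviation eps :: "nat \<Rightarrow> real" where
  "eps k \<equiv> (1 / 2) ^ k"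

lemma eps_less: "0 < \<epsilon> \<Longrightarrow> \<exists>k. eps k < \<epsilon>"
  by (rule real_arch_pow_inv) auto

lemma eps_antimono: "k \<le> l \<Longrightarrow> eps l \<le> eps k"
  by (rule power_decreasing) auto

locale polish_metric = Metric_space M d for M :: "'a set" and d +
  fixes q :: "nat \<Rightarrow> 'a"
  assumes complete: mcomplete and q_in: "q n \<in> M"
    and dense: "x \<in> M \<Longrightarrow> 0 < \<epsilon> \<Longrightarrow> \<exists>n. d (q n) x < \<epsilon>"

lemma polish_topologyE:
  assumes "polish_topology \<tau>" "topspace \<tau> \<noteq> {}"
  obtains d q where "polish_metric (topspace \<tau>) d q" "Metric_space.mtopology (topspace \<tau>) d = \<tau>"
proof -
  obtain M d where d: "Metric_space M d" "Metric_space.mcomplete M d" "\<tau> = Metric_space.mtopology M d"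
    using assms(1) unfolding polish_topology_def completely_metrizable_space_def by blast
  interpret Metric_space M d by (rule d(1))
  have M: "topspace \<tau> = M" using d(3) by simp
  obtain C where C: "countable C" "C \<subseteq> M" "mtopology closure_of C = M"
    using assms(1) unfolding polish_topology_def separable_space_def d(3) by auto
  have "C \<noteq> {}" using C(3) assms(2) M by auto
  define q where "q = from_nat_into C"
  have q: "range q = C" unfolding q_def using C(1) \<open>C \<noteq> {}\<close> by (intro range_from_nat_into)
  have "polish_metric M d q"
  proof
    show mcomplete by (rule d(2))
    show "q n \<in> M" for n using q C(2) by blast
    fix x and \<epsilon> :: real assume "x \<in> M" "0 < \<epsilon>"
    then have "\<exists>y\<in>C. y \<in> mball x \<epsilon>" using C(3) unfolding metric_closure_of by blast
    then show "\<exists>n. d (q n) x < \<epsilon>" using q by (auto simp: commute)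
  qed
  then show ?thesis using that[of d q] d(3) M by simp
qed

context polish_metric
begin

lemma ball_base:
  assumes "openin mtopology U" "x \<in> U"
  obtains n k where "x \<in> mball (q n) (eps k)" "mball (q n) (eps k) \<subseteq> U"
proof -
  obtain r where r: "r > 0" "mball x r \<subseteq> U" "x \<in> M"
    using assms unfolding openin_mtopology by blast
  obtain k where k: "eps k < r / 2" using eps_less[of "r / 2"] r(1) by auto
  obtain n where n: "d (q n) x < eps k" using dense[OF r(3), of "eps k"] by auto
  have "mball (q n) (eps k) \<subseteq> mball x r"
  proof
    fix y assume "y \<in> mball (q n) (eps k)"
    then have y: "y \<in> M" "d (q n) y < eps k" by auto
    have "d x y \<le> d x (q n) + d (q n) y" using triangle[OF r(3) q_in y(1)] .
    then show "y \<in> mball x r" using y n k r(3) commute[of x "q n"] by simp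
  qed
  then show ?thesis using that[of n k] n r q_in by auto
qed

lemma eq_if_close:
  assumes "x \<in> M" "y \<in> M" "\<And>k. d x y \<le> 2 * eps k"
  shows "x = y"
proof (rule ccontr)
  assume "x \<noteq> y"
  then have "0 < d x y / 2" using assms by simp
  then obtain k where "eps k < d x y / 2" using eps_less by blast
  then show False using assms(3)[of k] by simp
qed

lemma limit_exists:
  assumes s: "\<And>l. s l \<in> M" and close: "\<And>k l. d (s k) (s l) < eps k + eps l"
  obtains x where "x \<in> M" "\<And>l. d (s l) x \<le> eps l" "\<And>y. y \<in> M \<Longrightarrow> (\<lambda>l. d y (s l)) \<longlonglongrightarrow> d y x"
    "limitin mtopology s x sequentially"
proof -
  have "MCauchy s"
    unfolding MCauchy_def
  proof (intro conjI allI impI)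
    fix \<epsilon> :: real assume "0 < \<epsilon>"
    then obtain k where k: "eps k < \<epsilon> / 2" using eps_less[of "\<epsilon> / 2"] by auto
    have "d (s m) (s n) < \<epsilon>" if "k \<le> m" "k \<le> n" for m n
      using close[of m n] k eps_antimono[OF that(1)] eps_antimono[OF that(2)] by linarith
    then show "\<exists>N. \<forall>n n'. N \<le> n \<longrightarrow> N \<le> n' \<longrightarrow> d (s n) (s n') < \<epsilon>" by blast
  qed (use s in auto)
  then obtain x where x: "limitin mtopology s x sequentially" using complete unfolding mcomplete_def by blast
  then have xM: "x \<in> M" using limitin_mspace by blast
  have lim0: "(\<lambda>l. d (s l) x) \<longlonglongrightarrow> 0"
    using x s unfolding limit_metric_sequentially LIMSEQ_iff by auto
  have lim: "(\<lambda>l. d y (s l)) \<longlonglongrightarrow> d y x" if y: "y \<in> M" for y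
  proof (rule LIM_zero_cancel, rule Lim_null_comparison[OF _ lim0])
    have "\<bar>d y (s l) - d y x\<bar> \<le> d (s l) x" for l
      using triangle[OF y s[of l] xM] triangle[OF y xM s[of l]] commute[of x "s l"] by linarith
    then show "\<forall>\<^sub>F l in sequentially. norm (d y (s l) - d y x) \<le> d (s l) x" by simp
  qed
  have "d (s l) x \<le> eps l" for l
  proof (rule LIMSEQ_le[OF lim[OF s[of l]]])
    have "(\<lambda>k. eps k) \<longlonglongrightarrow> 0" by (rule LIMSEQ_realpow_zero) auto
    from tendsto_add[OF tendsto_const this, of "eps l"]
    show "(\<lambda>k. eps l + eps k) \<longlonglongrightarrow> eps l" by simp
    show "\<exists>N. \<forall>n\<ge>N. d (s l) (s n) \<le> eps l + eps n" using close less_imp_le by blast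
  qed
  then show ?thesis using that xM lim x by blast
qed

definition digits :: "'a \<Rightarrow> nat \<Rightarrow> bool" where
  "digits x i = (case prod_decode i of (n, k) \<Rightarrow> d (q n) x < eps k)"

lemma digits_encode: "digits x (prod_encode (n, k)) \<longleftrightarrow> d (q n) x < eps k"
  by (simp add: digits_def)

text \<open>
  The last clause of \<open>codes\<close> says that the limit point \<open>x\<close> coded by \<open>z\<close> satisfies
  \<open>d (q n) x < eps k\<close> exactly when \<open>z\<close> claims so.
\<close>

definition codes :: "(nat \<Rightarrow> bool) set" where
  "codes = {z. (\<forall>k. \<exists>n. z (prod_encode (n, k))) \<and>
     (\<forall>n n' k k'. z (prod_encode (n, k)) \<and> z (prod_encode (n', k')) \<longrightarrow> d (q n) (q n') < eps k + eps k') \<and>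
     (\<forall>n k. z (prod_encode (n, k)) \<longleftrightarrow>
        (\<exists>m L. \<forall>l\<ge>L. \<forall>n'. z (prod_encode (n', l)) \<longrightarrow> d (q n) (q n') \<le> eps k - eps m))}"

lemma codes_borel: "codes \<in> sets borel"
proof -
  have [measurable]: "Measurable.pred borel (\<lambda>z :: nat \<Rightarrow> bool. z i)" for i
    using clopen_coordinate(1)[of i True] by (simp add: pred_def borel_open)
  have "Measurable.pred borel (\<lambda>z :: nat \<Rightarrow> bool. (\<forall>k. \<exists>n. z (prod_encode (n, k))) \<and>
     (\<forall>n n' k k'. z (prod_encode (n, k)) \<and> z (prod_encode (n', k')) \<longrightarrow> d (q n) (q n') < eps k + eps k') \<and>
     (\<forall>n k. z (prod_encode (n, k)) \<longleftrightarrow>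
        (\<exists>m L. \<forall>l\<ge>L. \<forall>n'. z (prod_encode (n', l)) \<longrightarrow> d (q n) (q n') \<le> eps k - eps m)))"
    by measurable
  then show ?thesis by (simp add: pred_def codes_def)
qed

lemma digits_in_codes:
  assumes x: "x \<in> M"
  shows "digits x \<in> codes"
proof -
  have near: "d (q n) (q n') < eps k + eps k'" if "d (q n) x < eps k" "d (q n') x < eps k'" for n n' k k'
    using that triangle[OF q_in x q_in, of n n'] commute[of x "q n'"] by simp
  have "d (q n) x < eps k \<longleftrightarrow>
    (\<exists>m L. \<forall>l\<ge>L. \<forall>n'. d (q n') x < eps l \<longrightarrow> d (q n) (q n') \<le> eps k - eps m)" (is "?l \<longleftrightarrow> ?r") for n k
  proof
    assume ?l
    \<comment> \<open>Half of the gap pays for the margin \<open>eps m\<close>, the other half for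
      the distance between \<open>x\<close> and the approximating centre.\<close>
    then obtain m where m: "eps m < (eps k - d (q n) x) / 2" using eps_less[of "(eps k - d (q n) x) / 2"] by auto
    have "d (q n) (q n') \<le> eps k - eps m" if "m \<le> l" "d (q n') x < eps l" for l n'
      using that(2) m eps_antimono[OF that(1)] triangle[OF q_in x q_in, of n n'] commute[of x "q n'"]
      by argo
    then show ?r by blast
  next
    assume ?r
    then obtain m L where mL: "\<And>l n'. l \<ge> L \<Longrightarrow> d (q n') x < eps l \<Longrightarrow> d (q n) (q n') \<le> eps k - eps m" by blast
    \<comment> \<open>Taking \<open>l\<close> beyond \<open>m\<close> makes the approximation error
      \<open>eps l\<close> strictly smaller than the margin.\<close>
    define l where "l = max L (Suc m)"
    obtain n' where n': "d (q n') x < eps l" using dense[OF x, of "eps l"] by auto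
    have "eps l < eps m" by (rule power_strict_decreasing) (auto simp: l_def)
    moreover have "d (q n) (q n') \<le> eps k - eps m" using mL[of l n'] n' by (simp add: l_def)
    ultimately show ?l using n' triangle[OF q_in q_in x, of n n'] by linarith
  qed
  then show ?thesis
    unfolding codes_def digits_encode mem_Collect_eq
  proof (intro conjI allI impI)
    show "\<exists>n. d (q n) x < eps k" for k using dense[OF x, of "eps k"] by simp
  qed (use near in blast)+
qed

text \<open>The first two clauses of \<open>codes\<close> provide a Cauchy sequence of centres, one
  for each radius. The third clause mentions no limit point; comparing it with the limit of these
  centres shows that \<open>z\<close> is the sequence of digits of this limit.\<close>

lemma codes_eq_digits:
  assumes z: "z \<in> codes"
  shows "\<exists>x\<in>M. digits x = z"
proof -
  have ex: "\<forall>k. \<exists>n. z (prod_encode (n, k))"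
    and near: "\<And>n n' k k'. z (prod_encode (n, k)) \<Longrightarrow> z (prod_encode (n', k')) \<Longrightarrow> d (q n) (q n') < eps k + eps k'"
    and iff: "\<And>n k. z (prod_encode (n, k)) \<longleftrightarrow>
        (\<exists>m L. \<forall>l\<ge>L. \<forall>n'. z (prod_encode (n', l)) \<longrightarrow> d (q n) (q n') \<le> eps k - eps m)"
    using z unfolding codes_def by blast+
  obtain c where c: "\<And>k. z (prod_encode (c k, k))" using ex by metis
  obtain x where x: "x \<in> M" "\<And>l. d (q (c l)) x \<le> eps l" "\<And>y. y \<in> M \<Longrightarrow> (\<lambda>l. d y (q (c l))) \<longlonglongrightarrow> d y x"
    using limit_exists[of "\<lambda>l. q (c l)"] q_in near[OF c c] by metis
  have near_x: "d (q n) x \<le> eps k" if "z (prod_encode (n, k))" for n k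
  proof (rule LIMSEQ_le[OF x(3)[OF q_in[of n]]])
    have "(\<lambda>l. eps l) \<longlonglongrightarrow> 0" by (rule LIMSEQ_realpow_zero) auto
    from tendsto_add[OF tendsto_const this, of "eps k"]
    show "(\<lambda>l. eps k + eps l) \<longlonglongrightarrow> eps k" by simp
    show "\<exists>N. \<forall>l\<ge>N. d (q n) (q (c l)) \<le> eps k + eps l" using near[OF that c] less_imp_le by blast
  qed
  have "d (q n) x < eps k \<longleftrightarrow> z (prod_encode (n, k))" for n k
  proof
    assume "d (q n) x < eps k"
    then obtain m where m: "eps m < (eps k - d (q n) x) / 2" using eps_less[of "(eps k - d (q n) x) / 2"] by auto
    have "d (q n) (q n') \<le> eps k - eps m" if "m \<le> l" "z (prod_encode (n', l))" for l n'
      using near_x[OF that(2)] m eps_antimono[OF that(1)] triangle[OF q_in x(1) q_in, of n n'] commute[of x "q n'"]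
      by argo
    then show "z (prod_encode (n, k))" unfolding iff[of n k] by blast
  next
    assume "z (prod_encode (n, k))"
    then obtain m L where mL: "\<And>l n'. l \<ge> L \<Longrightarrow> z (prod_encode (n', l)) \<Longrightarrow> d (q n) (q n') \<le> eps k - eps m"
      unfolding iff[of n k] by blast
    have "d (q n) x \<le> eps k - eps m"
      by (rule LIMSEQ_le_const2[OF x(3)[OF q_in[of n]]]) (use mL c in blast)
    moreover have "0 < eps m" by simp
    ultimately show "d (q n) x < eps k" by linarith
  qed
  then have "digits x i = z i" for i
    unfolding digits_def by (cases "prod_decode i") (metis prod_decode_inverse case_prod_conv)
  then show ?thesis using x(1) by blast
qed

lemma digits_inject:
  assumes "x \<in> M" "y \<in> M" "digits x = digits y"
  shows "x = y"
proof (rule eq_if_close[OF assms(1,2)])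
  fix k
  obtain n where n: "d (q n) x < eps k" using dense[OF assms(1), of "eps k"] by auto
  then have "d (q n) y < eps k" using assms(3) digits_encode by metis
  then show "d x y \<le> 2 * eps k" using n triangle[OF assms(1) q_in assms(2), of n] commute[of x "q n"] by simp
qed

lemma cantor_code_borel_of: "\<exists>e j D. cantor_code (borel_of mtopology) e j D"
proof -
  define j where "j z = (THE x. x \<in> M \<and> digits x = z)" for z
  have j_digits: "j (digits x) = x" if "x \<in> M" for x
    unfolding j_def using that digits_inject by blast
  have "digits \<in> measurable (borel_of mtopology) borel"
  proof (rule measurable_coordinatewise)
    fix i
    obtain n k where nk: "prod_decode i = (n, k)" by fastforce
    have "{x \<in> space (borel_of mtopology). digits x i} = mball (q n) (eps k)"
      using q_in by (auto simp: digits_def nk)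
    then show "{x \<in> space (borel_of mtopology). digits x i} \<in> sets (borel_of mtopology)"
      using openin_borel_of[OF openin_mball] by simp
  qed
  moreover have "j \<in> measurable (restrict_space borel codes) (borel_of mtopology)"
  proof (rule measurable_borel_ofI)
    fix z assume "z \<in> space (restrict_space borel codes)"
    then show "j z \<in> topspace mtopology"
      using codes_eq_digits j_digits by (fastforce simp: space_restrict_space)
  next
    fix U assume U: "openin mtopology U"
    define I where "I = {(n, k). mball (q n) (eps k) \<subseteq> U}"
    have "{z \<in> space (restrict_space borel codes). j z \<in> U} =
        codes \<inter> (\<Union>p\<in>I. {z. z (prod_encode p) = True})"
    proof (intro equalityI subsetI)
      fix z assume "z \<in> {z \<in> space (restrict_space borel codes). j z \<in> U}"
      then have z: "z \<in> codes" "j z \<in> U" by (auto simp: space_restrict_space)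
      obtain x where x: "x \<in> M" "digits x = z" using codes_eq_digits[OF z(1)] by blast
      then have "x \<in> U" using z(2) j_digits by auto
      then obtain n k where "x \<in> mball (q n) (eps k)" "mball (q n) (eps k) \<subseteq> U" using ball_base U by metis
      then show "z \<in> codes \<inter> (\<Union>p\<in>I. {z. z (prod_encode p) = True})"
        using z(1) x(2) digits_encode by (fastforce simp: I_def)
    next
      fix z assume "z \<in> codes \<inter> (\<Union>p\<in>I. {z. z (prod_encode p) = True})"
      then obtain n k where z: "z \<in> codes" "mball (q n) (eps k) \<subseteq> U" "z (prod_encode (n, k))"
        by (auto simp: I_def)
      obtain x where x: "x \<in> M" "digits x = z" using codes_eq_digits[OF z(1)] by blast
      then have "d (q n) x < eps k" using z(3) digits_encode by metis
      then have "x \<in> U" using z(2) x(1) q_in by auto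
      then show "z \<in> {z \<in> space (restrict_space borel codes). j z \<in> U}"
        using z(1) x j_digits by (auto simp: space_restrict_space)
    qed
    moreover have "codes \<inter> (\<Union>p\<in>I. {z. z (prod_encode p) = True}) \<in> sets borel"
      by (intro sets.Int codes_borel sets.countable_UN' countableI_type image_subsetI
          borel_open[OF clopen_coordinate(1)])
    ultimately show "{z \<in> space (restrict_space borel codes). j z \<in> U} \<in> sets (restrict_space borel codes)"
      using codes_borel by (simp add: sets_restrict_space_iff)
  qed
  moreover have "digits (j z) = z" if "z \<in> codes" for z
    using codes_eq_digits[OF that] j_digits by auto
  ultimately have "cantor_code (borel_of mtopology) digits j codes"
    unfolding cantor_code_def using codes_borel digits_in_codes j_digits by simp
  then show ?thesis by blast
qed

end

theorem standard_borel_cantor_code: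
  assumes "standard_borel N"
  shows "\<exists>e j D. cantor_code N e j D"
proof -
  obtain \<tau> where \<tau>: "polish_topology \<tau>" "space N = topspace \<tau>" "sets N = sets (borel_of \<tau>)"
    using assms unfolding standard_borel_def by blast
  show ?thesis
  proof (cases "topspace \<tau> = {}")
    case True
    then have "cantor_code N undefined undefined {}"
      using \<tau>(2) by (auto simp: cantor_code_def measurable_def space_restrict_space sets_eq_bot)
    then show ?thesis by blast
  next
    case False
    then obtain d q where dq: "polish_metric (topspace \<tau>) d q" "Metric_space.mtopology (topspace \<tau>) d = \<tau>"
      using polish_topologyE \<tau>(1) by metis
    obtain e j D where "cantor_code (borel_of \<tau>) e j D"
      using polish_metric.cantor_code_borel_of[OF dq(1)] dq(2) by metis
    then have "cantor_code N e j D"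
      unfolding cantor_code_def using \<tau>(2,3) by (simp cong: measurable_cong_sets)
    then show ?thesis by blast
  qed
qed

section \<open>Borel selection from closed sets\<close>

lemma Least_eq_iff:
  fixes n :: nat
  assumes "\<exists>m. P m"
  shows "(LEAST m. P m) = n \<longleftrightarrow> P n \<and> (\<forall>m<n. \<not> P m)"
proof
  assume "(LEAST m. P m) = n"
  then show "P n \<and> (\<forall>m<n. \<not> P m)" using LeastI_ex[OF assms] not_less_Least by blast
next
  assume "P n \<and> (\<forall>m<n. \<not> P m)"
  then show "(LEAST m. P m) = n" by (intro Least_equality) (auto simp: not_less[symmetric])
qed

context polish_metric
begin

definition cell :: "nat list \<Rightarrow> 'a set" where
  "cell ns = {x \<in> M. \<forall>i<length ns. d (q (ns ! i)) x < eps i}"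

text \<open>This is the selection of Kuratowski and Ryll-Nardzewski. Taking the least admissible
  index at each stage makes the choice a function of which open cells \<open>C\<close> meets, and
  hence canonical as well as Borel.\<close>

primrec sel_seq :: "'a set \<Rightarrow> nat \<Rightarrow> nat list" where
  "sel_seq C 0 = []"
| "sel_seq C (Suc k) = sel_seq C k @ [LEAST n. C \<inter> cell (sel_seq C k @ [n]) \<noteq> {}]"

definition sel_index :: "'a set \<Rightarrow> nat \<Rightarrow> nat" where
  "sel_index C k = last (sel_seq C (Suc k))"

text \<open>
  The point selected from a nonempty closed set \<open>C\<close> is the limit of the \<open>sel_index C k\<close>-th points
  of the dense sequence.
\<close>

definition selected :: "'a set \<Rightarrow> 'a \<Rightarrow> bool" where
  "selected C y \<longleftrightarrow> (\<forall>k. d (q (sel_index C k)) y \<le> eps k)"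

lemma sel_seq_eq: "sel_seq C k = map (sel_index C) [0..<k]"
  by (induction k) (simp_all add: sel_index_def)

lemma cell_openin: "openin mtopology (cell ns)"
proof -
  have "cell ns = topspace mtopology \<inter> (\<Inter>i\<in>{..<length ns}. mball (q (ns ! i)) (eps i))" if "ns \<noteq> []"
    using q_in by (auto simp: cell_def)
  moreover have "cell [] = topspace mtopology" by (simp add: cell_def)
  moreover have "openin mtopology (\<Inter>i\<in>{..<length ns}. mball (q (ns ! i)) (eps i))" if "ns \<noteq> []"
    using that by (intro openin_INT2) auto
  ultimately show ?thesis by (cases "ns = []") (auto intro: openin_Int)
qed

lemma cell_extend:
  assumes "C \<inter> cell ns \<noteq> {}"
  shows "\<exists>n. C \<inter> cell (ns @ [n]) \<noteq> {}"
proof -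
  obtain x where x: "x \<in> C" "x \<in> cell ns" using assms by blast
  then have "x \<in> M" by (simp add: cell_def)
  then obtain n where "d (q n) x < eps (length ns)" using dense[of x "eps (length ns)"] by auto
  then have "x \<in> cell (ns @ [n])" using x(2) by (auto simp: cell_def nth_append less_Suc_eq)
  then show ?thesis using x(1) by blast
qed

lemma sel_seq_meets:
  assumes "C \<subseteq> M" "C \<noteq> {}"
  shows "C \<inter> cell (sel_seq C k) \<noteq> {}"
proof (induction k)
  case (Suc k)
  from LeastI_ex[OF cell_extend[OF this]] show ?case by simp
qed (use assms in \<open>auto simp: cell_def\<close>)

lemma selected_unique:
  assumes "selected C x" "selected C y" "x \<in> M" "y \<in> M"
  shows "x = y"
proof (rule eq_if_close[OF assms(3,4)])
  fix k
  have "d (q (sel_index C k)) x \<le> eps k" "d (q (sel_index C k)) y \<le> eps k"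
    using assms(1,2) by (auto simp: selected_def)
  then show "d x y \<le> 2 * eps k"
    using triangle[OF assms(3) q_in assms(4), of "sel_index C k"] commute[of x "q (sel_index C k)"] by simp
qed

text \<open>Any finitely many of the chosen balls have a common point in \<open>C\<close>. Comparing
  centres through such points makes the centres a Cauchy sequence, and its limit cannot keep a
  positive distance from the closed set \<open>C\<close>.\<close>

lemma selected_exists:
  assumes C: "closedin mtopology C" "C \<noteq> {}"
  shows "\<exists>y\<in>C. selected C y"
proof -
  have CM: "C \<subseteq> M" using closedin_subset[OF C(1)] by simp
  define p where "p k = q (sel_index C k)" for k
  have "\<exists>x\<in>C. \<forall>i<k. d (p i) x < eps i" for k
    using sel_seq_meets[OF CM C(2), of k] by (auto simp: cell_def sel_seq_eq p_def)
  then obtain c where c: "\<And>k. c k \<in> C" "\<And>k i. i < k \<Longrightarrow> d (p i) (c k) < eps i" by metis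
  have pM: "p k \<in> M" for k using q_in by (simp add: p_def)
  have "d (p k) (p l) < eps k + eps l" for k l
  proof -
    let ?m = "Suc (max k l)"
    have "d (p k) (p l) \<le> d (p k) (c ?m) + d (c ?m) (p l)"
      using triangle[OF pM _ pM] c(1) CM by blast
    moreover have "d (p k) (c ?m) < eps k" "d (p l) (c ?m) < eps l"
      using c(2) by (simp_all add: less_Suc_eq_le)
    ultimately show ?thesis using commute[of "c ?m" "p l"] by simp
  qed
  then obtain y where y: "y \<in> M" "\<And>l. d (p l) y \<le> eps l"
    using limit_exists[of p] pM by metis
  have "y \<in> C"
  proof (rule ccontr)
    assume "y \<notin> C"
    then obtain r where r: "r > 0" "disjnt C (mball y r)"
      using C(1) y(1) unfolding closedin_metric by blast
    obtain k where k: "eps k < r / 2" using eps_less[of "r / 2"] r(1) by auto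
    have ck: "c (Suc k) \<in> M" using c(1) CM by blast
    have "d y (c (Suc k)) \<le> d y (p k) + d (p k) (c (Suc k))" using triangle[OF y(1) pM ck] .
    then have "d y (c (Suc k)) < r" using y(2)[of k] c(2)[of k "Suc k"] commute[of y "p k"] k by simp
    then show False using r(2) c(1)[of "Suc k"] y(1) ck by (auto simp: disjnt_iff)
  qed
  then show ?thesis using y(2) unfolding selected_def p_def by blast
qed

text \<open>That the least index is \<open>n\<close> means meeting the cell of \<open>n\<close> and
  missing those of all smaller indices. Cells are open, so these are finitely many events of the
  kind given by \<open>meas\<close>.\<close>

lemma sel_seq_measurable:
  assumes \<Phi>: "\<And>p. p \<in> space N \<Longrightarrow> \<Phi> p \<subseteq> M \<and> \<Phi> p \<noteq> {}"
    and meas: "\<And>U. openin mtopology U \<Longrightarrow> {p \<in> space N. \<Phi> p \<inter> U \<noteq> {}} \<in> sets N"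
  shows "{p \<in> space N. sel_seq (\<Phi> p) k = ns} \<in> sets N"
proof (induction k arbitrary: ns)
  case 0
  then show ?case by simp
next
  case (Suc k)
  show ?case
  proof (cases ns rule: rev_cases)
    case Nil
    then show ?thesis by simp
  next
    case (snoc ms n)
    let ?S = "\<lambda>m. {p \<in> space N. \<Phi> p \<inter> cell (ms @ [m]) \<noteq> {}}"
    have "(LEAST m. \<Phi> p \<inter> cell (ms @ [m]) \<noteq> {}) = n \<longleftrightarrow>
        \<Phi> p \<inter> cell (ms @ [n]) \<noteq> {} \<and> (\<forall>m<n. \<not> \<Phi> p \<inter> cell (ms @ [m]) \<noteq> {})"
      if "p \<in> space N" "sel_seq (\<Phi> p) k = ms" for p
    proof -
      have "\<exists>m. \<Phi> p \<inter> cell (ms @ [m]) \<noteq> {}"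
        using cell_extend sel_seq_meets[of "\<Phi> p" k] \<Phi>[OF that(1)] that(2) by metis
      then show ?thesis by (rule Least_eq_iff)
    qed
    then have "{p \<in> space N. sel_seq (\<Phi> p) (Suc k) = ns} =
        {p \<in> space N. sel_seq (\<Phi> p) k = ms} \<inter> (?S n - (\<Union>m\<in>{..<n}. ?S m))"
      unfolding snoc by auto
    moreover have "?S m \<in> sets N" for m by (rule meas[OF cell_openin])
    ultimately show ?thesis using Suc.IH[of ms] by (auto intro!: sets.Int sets.Diff sets.finite_UN)
  qed
qed

text \<open>Index sequences of a given length are countable in number, and once one is fixed the
  condition merely puts \<open>h p\<close> into a fixed closed ball.\<close>

lemma selected_measurable:
  assumes \<Phi>: "\<And>p. p \<in> space N \<Longrightarrow> \<Phi> p \<subseteq> M \<and> \<Phi> p \<noteq> {}"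
    and meas: "\<And>U. openin mtopology U \<Longrightarrow> {p \<in> space N. \<Phi> p \<inter> U \<noteq> {}} \<in> sets N"
    and h: "h \<in> measurable N (borel_of mtopology)"
  shows "{p \<in> space N. selected (\<Phi> p) (h p)} \<in> sets N"
proof -
  let ?S = "\<lambda>k ns. {p \<in> space N. sel_seq (\<Phi> p) (Suc k) = ns} \<inter> {p \<in> space N. h p \<in> mcball (q (last ns)) (eps k)}"
  have hM: "h p \<in> M" if "p \<in> space N" for p using measurable_space[OF h that] by simp
  have "{p \<in> space N. selected (\<Phi> p) (h p)} = (\<Inter>k. \<Union>ns. ?S k ns)"
    using hM q_in by (auto simp: selected_def sel_index_def)
  moreover have "?S k ns \<in> sets N" for k ns
  proof (intro sets.Int)
    show "{p \<in> space N. sel_seq (\<Phi> p) (Suc k) = ns} \<in> sets N"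
      using \<Phi> meas by (rule sel_seq_measurable)
    have "M - mcball (q (last ns)) (eps k) \<in> sets (borel_of mtopology)"
      using openin_borel_of[of mtopology] closedin_mcball[of "q (last ns)" "eps k"]
      by (auto simp: closedin_def)
    from sets.compl_sets[OF this] have "mcball (q (last ns)) (eps k) \<in> sets (borel_of mtopology)"
      by (simp add: Diff_Diff_Int Int_absorb1 mcball_subset_mspace)
    from measurable_sets[OF h this]
    show "{p \<in> space N. h p \<in> mcball (q (last ns)) (eps k)} \<in> sets N"
      by (simp add: vimage_def Int_def conj_commute)
  qed
  ultimately show ?thesis
    by (simp add: sets.countable_INT'' sets.countable_UN'')
qed

end

text \<open>The point selected from a coset depends on the coset only and not on its representative.
  So the pairs \<open>(x, y)\<close> in which \<open>y\<close> is the point selected from its own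
  coset contain exactly one point of every coset. Closedness of the subgroups makes the cosets
  closed, as the selection requires.\<close>

theorem borel_transversal:
  assumes Y: "polish_group Y \<tau>"
    and \<Sigma>: "\<And>x. x \<in> space N \<Longrightarrow> \<Sigma> x \<in> closed_subgroups Y \<tau>"
    and meas: "\<And>U. openin \<tau> U \<Longrightarrow> {x \<in> space N. \<Sigma> x \<inter> U \<noteq> {}} \<in> sets N"
  obtains T where "T \<in> sets (N \<Otimes>\<^sub>M borel_of \<tau>)"
    "\<And>x y. x \<in> space N \<Longrightarrow> y \<in> carrier Y \<Longrightarrow> \<exists>!y'. y' \<in> y <#\<^bsub>Y\<^esub> \<Sigma> x \<and> (x, y') \<in> T"
proof -
  interpret group Y using Y by (simp add: polish_group_def)
  have top: "topspace \<tau> = carrier Y" "polish_topology \<tau>"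
    and mult: "continuous_map (prod_topology \<tau> \<tau>) \<tau> (\<lambda>(x, y). x \<otimes>\<^bsub>Y\<^esub> y)"
    using Y by (auto simp: polish_group_def)
  obtain d q where dq: "polish_metric (topspace \<tau>) d q" "Metric_space.mtopology (topspace \<tau>) d = \<tau>"
    using polish_topologyE[OF top(2)] one_closed top(1) by blast
  interpret polish_metric "topspace \<tau>" d q by (rule dq(1))
  define N' where "N' = N \<Otimes>\<^sub>M borel_of \<tau>"
  have spN': "space N' = space N \<times> carrier Y" by (simp add: N'_def space_pair_measure top(1))
  define \<Phi> where "\<Phi> p = snd p <#\<^bsub>Y\<^esub> \<Sigma> (fst p)" for p
  have sub: "subgroup (\<Sigma> x) Y" "closedin \<tau> (\<Sigma> x)" if "x \<in> space N" for x
    using \<Sigma>[OF that] by (auto simp: closed_subgroups_def)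
  have \<Phi>_closed: "closedin \<tau> (\<Phi> p)" if p: "p \<in> space N'" for p
  proof -
    obtain x y where xy: "p = (x, y)" "x \<in> space N" "y \<in> carrier Y" using p spN' by auto
    have "continuous_map \<tau> (prod_topology \<tau> \<tau>) (\<lambda>z. (inv\<^bsub>Y\<^esub> y, z))"
      using xy(3) top(1) by (auto intro!: continuous_map_pairedI)
    from continuous_map_compose[OF this mult]
    have "continuous_map \<tau> \<tau> (\<lambda>z. inv\<^bsub>Y\<^esub> y \<otimes>\<^bsub>Y\<^esub> z)" by (simp add: o_def)
    from closedin_continuous_map_preimage[OF this sub(2)[OF xy(2)]]
    have "closedin \<tau> {z \<in> carrier Y. inv\<^bsub>Y\<^esub> y \<otimes>\<^bsub>Y\<^esub> z \<in> \<Sigma> x}" by (simp add: top(1))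
    moreover have "{z \<in> carrier Y. inv\<^bsub>Y\<^esub> y \<otimes>\<^bsub>Y\<^esub> z \<in> \<Sigma> x} = y <#\<^bsub>Y\<^esub> \<Sigma> x"
    proof (intro equalityI subsetI)
      fix z assume "z \<in> {z \<in> carrier Y. inv\<^bsub>Y\<^esub> y \<otimes>\<^bsub>Y\<^esub> z \<in> \<Sigma> x}"
      then have z: "z \<in> carrier Y" "inv\<^bsub>Y\<^esub> y \<otimes>\<^bsub>Y\<^esub> z \<in> \<Sigma> x" by auto
      have "z = y \<otimes>\<^bsub>Y\<^esub> (inv\<^bsub>Y\<^esub> y \<otimes>\<^bsub>Y\<^esub> z)" using z(1) xy(3) by (simp add: m_assoc[symmetric])
      then show "z \<in> y <#\<^bsub>Y\<^esub> \<Sigma> x" using z(2) unfolding l_coset_def by blast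
    next
      fix z assume "z \<in> y <#\<^bsub>Y\<^esub> \<Sigma> x"
      then obtain h where h: "h \<in> \<Sigma> x" "z = y \<otimes>\<^bsub>Y\<^esub> h" by (auto simp: l_coset_def)
      have "h \<in> carrier Y" by (rule subgroup.mem_carrier[OF sub(1)[OF xy(2)] h(1)])
      then show "z \<in> {z \<in> carrier Y. inv\<^bsub>Y\<^esub> y \<otimes>\<^bsub>Y\<^esub> z \<in> \<Sigma> x}"
        using h xy(3) by (simp add: m_assoc[symmetric])
    qed
    ultimately show ?thesis by (simp add: \<Phi>_def xy(1))
  qed
  have self: "y \<in> y <#\<^bsub>Y\<^esub> \<Sigma> x" if "x \<in> space N" "y \<in> carrier Y" for x y
    using subgroup.one_closed[OF sub(1)[OF that(1)]] that(2) unfolding l_coset_def by force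
  have \<Phi>: "\<Phi> p \<subseteq> topspace \<tau> \<and> \<Phi> p \<noteq> {}" if "p \<in> space N'" for p
    using closedin_subset[OF \<Phi>_closed[OF that]] self[of "fst p" "snd p"] that
    unfolding \<Phi>_def spN' by auto
  have \<Phi>_meas: "{p \<in> space N'. \<Phi> p \<inter> U \<noteq> {}} \<in> sets N'" if U: "openin \<tau> U" for U
  proof -
    \<comment> \<open>By continuity of multiplication, \<open>y <# \<Sigma> x\<close> meets
      \<open>U\<close> exactly if \<open>y\<close> and some element of \<open>\<Sigma> x\<close> lie
      in basic balls whose product is contained in \<open>U\<close>. This separates the condition on
      \<open>y\<close> from the one on \<open>x\<close>, leaving a countable union of
      rectangles.\<close>
    define I where "I = {(i, k, j, l). \<forall>a\<in>mball (q i) (eps k). \<forall>b\<in>mball (q j) (eps l). a \<otimes>\<^bsub>Y\<^esub> b \<in> U}"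
    define R where "R = (\<lambda>(i, k, j, l). {x \<in> space N. \<Sigma> x \<inter> mball (q j) (eps l) \<noteq> {}} \<times> mball (q i) (eps k))"
    have "{p \<in> space N'. \<Phi> p \<inter> U \<noteq> {}} = (\<Union>t\<in>I. R t)"
    proof (intro equalityI subsetI)
      fix p assume "p \<in> {p \<in> space N'. \<Phi> p \<inter> U \<noteq> {}}"
      then obtain x y h where p: "p = (x, y)" "x \<in> space N" "y \<in> carrier Y" "h \<in> \<Sigma> x" "y \<otimes>\<^bsub>Y\<^esub> h \<in> U"
        unfolding spN' \<Phi>_def l_coset_def by fastforce
      have h: "h \<in> carrier Y" by (rule subgroup.mem_carrier[OF sub(1)[OF p(2)] p(4)])
      have "openin (prod_topology \<tau> \<tau>) {z \<in> topspace (prod_topology \<tau> \<tau>). (case z of (x, y) \<Rightarrow> x \<otimes>\<^bsub>Y\<^esub> y) \<in> U}"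
        by (rule openin_continuous_map_preimage[OF mult U])
      moreover have "(y, h) \<in> {z \<in> topspace (prod_topology \<tau> \<tau>). (case z of (x, y) \<Rightarrow> x \<otimes>\<^bsub>Y\<^esub> y) \<in> U}"
        using p(3,5) h top(1) by simp
      ultimately obtain A B where AB: "openin \<tau> A" "openin \<tau> B" "y \<in> A" "h \<in> B"
        "A \<times> B \<subseteq> {z \<in> topspace (prod_topology \<tau> \<tau>). (case z of (x, y) \<Rightarrow> x \<otimes>\<^bsub>Y\<^esub> y) \<in> U}"
        unfolding openin_prod_topology_alt by meson
      obtain i k where ik: "y \<in> mball (q i) (eps k)" "mball (q i) (eps k) \<subseteq> A"
        using ball_base AB(1,3) dq(2) by metis
      obtain j l where jl: "h \<in> mball (q j) (eps l)" "mball (q j) (eps l) \<subseteq> B"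
        using ball_base AB(2,4) dq(2) by metis
      have "a \<otimes>\<^bsub>Y\<^esub> b \<in> U" if "a \<in> mball (q i) (eps k)" "b \<in> mball (q j) (eps l)" for a b
      proof -
        have "(a, b) \<in> A \<times> B" using that ik(2) jl(2) by blast
        from subsetD[OF AB(5) this] show ?thesis by simp
      qed
      then have "(i, k, j, l) \<in> I" by (simp add: I_def)
      moreover have "p \<in> R (i, k, j, l)" using p(1,2,4) ik(1) jl(1) by (auto simp: R_def)
      ultimately show "p \<in> (\<Union>t\<in>I. R t)" by blast
    next
      fix p assume "p \<in> (\<Union>t\<in>I. R t)"
      then obtain i k j l where *: "(i, k, j, l) \<in> I" "p \<in> R (i, k, j, l)" by auto
      then obtain x y where p: "p = (x, y)" "x \<in> space N" "\<Sigma> x \<inter> mball (q j) (eps l) \<noteq> {}"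
        "y \<in> mball (q i) (eps k)"
        unfolding R_def by blast
      from p(3) obtain h where h: "h \<in> \<Sigma> x" "h \<in> mball (q j) (eps l)" by blast
      have "y \<otimes>\<^bsub>Y\<^esub> h \<in> U" using *(1) h(2) p(4) unfolding I_def by blast
      moreover have "y \<otimes>\<^bsub>Y\<^esub> h \<in> \<Phi> p" using h(1) unfolding \<Phi>_def l_coset_def p(1) by auto
      moreover have "y \<in> carrier Y" using p(4) mball_subset_mspace unfolding top(1)[symmetric] by blast
      ultimately show "p \<in> {p \<in> space N'. \<Phi> p \<inter> U \<noteq> {}}"
        using p(1,2) unfolding spN' by blast
    qed
    moreover have "R t \<in> sets N'" for t
    proof -
      have ball: "openin \<tau> (mball x r)" for x r using openin_mball unfolding dq(2) .
      show ?thesis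
        unfolding R_def N'_def
        by (auto split: prod.splits intro!: pair_measureI meas openin_borel_of ball)
    qed
    ultimately show ?thesis by (simp add: sets.countable_UN' countableI_type image_subset_iff)
  qed
  define T where "T = {p \<in> space N'. selected (\<Phi> p) (snd p)}"
  have "T \<in> sets N'"
    unfolding T_def
    by (rule selected_measurable) (use \<Phi> \<Phi>_meas dq(2) in \<open>auto simp: N'_def\<close>)
  moreover have "\<exists>!y'. y' \<in> y <#\<^bsub>Y\<^esub> \<Sigma> x \<and> (x, y') \<in> T" if xy: "x \<in> space N" "y \<in> carrier Y" for x y
  proof -
    let ?C = "y <#\<^bsub>Y\<^esub> \<Sigma> x"
    have C: "closedin \<tau> ?C" "?C \<noteq> {}" using \<Phi>_closed[of "(x, y)"] \<Phi>[of "(x, y)"] xy by (auto simp: \<Phi>_def spN')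
    then have C': "?C \<subseteq> carrier Y" using closedin_subset top(1) by blast
    have "y' <#\<^bsub>Y\<^esub> \<Sigma> x = ?C" if "y' \<in> ?C" for y'
      using l_repr_independence[OF that xy(2) sub(1)[OF xy(1)]] by simp
    then have T_iff: "(x, y') \<in> T \<longleftrightarrow> selected ?C y'" if "y' \<in> ?C" for y'
      using that C' xy(1) by (auto simp: T_def spN' \<Phi>_def)
    obtain y' where "y' \<in> ?C" "selected ?C y'"
      using selected_exists[of ?C] C dq(2) by auto
    moreover have "y' = y''" if "y' \<in> ?C" "selected ?C y'" "y'' \<in> ?C" "selected ?C y''" for y' y''
      using selected_unique that C' top(1) by blast
    ultimately show ?thesis using T_iff by blast
  qed
  ultimately show ?thesis using that unfolding N'_def by blast
qed

section \<open>Invariant universality\<close>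

context gt_graphs
begin

lemma graph_embeds_imp_embedding:
  assumes c: "GT_coding num \<theta> c" and ST: "normal_tree S" "normal_tree T" "([], []) \<in> S"
    and emb: "graph_embeds (c S) (c T)"
  shows "\<exists>\<Phi>. gt_embedding num \<theta> S T \<Phi>"
proof -
  obtain g where g: "bij_betw g (V S) UNIV"
    "\<And>v w. v \<in> V S \<Longrightarrow> w \<in> V S \<Longrightarrow> (v, w) \<in> E S \<longleftrightarrow> (g v, g w) \<in> c S"
    using c ST(1) unfolding GT_coding_def by blast
  obtain h where h: "bij_betw h (V T) UNIV"
    "\<And>v w. v \<in> V T \<Longrightarrow> w \<in> V T \<Longrightarrow> (v, w) \<in> E T \<longleftrightarrow> (h v, h w) \<in> c T"
    using c ST(2) unfolding GT_coding_def by blast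
  obtain f where f: "inj f" "\<And>x y. (x, y) \<in> c S \<longleftrightarrow> (f x, f y) \<in> c T"
    using emb unfolding graph_embeds_def by blast
  let ?k = "the_inv_into (V T) h"
  have k: "h (?k n) = n" "?k n \<in> V T" for n
    using h(1) f_the_inv_into_f_bij_betw[of h "V T" UNIV n] bij_betw_the_inv_into[OF h(1)]
    by (auto simp: bij_betw_def)
  have "gt_embedding num \<theta> S T (\<lambda>v. ?k (f (g v)))"
  proof
    show "inj_on (\<lambda>v. ?k (f (g v))) (V S)"
    proof (rule inj_onI)
      fix v w assume "v \<in> V S" "w \<in> V S" "?k (f (g v)) = ?k (f (g w))"
      moreover from this(3) have "f (g v) = f (g w)" using k(1) by metis
      ultimately show "v = w" using f(1) g(1) by (meson bij_betw_imp_inj_on injD inj_onD)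
    qed
    fix v w assume vw: "(v, w) \<in> E S"
    then have "v \<in> V S" "w \<in> V S" using edge_vertices edge_sym by blast+
    then have "(f (g v), f (g w)) \<in> c T" using vw g(2) f(2) by blast
    then show "(?k (f (g v)), ?k (f (g w))) \<in> E T" using h(2)[OF k(2) k(2)] k(1) by simp
  qed (use ST in auto)
  then show ?thesis by blast
qed

lemma graph_embedsI:
  assumes c: "GT_coding num \<theta> c" and ST: "normal_tree S" "normal_tree T"
    and \<Phi>: "inj \<Phi>" "\<Phi> ` V S \<subseteq> V T"
      "\<And>v w. v \<in> V S \<Longrightarrow> w \<in> V S \<Longrightarrow> (v, w) \<in> E S \<longleftrightarrow> (\<Phi> v, \<Phi> w) \<in> E T"
  shows "graph_embeds (c S) (c T)"
proof -
  obtain g where g: "bij_betw g (V S) UNIV"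
    "\<And>v w. v \<in> V S \<Longrightarrow> w \<in> V S \<Longrightarrow> (v, w) \<in> E S \<longleftrightarrow> (g v, g w) \<in> c S"
    using c ST(1) unfolding GT_coding_def by blast
  obtain h where h: "bij_betw h (V T) UNIV"
    "\<And>v w. v \<in> V T \<Longrightarrow> w \<in> V T \<Longrightarrow> (v, w) \<in> E T \<longleftrightarrow> (h v, h w) \<in> c T"
    using c ST(2) unfolding GT_coding_def by blast
  let ?k = "the_inv_into (V S) g"
  have k: "g (?k n) = n" "?k n \<in> V S" for n
    using f_the_inv_into_f_bij_betw[of g "V S" UNIV n] bij_betw_the_inv_into[OF g(1)] g(1)
    by (auto simp: bij_betw_def)
  have \<Phi>k: "\<Phi> (?k n) \<in> V T" for n using \<Phi>(2) k(2) by blast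
  show ?thesis unfolding graph_embeds_def
  proof (intro exI[of _ "\<lambda>n. h (\<Phi> (?k n))"] conjI allI)
    show "inj (\<lambda>n. h (\<Phi> (?k n)))"
    proof (rule injI)
      fix m n assume "h (\<Phi> (?k m)) = h (\<Phi> (?k n))"
      then have "\<Phi> (?k m) = \<Phi> (?k n)" using inj_onD[OF bij_betw_imp_inj_on[OF h(1)]] \<Phi>k by blast
      then have "?k m = ?k n" using \<Phi>(1) by (simp add: inj_eq)
      then show "m = n" using k(1) by metis
    qed
    show "(x, y) \<in> c S \<longleftrightarrow> (h (\<Phi> (?k x)), h (\<Phi> (?k y))) \<in> c T" for x y
      using g(2)[OF k(2) k(2)] \<Phi>(3)[OF k(2) k(2)] h(2)[OF \<Phi>k \<Phi>k] k(1) by simp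
  qed
qed

text \<open>Equal codes are one and the same graph, so the two coding bijections compose to an
  isomorphism. Used in both directions it shows that the coding is injective on normal trees
  containing the root.\<close>

lemma coding_subset:
  assumes c: "GT_coding num \<theta> c" and ST: "normal_tree S" "normal_tree T" "([], []) \<in> S"
    and eq: "c S = c T"
  shows "S \<subseteq> T"
proof -
  obtain g where g: "bij_betw g (V S) UNIV"
    "\<And>v w. v \<in> V S \<Longrightarrow> w \<in> V S \<Longrightarrow> (v, w) \<in> E S \<longleftrightarrow> (g v, g w) \<in> c S"
    using c ST(1) unfolding GT_coding_def by blast
  obtain h where h: "bij_betw h (V T) UNIV"
    "\<And>v w. v \<in> V T \<Longrightarrow> w \<in> V T \<Longrightarrow> (v, w) \<in> E T \<longleftrightarrow> (h v, h w) \<in> c T"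
    using c ST(2) unfolding GT_coding_def by blast
  let ?k = "the_inv_into (V T) h"
  have k: "h (?k n) = n" "?k n \<in> V T" for n
    using f_the_inv_into_f_bij_betw[of h "V T" UNIV n] bij_betw_the_inv_into[OF h(1)] h(1)
    by (auto simp: bij_betw_def)
  have bij: "bij_betw (\<lambda>v. ?k (g v)) (V S) (V T)"
    using bij_betw_trans[OF g(1) bij_betw_the_inv_into[OF h(1)]] by (simp add: o_def)
  have E_iff: "(v, w) \<in> E S \<longleftrightarrow> (?k (g v), ?k (g w)) \<in> E T" if "v \<in> V S" "w \<in> V S" for v w
    using g(2)[OF that] h(2)[OF k(2) k(2)] k(1) eq by simp
  have "gt_isomorphism num \<theta> S T (\<lambda>v. ?k (g v))"
  proof
    show "(?k (g v), ?k (g w)) \<in> E T" if "(v, w) \<in> E S" for v w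
      using that E_iff edge_vertices edge_sym by blast
    show "inj_on (\<lambda>v. ?k (g v)) (V S)" "(\<lambda>v. ?k (g v)) ` V S = V T"
      using bij by (auto simp: bij_betw_def)
    show "(v, w) \<in> E S" if "v \<in> V S" "w \<in> V S" "(?k (g v), ?k (g w)) \<in> E T" for v w
      using that E_iff by blast
  qed (use ST in auto)
  then show ?thesis by (rule gt_isomorphism.isomorphism_imp_subset)
qed

end

section \<open>Analytic relations transported to the Cantor space\<close>

lemma closed_contains_pair:
  fixes x :: "nat \<Rightarrow> 'a::discrete_topology" and y :: "nat \<Rightarrow> 'b::discrete_topology"
    and \<alpha> :: "nat \<Rightarrow> 'c::discrete_topology"
  assumes "closed C"
    "\<And>n. \<exists>x' y' \<beta>. ((x', y'), \<beta>) \<in> C \<and> (\<forall>i<n. x' i = x i \<and> y' i = y i \<and> \<beta> i = \<alpha> i)"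
  shows "((x, y), \<alpha>) \<in> C"
proof (rule ccontr)
  assume "((x, y), \<alpha>) \<notin> C"
  then obtain A B where AB: "open A" "open B" "((x, y), \<alpha>) \<in> A \<times> B" "A \<times> B \<subseteq> - C"
    using open_prod_elim[of "- C" "((x, y), \<alpha>)"] assms(1) by (auto simp: open_Compl)
  obtain A1 A2 where A: "open A1" "open A2" "(x, y) \<in> A1 \<times> A2" "A1 \<times> A2 \<subseteq> A"
    using open_prod_elim[of A "(x, y)"] AB(1,3) by auto
  obtain F1 where F1: "finite F1" "{z. \<forall>i\<in>F1. z i = x i} \<subseteq> A1" using cylinder_subset A(1,3) by blast
  obtain F2 where F2: "finite F2" "{z. \<forall>i\<in>F2. z i = y i} \<subseteq> A2" using cylinder_subset A(2,3) by blast
  obtain G where G: "finite G" "{z. \<forall>i\<in>G. z i = \<alpha> i} \<subseteq> B" using cylinder_subset AB(2,3) by blast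
  obtain n where n: "F1 \<union> F2 \<union> G \<subseteq> {..<n}"
    using F1(1) F2(1) G(1) finite_nat_iff_bounded[of "F1 \<union> F2 \<union> G"] by auto
  obtain x' y' \<beta> where C: "((x', y'), \<beta>) \<in> C" "\<forall>i<n. x' i = x i \<and> y' i = y i \<and> \<beta> i = \<alpha> i"
    using assms(2) by blast
  have "x' \<in> A1" by (rule subsetD[OF F1(2)]) (use n C(2) in auto)
  moreover have "y' \<in> A2" by (rule subsetD[OF F2(2)]) (use n C(2) in auto)
  moreover have "\<beta> \<in> B" by (rule subsetD[OF G(2)]) (use n C(2) in auto)
  ultimately have "((x', y'), \<beta>) \<in> A \<times> B" using A(4) by blast
  then show False using C(1) AB(4) by blast
qed

text \<open>Decoding is Borel on the Borel set of codes. Hence the Borel witness for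
  \<open>R\<close> pulls back to one between sequence spaces, where it can be replaced by a closed
  one.\<close>

lemma analytic_in_code_image:
  assumes code: "cantor_code X e j D" and R: "analytic_in (X \<Otimes>\<^sub>M X) R" "R \<subseteq> space X \<times> space X"
  shows "analytic_set ((\<lambda>(x, y). (e x, e y)) ` R)"
proof -
  obtain B where B: "B \<in> sets ((X \<Otimes>\<^sub>M X) \<Otimes>\<^sub>M (borel :: (nat \<Rightarrow> nat) measure))" "R = fst ` B"
    using R(1) unfolding analytic_in_def by blast
  define K :: "(((nat \<Rightarrow> bool) \<times> (nat \<Rightarrow> bool)) \<times> (nat \<Rightarrow> nat)) set"
    where "K = {p. fst (fst p) \<in> D \<and> snd (fst p) \<in> D}"
  have proj: "(\<lambda>p :: ((nat \<Rightarrow> bool) \<times> (nat \<Rightarrow> bool)) \<times> (nat \<Rightarrow> nat). fst (fst p)) \<in> measurable borel borel"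
    "(\<lambda>p :: ((nat \<Rightarrow> bool) \<times> (nat \<Rightarrow> bool)) \<times> (nat \<Rightarrow> nat). snd (fst p)) \<in> measurable borel borel"
    using measurable_compose[OF measurable_fst_borel measurable_fst_borel]
      measurable_compose[OF measurable_fst_borel measurable_snd_borel] by blast+
  have K: "K \<in> sets borel"
    using sets.Int[OF measurable_sets[OF proj(1) cantor_codeD(2)[OF code]]
        measurable_sets[OF proj(2) cantor_codeD(2)[OF code]]]
    by (simp add: K_def vimage_def Int_def)
  define m :: "_ \<Rightarrow> ('a \<times> 'a) \<times> (nat \<Rightarrow> nat)" where "m p = ((j (fst (fst p)), j (snd (fst p))), snd p)" for p
  have "m \<in> measurable (restrict_space borel K) ((X \<Otimes>\<^sub>M X) \<Otimes>\<^sub>M borel)"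
  proof -
    have "(\<lambda>p. fst (fst p)) \<in> measurable (restrict_space borel K) (restrict_space borel D)"
      "(\<lambda>p. snd (fst p)) \<in> measurable (restrict_space borel K) (restrict_space borel D)"
      by (rule measurable_restrict_space2[OF _ measurable_restrict_space1[OF proj(1)]]
          measurable_restrict_space2[OF _ measurable_restrict_space1[OF proj(2)]],
          simp add: K_def space_restrict_space)+
    from this[THEN measurable_compose[OF _ cantor_codeD(3)[OF code]]]
    show ?thesis unfolding m_def
      by (intro measurable_Pair measurable_restrict_space1[OF measurable_snd_borel])
  qed
  from measurable_sets[OF this B(1)] have "K \<inter> m -` B \<in> sets borel"
    using K by (simp add: sets_restrict_space_iff space_restrict_space Int_commute)
  then have "analytic_set (fst ` (K \<inter> m -` B))"
    by (rule analytic_set_fst_image[where w = "\<lambda>\<alpha>. \<alpha>"]) auto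
  moreover have "fst ` (K \<inter> m -` B) = (\<lambda>(x, y). (e x, e y)) ` R"
  proof (intro equalityI subsetI)
    fix z assume "z \<in> fst ` (K \<inter> m -` B)"
    then obtain u v \<beta> where *: "z = (u, v)" "u \<in> D" "v \<in> D" "((j u, j v), \<beta>) \<in> B"
      by (auto simp: K_def m_def)
    then have "(j u, j v) \<in> R" unfolding B(2) by force
    then show "z \<in> (\<lambda>(x, y). (e x, e y)) ` R"
      using * cantor_codeD(6)[OF code] by (auto intro!: image_eqI[of _ _ "(j u, j v)"])
  next
    fix z assume "z \<in> (\<lambda>(x, y). (e x, e y)) ` R"
    then obtain x y where xy: "z = (e x, e y)" "(x, y) \<in> R" by auto
    then obtain \<beta> where \<beta>: "((x, y), \<beta>) \<in> B" by (auto simp: B(2))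
    have "x \<in> space X" "y \<in> space X" using xy(2) R(2) by auto
    then have "((e x, e y), \<beta>) \<in> K \<inter> m -` B"
      using \<beta> cantor_codeD(4,5)[OF code] by (simp add: K_def m_def)
    then show "z \<in> fst ` (K \<inter> m -` B)" using xy(1) by force
  qed
  ultimately show ?thesis by simp
qed

text \<open>A closed set contains every point all of whose initial segments can be extended into it,
  so the finite approximations of its members determine \<open>Q\<close>.\<close>

lemma sequence_tree_exists:
  assumes Q: "analytic_set Q" and trans: "trans Q"
  shows "\<exists>tr. sequence_tree tr Q"
proof -
  obtain C :: "(((nat \<Rightarrow> bool) \<times> (nat \<Rightarrow> bool)) \<times> (nat \<Rightarrow> nat)) set" where C: "closed C" "Q = fst ` C"
    using Q unfolding analytic_set_def by blast
  define tr where "tr u v s \<longleftrightarrow> (\<exists>x y \<alpha>. ((x, y), \<alpha>) \<in> C \<and> u = initial x (length s) \<and>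
    v = initial y (length s) \<and> s = initial \<alpha> (length s))" for u v s
  have "sequence_tree tr Q"
  proof
    show "length u = length s \<and> length v = length s" if "tr u v s" for u v s
    proof -
      obtain x y where "u = initial x (length s)" "v = initial y (length s)"
        using \<open>tr u v s\<close> unfolding tr_def by blast
      then show ?thesis by (metis length_map length_upt minus_nat.diff_0)
    qed
    show "tr (take m u) (take m v) (take m s)" if "tr u v s" for u v s m
    proof -
      obtain x y \<alpha> n where *: "((x, y), \<alpha>) \<in> C" "u = initial x n" "v = initial y n" "s = initial \<alpha> n"
        using \<open>tr u v s\<close> unfolding tr_def by blast
      show ?thesis unfolding tr_def
        by (rule exI[of _ x], rule exI[of _ y], rule exI[of _ \<alpha>]) (simp add: * take_map min_def)
    qed
    show "(x, y) \<in> Q \<longleftrightarrow> (\<exists>\<alpha>. \<forall>n. tr (initial x n) (initial y n) (initial \<alpha> n))" for x y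
    proof
      assume "(x, y) \<in> Q"
      then obtain \<alpha> where "((x, y), \<alpha>) \<in> C" by (auto simp: C(2))
      then have "\<forall>n. tr (initial x n) (initial y n) (initial \<alpha> n)" by (auto simp: tr_def)
      then show "\<exists>\<alpha>. \<forall>n. tr (initial x n) (initial y n) (initial \<alpha> n)" by blast
    next
      assume "\<exists>\<alpha>. \<forall>n. tr (initial x n) (initial y n) (initial \<alpha> n)"
      then obtain \<alpha> where \<alpha>: "\<And>n. tr (initial x n) (initial y n) (initial \<alpha> n)" by blast
      have "((x, y), \<alpha>) \<in> C"
      proof (rule closed_contains_pair[OF C(1)])
        fix n
        from \<alpha>[of n] obtain x' y' \<beta> where "((x', y'), \<beta>) \<in> C" "initial x n = initial x' n"
          "initial y n = initial y' n" "initial \<alpha> n = initial \<beta> n"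
          by (auto simp: tr_def simp del: map_eq_conv)
        then show "\<exists>x' y' \<beta>. ((x', y'), \<beta>) \<in> C \<and> (\<forall>i<n. x' i = x i \<and> y' i = y i \<and> \<beta> i = \<alpha> i)"
          unfolding initial_eq_iff by metis
      qed
      then show "(x, y) \<in> Q" by (force simp: C(2))
    qed
  qed (rule trans)
  then show ?thesis by blast
qed

text \<open>Whether a given pair belongs to the tree depends on finitely many digits of
  \<open>e x\<close> only.\<close>

lemma (in sequence_tree) tree_of_measurable:
  assumes e: "e \<in> measurable X (borel :: (nat \<Rightarrow> bool) measure)"
  shows "(\<lambda>x. tree_of (e x)) \<in> measurable X (restrict_space powerset_borel {T. normal_tree T})"
proof (rule measurable_restrict_space2)
  show "(\<lambda>x. tree_of (e x)) \<in> space X \<rightarrow> {T. normal_tree T}" by (simp add: normal_tree_of)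
  have init: "{x \<in> space X. initial (e x) n = w} \<in> sets X" for n w
  proof (cases "length w = n")
    case True
    then have "{x \<in> space X. initial (e x) n = w} = space X \<inter> (\<Inter>i\<in>{..<n}. {x \<in> space X. e x i = w ! i})" if "n > 0"
      using that by (auto simp: list_eq_iff_nth_eq)
    moreover have "\<dots> \<in> sets X" if "n > 0"
      using that by (intro sets.Int sets.top sets.finite_INT sets_coordinate[OF e]) auto
    ultimately show ?thesis using True by (cases "n > 0") auto
  next
    case False
    then have "{x \<in> space X. initial (e x) n = w} = {}" by auto
    then show ?thesis by (simp only: sets.empty_sets)
  qed
  show "(\<lambda>x. tree_of (e x)) \<in> measurable X powerset_borel"
    unfolding powerset_borel_def
  proof (rule measurable_vimage_algebra2)
    show "(\<lambda>x p. p \<in> tree_of (e x)) \<in> borel_measurable X"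
    proof (rule measurable_coordinatewise)
      fix p :: "bool list \<times> nat list"
      obtain u s where p: "p = (u, s)" by (cases p)
      have "{x \<in> space X. p \<in> tree_of (e x)} =
          (\<Union>w\<in>{w. chain u w s}. {x \<in> space X. initial (e x) (length s) = w})"
        unfolding p tree_of_def by auto
      also have "\<dots> \<in> sets X" using init by (intro sets.countable_UN' countableI_type) auto
      finally show "{x \<in> space X. p \<in> tree_of (e x)} \<in> sets X" .
    qed
  qed simp
qed

theorem theorem4p2:
  fixes num :: "nat list \<Rightarrow> nat" and \<theta> :: "bool list \<Rightarrow> nat"
    and c :: "(bool list \<times> nat list) set \<Rightarrow> nat rel"
    and Z :: "'z measure" and S E :: "'z rel" and f :: "nat rel \<Rightarrow> 'z"
    and Y :: "('y, 'm) monoid_scheme" and \<tau> :: "'y topology"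
    and W :: "'w measure" and a :: "'y \<Rightarrow> 'w \<Rightarrow> 'w" and g :: "'z \<Rightarrow> 'w"
  assumes "bij num"
    and "bij \<theta>" and "\<And>u v. length u < length v \<Longrightarrow> \<theta> u < \<theta> v"
    and "GT_coding num \<theta> c"
    and "standard_borel Z"
    and "analytic_quasi_order Z S"
    and "analytic_equivalence Z E" and "E \<subseteq> S \<inter> S\<inverse>"
    and "f \<in> measurable (coded_graphs c) Z"
    and "\<And>G H. G \<in> space (coded_graphs c) \<Longrightarrow> H \<in> space (coded_graphs c) \<Longrightarrow>
           graph_embeds G H \<longleftrightarrow> (f G, f H) \<in> S"
    and "\<And>G H. G \<in> space (coded_graphs c) \<Longrightarrow> H \<in> space (coded_graphs c) \<Longrightarrow>
           G = H \<longleftrightarrow> (f G, f H) \<in> E"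
    and "polish_group Y \<tau>"
    and "standard_borel W"
    and "borel_action Y \<tau> W a"
    and "borel_reduction Z E W (orbit_equivalence Y W a) g"
    and "(\<lambda>G. stabilizer Y a ((g \<circ> f) G)) \<in> measurable (coded_graphs c) (effros_subgroups Y \<tau>)"
  shows "invariantly_universal TYPE('r) Z S E"
  unfolding invariantly_universal_def
proof (intro allI impI)
  fix X :: "'r measure" and R
  assume XR: "standard_borel X \<and> analytic_quasi_order X R"
  interpret gt_graphs num \<theta> using assms(1-3) by unfold_locales
  interpret act: group_action Y "space W" a using assms(14) by (simp add: borel_action_def)
  have R: "R \<subseteq> space X \<times> space X" "refl_on (space X) R" "trans R" "analytic_in (X \<Otimes>\<^sub>M X) R"
    using XR by (auto simp: analytic_quasi_order_def preorder_on_def)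
  have S: "S \<subseteq> space Z \<times> space Z" "trans S"
    using assms(6) by (auto simp: analytic_quasi_order_def preorder_on_def)
  have E: "equiv (space Z) E" using assms(7) by (simp add: analytic_equivalence_def)
  obtain e j D where code: "cantor_code X e j D" using standard_borel_cantor_code XR by blast
  have e_inj: "e x = e y \<longleftrightarrow> x = y" if "x \<in> space X" "y \<in> space X" for x y
    using cantor_codeD(8)[OF code that] .
  define Q where "Q = (\<lambda>(x, y). (e x, e y)) ` R"
  have Q_code_iff: "(e x, e y) \<in> Q \<longleftrightarrow> (x, y) \<in> R" if "x \<in> space X" "y \<in> space X" for x y
  proof
    assume "(e x, e y) \<in> Q"
    then obtain x' y' where "(x', y') \<in> R" "e x = e x'" "e y = e y'" by (auto simp: Q_def)
    then show "(x, y) \<in> R" using e_inj that R(1) by blast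
  qed (force simp: Q_def)
  have "trans Q"
  proof (rule transI)
    fix u v w assume "(u, v) \<in> Q" "(v, w) \<in> Q"
    then obtain x y y' z where *: "u = e x" "v = e y" "v = e y'" "w = e z" "(x, y) \<in> R" "(y', z) \<in> R"
      unfolding Q_def by force
    moreover from this have "y = y'" using e_inj R(1) by blast
    ultimately have "(x, z) \<in> R" using R(3) by (meson transD)
    then show "(u, w) \<in> Q" using \<open>u = e x\<close> \<open>w = e z\<close> by (force simp: Q_def)
  qed
  then obtain tr where tr: "sequence_tree tr Q"
    using sequence_tree_exists analytic_in_code_image[OF code R(4,1)] unfolding Q_def by blast
  interpret sequence_tree tr Q by (rule tr)
  define G where "G x = c (tree_of (e x))" for x
  have c_meas: "c \<in> measurable (restrict_space powerset_borel {T. normal_tree T})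
      (restrict_space powerset_borel graphs_on_nat)"
    using assms(4) by (simp add: GT_coding_def)
  have G_meas: "G \<in> measurable X (coded_graphs c)"
    unfolding coded_graphs_def
  proof (rule measurable_restrict_space2)
    show "G \<in> space X \<rightarrow> c ` {T. normal_tree T}" using normal_tree_of by (auto simp: G_def)
    have "G \<in> measurable X (restrict_space powerset_borel graphs_on_nat)"
      unfolding G_def using tree_of_measurable[OF cantor_codeD(1)[OF code]] c_meas
      by (rule measurable_compose)
    then show "G \<in> measurable X powerset_borel"
      unfolding measurable_restrict_space2_iff by blast
  qed
  have G_space: "G x \<in> space (coded_graphs c)" if "x \<in> space X" for x
    using measurable_space[OF G_meas that] .
  have G_embeds: "graph_embeds (G x) (G y) \<longleftrightarrow> (x, y) \<in> R" if xy: "x \<in> space X" "y \<in> space X" for x y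
  proof
    assume "graph_embeds (G x) (G y)"
    then obtain \<Phi> where "gt_embedding num \<theta> (tree_of (e x)) (tree_of (e y)) \<Phi>"
      using graph_embeds_imp_embedding[OF assms(4) normal_tree_of normal_tree_of Nil_in_tree_of]
      unfolding G_def by blast
    then interpret gt_embedding num \<theta> "tree_of (e x)" "tree_of (e y)" \<Phi> .
    \<comment> \<open>\<open>Q\<close> relates codes of points of \<open>X\<close> only, so its
      reflexivity is available just at such codes. It takes care of chains consisting of trivial
      links.\<close>
    have "(e x, e x) \<in> Q" using Q_code_iff xy(1) R(2) by (auto simp: refl_on_def)
    then have "(e x, e y) \<in> Q"
      using tree_of_embedding_imp[of node_map "e x" "e y"] length_node_map node_map_snoc node_map_embeds
      by blast
    then show "(x, y) \<in> R" using Q_code_iff xy by blast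
  next
    assume "(x, y) \<in> R"
    then have "(e x, e y) \<in> Q" using Q_code_iff xy by blast
    then obtain \<beta> where \<beta>: "\<And>u s. (u, s) \<in> tree_of (e x) \<Longrightarrow>
        (u, map2 (+) s (initial \<beta> (length s))) \<in> tree_of (e y)"
      using tree_of_shift by metis
    \<comment> \<open>Adding \<open>\<beta>\<close> maps one tree into the other but may decrease
      \<open>num\<close>. As the target tree is normal, any \<open>h\<close> above this shift still
      maps into it.\<close>
    obtain h where h: "inj h" "h [] = []" "\<And>s n. \<exists>m. h (s @ [n]) = h s @ [m]"
      "\<And>s. num s \<le> num (h s)" "\<And>s. list_all2 (\<le>) (map2 (+) s (initial \<beta> (length s))) (h s)"
      using dominating_node_map[of num \<beta>] bij_num by (metis bij_is_inj)
    have "(u, h s) \<in> tree_of (e y)" if "(u, s) \<in> tree_of (e x)" for u s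
      using \<beta>[OF that] h(5)[of s] normal_tree_of[of "e y"] unfolding normal_tree_def by blast
    from embedding_of_node_map[OF h(1-4) this]
    obtain \<Phi> where "inj \<Phi>" "\<Phi> ` GT_vertices num \<theta> (tree_of (e x)) \<subseteq> GT_vertices num \<theta> (tree_of (e y))"
      "\<And>v w. v \<in> GT_vertices num \<theta> (tree_of (e x)) \<Longrightarrow> w \<in> GT_vertices num \<theta> (tree_of (e x)) \<Longrightarrow>
        (v, w) \<in> GT_edges num \<theta> (tree_of (e x)) \<longleftrightarrow> (\<Phi> v, \<Phi> w) \<in> GT_edges num \<theta> (tree_of (e y))"
      by metis
    then show "graph_embeds (G x) (G y)"
      unfolding G_def by (rule graph_embedsI[OF assms(4) normal_tree_of normal_tree_of])
  qed
  have G_inj: "x = y" if "x \<in> space X" "y \<in> space X" "G x = G y" for x y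
  proof -
    have "tree_of (e x) = tree_of (e y)"
      using coding_subset[OF assms(4) normal_tree_of normal_tree_of Nil_in_tree_of] that(3)
      unfolding G_def by (metis subset_antisym)
    then show ?thesis using tree_of_inject e_inj that by blast
  qed
  define \<phi> where "\<phi> x = f (G x)" for x
  have \<phi>_meas: "\<phi> \<in> measurable X Z" unfolding \<phi>_def using G_meas assms(9) by (rule measurable_compose)
  have \<phi>_space: "\<phi> x \<in> space Z" if "x \<in> space X" for x using measurable_space[OF \<phi>_meas that] .
  have \<phi>_S: "(\<phi> x, \<phi> y) \<in> S \<longleftrightarrow> (x, y) \<in> R" if "x \<in> space X" "y \<in> space X" for x y
    using assms(10)[OF G_space G_space] G_embeds that unfolding \<phi>_def by blast
  have \<phi>_E: "x = y" if "x \<in> space X" "y \<in> space X" "(\<phi> x, \<phi> y) \<in> E" for x y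
    using assms(11)[OF G_space G_space] G_inj that unfolding \<phi>_def by blast
  have g_meas: "g \<in> measurable Z W"
    and g_E: "\<And>x y. x \<in> space Z \<Longrightarrow> y \<in> space Z \<Longrightarrow> (x, y) \<in> E \<longleftrightarrow> g y \<in> orbit Y a (g x)"
    using assms(15) measurable_space[of g Z W]
    by (auto simp: borel_reduction_def orbit_equivalence_def)
  have g\<phi>: "g (\<phi> x) \<in> space W" if "x \<in> space X" for x
    using measurable_space[OF g_meas \<phi>_space[OF that]] .
  define \<Sigma> where "\<Sigma> x = stabilizer Y a (g (\<phi> x))" for x
  have \<Sigma>_meas: "\<Sigma> \<in> measurable X (effros_subgroups Y \<tau>)"
    using measurable_compose[OF G_meas assms(16)] by (simp add: \<Sigma>_def[abs_def] \<phi>_def)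
  have effros: "{{H \<in> closed_subgroups Y \<tau>. H \<inter> U \<noteq> {}} |U. openin \<tau> U} \<subseteq> Pow (closed_subgroups Y \<tau>)"
    by auto
  \<comment> \<open>The action is merely Borel, so closedness of stabilizers is not a matter of
    continuity. It is read off from the target space of the Borel stabilizer map.\<close>
  have \<Sigma>: "\<Sigma> x \<in> closed_subgroups Y \<tau>" if "x \<in> space X" for x
    using measurable_space[OF \<Sigma>_meas that] effros by (simp add: effros_subgroups_def space_measure_of_conv)
  have \<Sigma>_open: "{x \<in> space X. \<Sigma> x \<inter> U \<noteq> {}} \<in> sets X" if "openin \<tau> U" for U
  proof -
    have "{H \<in> closed_subgroups Y \<tau>. H \<inter> U \<noteq> {}} \<in> sets (effros_subgroups Y \<tau>)"
      unfolding effros_subgroups_def by (rule in_measure_of[OF effros]) (use that in blast)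
    from measurable_sets[OF \<Sigma>_meas this]
    have "\<Sigma> -` {H \<in> closed_subgroups Y \<tau>. H \<inter> U \<noteq> {}} \<inter> space X \<in> sets X" .
    moreover have "\<Sigma> -` {H \<in> closed_subgroups Y \<tau>. H \<inter> U \<noteq> {}} \<inter> space X = {x \<in> space X. \<Sigma> x \<inter> U \<noteq> {}}"
      using \<Sigma> by blast
    ultimately show ?thesis by simp
  qed
  obtain P where P: "P \<in> sets (X \<Otimes>\<^sub>M borel_of \<tau>)"
    "\<And>x y. x \<in> space X \<Longrightarrow> y \<in> carrier Y \<Longrightarrow> \<exists>!y'. y' \<in> y <#\<^bsub>Y\<^esub> \<Sigma> x \<and> (x, y') \<in> P"
    using borel_transversal[OF assms(12) \<Sigma> \<Sigma>_open] by metis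
  have top: "topspace \<tau> = carrier Y" "polish_topology \<tau>" using assms(12) by (auto simp: polish_group_def)
  have P_space: "x \<in> space X" "y \<in> carrier Y" if "(x, y) \<in> P" for x y
    using sets.sets_into_space[OF P(1)] that top(1) by (auto simp: space_pair_measure)
  define F where "F p = a (snd p) (g (\<phi> (fst p)))" for p
  have F_meas: "F \<in> measurable (X \<Otimes>\<^sub>M borel_of \<tau>) W"
  proof -
    have "(\<lambda>p. g (\<phi> (fst p))) \<in> measurable (X \<Otimes>\<^sub>M borel_of \<tau>) W"
      by (rule measurable_compose[OF measurable_fst measurable_compose[OF \<phi>_meas g_meas]])
    then have "(\<lambda>p. (snd p, g (\<phi> (fst p)))) \<in> measurable (X \<Otimes>\<^sub>M borel_of \<tau>) (borel_of \<tau> \<Otimes>\<^sub>M W)"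
      by (intro measurable_Pair measurable_snd)
    moreover have "(\<lambda>(y, w). a y w) \<in> measurable (borel_of \<tau> \<Otimes>\<^sub>M W) W"
      using assms(14) by (simp add: borel_action_def)
    ultimately have "(\<lambda>p. (\<lambda>(y, w). a y w) (snd p, g (\<phi> (fst p)))) \<in> measurable (X \<Otimes>\<^sub>M borel_of \<tau>) W"
      by (rule measurable_compose)
    then show ?thesis by (simp add: F_def[abs_def])
  qed
  have act_mult: "a (y \<otimes>\<^bsub>Y\<^esub> y') w = a y (a y' w)" if "w \<in> space W" "y \<in> carrier Y" "y' \<in> carrier Y" for y y' w
    using act.composition_rule that by blast
  interpret Y: group Y using assms(12) by (simp add: polish_group_def)
  have act_inv: "a (inv\<^bsub>Y\<^esub> y) (a y w) = w" if "w \<in> space W" "y \<in> carrier Y" for y w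
    using act.orbit_sym_aux that by blast
  \<comment> \<open>On a coset of the stabilizer the action is constant, so restricting
    \<open>F\<close> to the transversal \<open>P\<close> loses none of its values.\<close>
  have F_coset: "a (y \<otimes>\<^bsub>Y\<^esub> s) (g (\<phi> x)) = a y (g (\<phi> x))"
    if "x \<in> space X" "y \<in> carrier Y" "s \<in> \<Sigma> x" for x y s
    using that act_mult[OF g\<phi>] by (auto simp: \<Sigma>_def stabilizer_def)
  have F_inj: "inj_on F P"
  proof (rule inj_onI)
    fix p p' assume "p \<in> P" "p' \<in> P" and eq: "F p = F p'"
    then obtain x y x' y' where p: "p = (x, y)" "p' = (x', y')" and xy: "(x, y) \<in> P" "(x', y') \<in> P"
      by (cases p; cases p') auto
    note sp = P_space[OF xy(1)] P_space[OF xy(2)]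
    have eq': "a y (g (\<phi> x)) = a y' (g (\<phi> x'))" using eq by (simp add: F_def p)
    \<comment> \<open>This element is used twice. It carries \<open>g (\<phi> x)\<close> to
      \<open>g (\<phi> x')\<close>, so the two share an orbit and \<open>x = x'\<close>; then it
      stabilizes this point, so \<open>y\<close> and \<open>y'\<close> share a coset, which meets
      \<open>P\<close> only once.\<close>
    let ?t = "inv\<^bsub>Y\<^esub> y' \<otimes>\<^bsub>Y\<^esub> y"
    have t: "?t \<in> carrier Y" using sp by simp
    have t_act: "a ?t (g (\<phi> x)) = g (\<phi> x')"
      using act_mult[OF g\<phi>[OF sp(1)], of "inv\<^bsub>Y\<^esub> y'" y] eq' act_inv[OF g\<phi>[OF sp(3)] sp(4)] sp by simp
    then have "g (\<phi> x') \<in> orbit Y a (g (\<phi> x))" using t unfolding orbit_def by force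
    then have "x = x'" using g_E[OF \<phi>_space \<phi>_space] \<phi>_E sp by blast
    then have "?t \<in> \<Sigma> x" using t t_act by (simp add: \<Sigma>_def stabilizer_def)
    moreover have "y = y' \<otimes>\<^bsub>Y\<^esub> ?t" using sp by (simp add: Y.m_assoc[symmetric])
    ultimately have "y \<in> y' <#\<^bsub>Y\<^esub> \<Sigma> x" unfolding l_coset_def by blast
    moreover have "y' \<in> y' <#\<^bsub>Y\<^esub> \<Sigma> x"
    proof -
      have "\<one>\<^bsub>Y\<^esub> \<in> \<Sigma> x" using \<Sigma>[OF sp(1)] subgroup.one_closed by (auto simp: closed_subgroups_def)
      then show ?thesis using sp(4) unfolding l_coset_def by force
    qed
    ultimately have "y = y'" using P(2)[OF sp(1,4)] xy \<open>x = x'\<close> by blast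
    then show "p = p'" using p \<open>x = x'\<close> by simp
  qed
  obtain eW jW DW where codeW: "cantor_code W eW jW DW" using standard_borel_cantor_code assms(13) by blast
  have "standard_borel (borel_of \<tau>)" unfolding standard_borel_def using top(2) by auto
  then obtain eY jY DY where "cantor_code (borel_of \<tau>) eY jY DY" using standard_borel_cantor_code by blast
  then obtain e' j' D' where code': "cantor_code (X \<Otimes>\<^sub>M borel_of \<tau>) e' j' D'"
    using cantor_code_prod[OF code] by blast
  \<comment> \<open>One computation serves both needs: the whole of \<open>X\<close> gives the
    invariant set, and an arbitrary Borel \<open>A\<close> gives the preimages under the inverse
    reduction.\<close>
  define B where "B A = {z \<in> space Z. \<exists>x\<in>A. (\<phi> x, z) \<in> E}" for A
  have B_sets: "B A \<in> sets Z" if A: "A \<in> sets X" for A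
  proof -
    have AX: "A \<subseteq> space X" using A by (rule sets.sets_into_space)
    define PA where "PA = P \<inter> (A \<times> space (borel_of \<tau>))"
    have PA: "PA \<in> sets (X \<Otimes>\<^sub>M borel_of \<tau>)" unfolding PA_def using P(1) A by (intro sets.Int pair_measureI sets.top)
    have "F ` PA \<in> sets W"
      using lusin_souslin[OF code' codeW F_meas PA] inj_on_subset[OF F_inj] by (auto simp: PA_def)
    moreover have "B A = g -` (F ` PA) \<inter> space Z"
    proof (intro equalityI subsetI)
      fix z assume "z \<in> B A"
      then obtain x where x: "z \<in> space Z" "x \<in> A" "(\<phi> x, z) \<in> E" by (auto simp: B_def)
      have xX: "x \<in> space X" using x(2) AX by blast
      then obtain y where y: "y \<in> carrier Y" "g z = a y (g (\<phi> x))"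
        using x g_E[OF \<phi>_space] unfolding orbit_def by blast
      obtain y' where y': "y' \<in> y <#\<^bsub>Y\<^esub> \<Sigma> x" "(x, y') \<in> P" using P(2)[OF xX y(1)] by blast
      then obtain s where s: "s \<in> \<Sigma> x" "y' = y \<otimes>\<^bsub>Y\<^esub> s" by (auto simp: l_coset_def)
      have "F (x, y') = g z" using F_coset[OF xX y(1) s(1)] y(2) s(2) by (simp add: F_def)
      moreover have "(x, y') \<in> PA" using y'(2) x(2) P_space[OF y'(2)] top(1) by (simp add: PA_def)
      ultimately show "z \<in> g -` (F ` PA) \<inter> space Z" using x(1) by (metis IntI imageI vimageI)
    next
      fix z assume "z \<in> g -` (F ` PA) \<inter> space Z"
      then obtain x y where z: "z \<in> space Z" "(x, y) \<in> P" "x \<in> A" "g z = a y (g (\<phi> x))"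
        by (auto simp: PA_def F_def)
      then have "g z \<in> orbit Y a (g (\<phi> x))" using P_space[OF z(2)] unfolding orbit_def by blast
      then show "z \<in> B A" using z g_E[OF \<phi>_space] P_space[OF z(2)] unfolding B_def by blast
    qed
    ultimately show ?thesis using measurable_sets[OF g_meas] by simp
  qed
  let ?B = "B (space X)"
  have B_inv: "E `` ?B \<subseteq> ?B"
    using E unfolding B_def equiv_def trans_def by blast
  have E_refl: "(z, z) \<in> E" if "z \<in> space Z" for z using E that by (auto simp: equiv_def refl_on_def)
  have \<phi>_B: "\<phi> x \<in> ?B" if "x \<in> space X" for x
    using that E_refl[OF \<phi>_space] \<phi>_space unfolding B_def by blast
  have Bsub: "?B \<subseteq> space Z" by (auto simp: B_def)
  have "borel_reduction X R (restrict_space Z ?B) (S \<inter> ?B \<times> ?B) \<phi>"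
    unfolding borel_reduction_def
    using \<phi>_B \<phi>_S \<phi>_meas by (auto intro!: measurable_restrict_space2)
  moreover have "\<exists>r. borel_reduction (restrict_space Z ?B) (S \<inter> ?B \<times> ?B) X R r"
  proof -
    have "\<forall>z\<in>?B. \<exists>x\<in>space X. (\<phi> x, z) \<in> E" by (auto simp: B_def)
    \<comment> \<open>\<open>r\<close> comes from mere choice. It is Borel because the chosen point
      is unique, so that the preimage of \<open>A\<close> is \<open>B A\<close>.\<close>
    then obtain r where r: "\<And>z. z \<in> ?B \<Longrightarrow> r z \<in> space X \<and> (\<phi> (r z), z) \<in> E" by metis
    have r_unique: "x = r z" if "z \<in> ?B" "x \<in> space X" "(\<phi> x, z) \<in> E" for x z
    proof -
      have "(\<phi> x, \<phi> (r z)) \<in> E" using r[OF that(1)] that(3) E unfolding equiv_def by (meson symD transD)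
      then show ?thesis using \<phi>_E that(2) r[OF that(1)] by blast
    qed
    have "r \<in> measurable (restrict_space Z ?B) X"
    proof (rule measurableI)
      fix A assume A: "A \<in> sets X"
      have AX: "A \<subseteq> space X" using A by (rule sets.sets_into_space)
      have "r -` A \<inter> space (restrict_space Z ?B) = B A"
      proof (intro equalityI subsetI)
        fix z assume "z \<in> r -` A \<inter> space (restrict_space Z ?B)"
        then have "r z \<in> A" "z \<in> ?B" by (auto simp: space_restrict_space)
        then show "z \<in> B A" using r Bsub unfolding B_def by blast
      next
        fix z assume "z \<in> B A"
        then obtain x where x: "z \<in> space Z" "x \<in> A" "(\<phi> x, z) \<in> E" by (auto simp: B_def)
        then have "z \<in> ?B" "x \<in> space X" using AX by (auto simp: B_def)
        then show "z \<in> r -` A \<inter> space (restrict_space Z ?B)"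
          using r_unique x by (auto simp: space_restrict_space)
      qed
      moreover have "B A \<subseteq> ?B" using AX by (auto simp: B_def)
      ultimately show "r -` A \<inter> space (restrict_space Z ?B) \<in> sets (restrict_space Z ?B)"
        using B_sets[OF A] B_sets[OF sets.top[of X]] by (simp add: sets_restrict_space_iff)
    qed (use r in \<open>auto simp: space_restrict_space\<close>)
    moreover have "(z, z') \<in> S \<longleftrightarrow> (r z, r z') \<in> R" if "z \<in> ?B" "z' \<in> ?B" for z z'
    proof -
      \<comment> \<open>As \<open>E\<close> is contained in \<open>S\<close> and its converse,
        \<open>z\<close> and \<open>\<phi> (r z)\<close> are interchangeable with respect to
        \<open>S\<close>.\<close>
      have *: "(\<phi> (r z), z) \<in> S" "(z, \<phi> (r z)) \<in> S" "(\<phi> (r z'), z') \<in> S" "(z', \<phi> (r z')) \<in> S"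
        using r[OF that(1)] r[OF that(2)] assms(8) by auto
      have "(z, z') \<in> S \<longleftrightarrow> (\<phi> (r z), \<phi> (r z')) \<in> S" using * S(2) by (meson transD)
      then show ?thesis using \<phi>_S r that by blast
    qed
    ultimately have "borel_reduction (restrict_space Z ?B) (S \<inter> ?B \<times> ?B) X R r"
      unfolding borel_reduction_def using Bsub by (auto simp: space_restrict_space)
    then show ?thesis by blast
  qed
  ultimately have "borel_bireducible X R (restrict_space Z ?B) (S \<inter> ?B \<times> ?B)"
    unfolding borel_bireducible_def borel_reducible_def by blast
  then show "\<exists>B\<in>sets Z. E `` B \<subseteq> B \<and> borel_bireducible X R (restrict_space Z B) (S \<inter> B \<times> B)"
    using B_sets[OF sets.top] B_inv by blast
qed

end
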